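(* Fix $1<p<\infty$. Given a matrix weight $W:\mathbb{R}^n\to\mathcal{S}_d$, we have $W\in\mathcal{A}_p$ if and only if $$W=W_0^{1/p}\,W_1^{1/p'}$$ for some commuting matrix weights $W_0\in\mathcal{A}_1$ and $W_1\in\mathcal{A}_\infty$.
   Context: $\mathcal{S}_d$ is the set of $d\times d$ real symmetric positive semidefinite matrices. A matrix weight is a measurable map $W:\mathbb{R}^n\to\mathcal{S}_d$ such that $W(x)$ is positive definite for a.e. $x$. Two matrix weights commute if $W_0(x)W_1(x)=W_1(x)W_0(x)$ for a.e. $x$; powers of matrix weights are taken pointwise, and identities between weights hold a.e. Cubes $Q\subset\mathbb{R}^n$ have sides parallel to the coordinate axes, $\frac{1}{|Q|}\int_Q$ is the average with respect to Lebesgue measure, $|\cdot|_{\mathrm{op}}$ is the operator norm, and $1/p+1/p'=1$. For $1<p<\infty$, $W\in\mathcal{A}_p$ means $$[W]_{\mathcal{A}_p}=\sup_Q\Big(\frac{1}{|Q|}\int_Q\Big(\frac{1}{|Q|}\int_Q|W(x)W^{-1}(y)|_{\mathrm{op}}^{p'}\,dy\Big)^{p/p'}dx\Big)^{1/p}<\infty .$$ $W\in\mathcal{A}_1$ means $[W]_{\mathcal{A}_1}=\sup_Q\operatorname{ess\,sup}_{x\in Q}\frac{1}{|Q|}\int_Q|W^{-1}(x)W(y)|_{\mathrm{op}}\,dy<\infty$, and $W\in\mathcal{A}_\infty$ means $[W]_{\mathcal{A}_\infty}=\sup_Q\operatorname{ess\,sup}_{x\in Q}\frac{1}{|Q|}\int_Q|W(x)W^{-1}(y)|_{\mathrm{op}}\,dy<\infty$.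 *)

theory Defs
  imports "HOL-Analysis.Analysis" "HOL-Probability.Essential_Supremum"
begin

section \<open>Positive semidefinite matrices and their powers\<close>

definition psd_matrix :: "real^'d^'d \<Rightarrow> bool" where
  "psd_matrix A \<longleftrightarrow> transpose A = A \<and> (\<forall>v. 0 \<le> v \<bullet> (A *v v))"

definition pd_matrix :: "real^'d^'d \<Rightarrow> bool" where
  "pd_matrix A \<longleftrightarrow> transpose A = A \<and> (\<forall>v. v \<noteq> 0 \<longrightarrow> 0 < v \<bullet> (A *v v))"

definition diag_matrix :: "real^'d \<Rightarrow> real^'d^'d" where
  "diag_matrix l = (\<chi> i j. if i = j then l $ i else 0)"

text \<open>
  The power \<open>A\<^sup>s\<close> of a positive semidefinite matrix, by functional calculus: diagonalise \<open>A\<close>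
  orthogonally and raise the eigenvalues to the power \<open>s\<close>.  The result does not depend on the
  diagonalisation (lemma \<open>psd_powr_eqI\<close>).  It is only meant for \<open>s > 0\<close> when \<open>A\<close> is singular,
  since \<open>0 powr s = 0\<close> for every \<open>s\<close>.
\<close>

definition psd_powr :: "real^'d^'d \<Rightarrow> real \<Rightarrow> real^'d^'d" where
  "psd_powr A s = (THE B. \<exists>P l. orthogonal_matrix P \<and>
     A = P ** diag_matrix l ** transpose P \<and>
     B = P ** diag_matrix (\<chi> i. l $ i powr s) ** transpose P)"

lemma diag_matrix_mult_left: "(diag_matrix l ** M) $ i $ j = l $ i * M $ i $ j"
  by (simp add: diag_matrix_def matrix_matrix_mult_def if_distrib if_distribR sum.delta cong: if_cong)

lemma diag_matrix_mult_right: "(M ** diag_matrix l) $ i $ j = M $ i $ j * l $ j"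
  by (simp add: diag_matrix_def matrix_matrix_mult_def if_distrib if_distribR sum.delta cong: if_cong)

lemma orthogonal_conj_eq_iff:
  fixes P Q D E :: "real^'d^'d"
  assumes P: "orthogonal_matrix P" and Q: "orthogonal_matrix Q"
  shows "P ** D ** transpose P = Q ** E ** transpose Q \<longleftrightarrow>
    (transpose Q ** P) ** D = E ** (transpose Q ** P)"
proof -
  have P': "transpose P ** P = mat 1" "P ** transpose P = mat 1"
    and Q': "transpose Q ** Q = mat 1" "Q ** transpose Q = mat 1"
    using P Q by (auto simp: orthogonal_matrix_def)
  show ?thesis
  proof
    assume "P ** D ** transpose P = Q ** E ** transpose Q"
    then have "transpose Q ** (P ** D ** transpose P) ** P = transpose Q ** (Q ** E ** transpose Q) ** P"
      by simp
    then show "(transpose Q ** P) ** D = E ** (transpose Q ** P)"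
      by (metis P'(1) Q'(1) matrix_mul_assoc matrix_mul_lid matrix_mul_rid)
  next
    assume "(transpose Q ** P) ** D = E ** (transpose Q ** P)"
    then have "Q ** ((transpose Q ** P) ** D) ** transpose P = Q ** (E ** (transpose Q ** P)) ** transpose P"
      by simp
    then show "P ** D ** transpose P = Q ** E ** transpose Q"
      by (metis P'(2) Q'(2) matrix_mul_assoc matrix_mul_lid matrix_mul_rid)
  qed
qed

lemma psd_powr_eqI:
  fixes P :: "real^'d^'d"
  assumes P: "orthogonal_matrix P" and A: "A = P ** diag_matrix l ** transpose P"
  shows "psd_powr A s = P ** diag_matrix (\<chi> i. l $ i powr s) ** transpose P"
  unfolding psd_powr_def
proof (rule the_equality)
  show "\<exists>P' l'. orthogonal_matrix P' \<and> A = P' ** diag_matrix l' ** transpose P' \<and>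
      P ** diag_matrix (\<chi> i. l $ i powr s) ** transpose P =
      P' ** diag_matrix (\<chi> i. l' $ i powr s) ** transpose P'"
    using assms by blast
next
  fix B assume "\<exists>Q m. orthogonal_matrix Q \<and> A = Q ** diag_matrix m ** transpose Q \<and>
      B = Q ** diag_matrix (\<chi> i. m $ i powr s) ** transpose Q"
  then obtain Q m where Q: "orthogonal_matrix Q" and AQ: "A = Q ** diag_matrix m ** transpose Q"
    and B: "B = Q ** diag_matrix (\<chi> i. m $ i powr s) ** transpose Q" by blast
  define U where "U = transpose P ** Q"
  have "U ** diag_matrix m = diag_matrix l ** U"
    using A AQ orthogonal_conj_eq_iff[OF Q P] by (simp add: U_def)
  then have "U $ i $ j * m $ j = l $ i * U $ i $ j" for i j
    by (metis diag_matrix_mult_left diag_matrix_mult_right)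
  then have "U $ i $ j * m $ j powr s = l $ i powr s * U $ i $ j" for i j
    by (metis mult.commute mult_cancel_left)
  then have "U ** diag_matrix (\<chi> i. m $ i powr s) = diag_matrix (\<chi> i. l $ i powr s) ** U"
    by (simp add: vec_eq_iff diag_matrix_mult_left diag_matrix_mult_right)
  then show "B = P ** diag_matrix (\<chi> i. l $ i powr s) ** transpose P"
    using orthogonal_conj_eq_iff[OF Q P] by (simp add: U_def B)
qed

definition op_norm :: "real^'d^'d \<Rightarrow> real" where
  "op_norm A = onorm (\<lambda>v. A *v v)"

section \<open>Matrix weights\<close>

definition matrix_weight :: "(real^'n \<Rightarrow> real^'d^'d) \<Rightarrow> bool" where
  "matrix_weight W \<longleftrightarrow> W \<in> borel_measurable lebesgue \<and> (\<forall>x. psd_matrix (W x)) \<and>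
     (AE x in lebesgue. pd_matrix (W x))"

definition commuting_weights :: "(real^'n \<Rightarrow> real^'d^'d) \<Rightarrow> (real^'n \<Rightarrow> real^'d^'d) \<Rightarrow> bool" where
  "commuting_weights W\<^sub>0 W\<^sub>1 \<longleftrightarrow> (AE x in lebesgue. W\<^sub>0 x ** W\<^sub>1 x = W\<^sub>1 x ** W\<^sub>0 x)"

definition cubes :: "(real^'n) set set" where
  "cubes = {cbox a (\<chi> i. a $ i + h) | a h. 0 < h}"

definition average :: "(real^'n) set \<Rightarrow> (real^'n \<Rightarrow> ennreal) \<Rightarrow> ennreal" where
  "average Q f = (\<integral>\<^sup>+x\<in>Q. f x \<partial>lebesgue) / emeasure lebesgue Q"

text \<open>Powers of extended nonnegative reals, for exponents \<open>s > 0\<close> only.\<close>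

definition ennreal_powr :: "ennreal \<Rightarrow> real \<Rightarrow> ennreal" where
  "ennreal_powr x s = (if x = top then top else ennreal (enn2real x powr s))"

definition conj_exponent :: "real \<Rightarrow> real" where
  "conj_exponent p = p / (p - 1)"

lemma conj_exponent: "1 < p \<Longrightarrow> 1 / p + 1 / conj_exponent p = 1"
  by (simp add: conj_exponent_def field_simps)

definition Ap_characteristic :: "real \<Rightarrow> (real^'n \<Rightarrow> real^'d^'d) \<Rightarrow> ennreal" where
  "Ap_characteristic p W =
     (SUP Q\<in>cubes. ennreal_powr
        (average Q (\<lambda>x. ennreal_powr
           (average Q (\<lambda>y. ennreal (op_norm (W x ** matrix_inv (W y)) powr conj_exponent p)))
           (p / conj_exponent p)))
        (1 / p))"

definition A1_characteristic :: "(real^'n \<Rightarrow> real^'d^'d) \<Rightarrow> ennreal" where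
  "A1_characteristic W =
     (SUP Q\<in>cubes. esssup (restrict_space lebesgue Q)
        (\<lambda>x. average Q (\<lambda>y. ennreal (op_norm (matrix_inv (W x) ** W y)))))"

definition Ainf_characteristic :: "(real^'n \<Rightarrow> real^'d^'d) \<Rightarrow> ennreal" where
  "Ainf_characteristic W =
     (SUP Q\<in>cubes. esssup (restrict_space lebesgue Q)
        (\<lambda>x. average Q (\<lambda>y. ennreal (op_norm (W x ** matrix_inv (W y))))))"

definition matrix_Ap :: "real \<Rightarrow> (real^'n \<Rightarrow> real^'d^'d) set" where
  "matrix_Ap p = {W. matrix_weight W \<and> Ap_characteristic p W < \<infinity>}"

definition matrix_A1 :: "(real^'n \<Rightarrow> real^'d^'d) set" where
  "matrix_A1 = {W. matrix_weight W \<and> A1_characteristic W < \<infinity>}"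

definition matrix_Ainf :: "(real^'n \<Rightarrow> real^'d^'d) set" where
  "matrix_Ainf = {W. matrix_weight W \<and> Ainf_characteristic W < \<infinity>}"

end

theory Submission
  imports Defs
begin

text \<open>
  Write \<open>q = p'\<close> and \<open>\<kappa>(x, y) = \<bar>W(x) W\<^sup>-\<^sup>1(y)\<bar>\<close>.

  For the factorization of an \<open>A\<^sub>p\<close> weight it suffices to find a scalar \<open>t > 0\<close> with
  \<open>avg\<^sub>Q \<kappa>(x, \<cdot>) t \<le> C t(x)\<close> and \<open>avg\<^sub>Q \<kappa>(\<cdot>, x) t\<^sup>p\<^sup>-\<^sup>1 \<le> C t(x)\<^sup>p\<^sup>-\<^sup>1\<close>: then \<open>W\<^sub>0 = t\<^sup>p\<^sup>-\<^sup>1 W\<close> and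
  \<open>W\<^sub>1 = t\<^sup>-\<^sup>1 W\<close> commute, being scalar multiples of \<open>W\<close>.  Such a \<open>t\<close> comes from the Rubio de
  Francia iteration, once the Christ--Goldberg maximal operators with kernels \<open>\<kappa>(x, y)\<close> and
  \<open>\<kappa>(y, x)\<close> are bounded on \<open>L\<^sup>p\<close> and \<open>L\<^sup>q\<close>.  On a cube \<open>Q\<close> an approximate Auerbach basis separates
  the variables, \<open>\<kappa>(x, y)\<^sup>q \<le> \<Psi>\<^sub>Q(x) U\<^sub>Q(y)\<close> with \<open>\<Psi>\<^sub>Q(x) = avg\<^sub>Q \<kappa>(x, \<cdot>)\<^sup>q\<close> and \<open>avg\<^sub>Q U\<^sub>Q\<close> bounded.  A
  reverse Hoelder inequality for \<open>U\<^sub>Q\<close> reduces averages of \<open>\<kappa>(x, \<cdot>) h\<close> to averages of \<open>h\<^sup>s\<close> with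
  \<open>s < p\<close>, and the supremum of \<open>\<Psi>\<^sub>R\<close> over the cubes \<open>R\<close> inside \<open>Q\<close> is controlled by stopping where the
  average of \<open>U\<^sub>Q\<close> over \<open>R\<close> is large.

  Conversely, for commuting factors the norm of \<open>W(x) W\<^sup>-\<^sup>1(y)\<close> is log-convex in the exponent, so
  \<open>\<kappa>(x, y) \<le> \<bar>W\<^sub>0(x) W\<^sub>0\<^sup>-\<^sup>1(y)\<bar>\<^sup>1\<^sup>/\<^sup>p \<bar>W\<^sub>1(x) W\<^sub>1\<^sup>-\<^sup>1(y)\<bar>\<^sup>1\<^sup>/\<^sup>q\<close>; the average in \<open>y\<close> of the second factor is
  bounded, and an Auerbach basis bounds the first by an integrable function of \<open>x\<close> alone.
\<close>

section \<open>Powers of extended nonnegative reals and Hoelder's inequality\<close>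

text \<open>The obstacle is that \<Psi>_Q(x) still depends on Q after separation, so the maximal
  operator is not a weight times a scalar maximal function. What survives is a Carleson-type bound:
  the supremum over R inside Q of \<Psi>_R^(p/q) integrates to at most a constant times |Q|, and
  this is combined with the dyadic layers of a scalar maximal function. The reverse Hoelder gain
  rests on duality: for each fixed vector v, the dual bound makes |W^-1 v|^q a scalar A_infinity
  weight with constants independent of v. Stopping arguments need nested cells, so they run on
  shifted dyadic grids, every cube lying in a comparable cell of one of them, and over finite
  families, with monotone convergence at the end. The iteration needs p - 1 >= 1; for p < 2 it is
  applied to the inverse weight with exponent q. In the converse, complex interpolation is replaced
  by an eigenvalue argument at midpoints, where boundedness of a quotient does the work of
  continuity.\<close>

lemma ennreal_powr_ennreal: "0 \<le> a \<Longrightarrow> ennreal_powr (ennreal a) s = ennreal (a powr s)"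
  by (simp add: ennreal_powr_def)

lemma ennreal_powr_top [simp]: "ennreal_powr top s = top"
  by (simp add: ennreal_powr_def)

lemma ennreal_powr_zero [simp]: "ennreal_powr 0 s = 0"
  by (simp add: ennreal_powr_def)

lemma ennreal_powr_one [simp]: "ennreal_powr x 1 = x"
  by (cases x) (auto simp: ennreal_powr_def)

lemma ennreal_powr_eq_0_iff [simp]: "ennreal_powr x s = 0 \<longleftrightarrow> x = 0"
  by (cases x) (auto simp: ennreal_powr_ennreal)

lemma ennreal_powr_eq_top_iff [simp]: "ennreal_powr x s = top \<longleftrightarrow> x = top"
  by (cases x) (auto simp: ennreal_powr_ennreal)

lemma ennreal_powr_less_top_iff [simp]: "ennreal_powr x s < top \<longleftrightarrow> x < top"
  by (simp add: less_top[symmetric])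

lemma ennreal_powr_mult: "ennreal_powr (x * y) s = ennreal_powr x s * ennreal_powr y s"
proof (cases x; cases y)
  fix a b :: real assume "x = ennreal a" "0 \<le> a" "y = ennreal b" "0 \<le> b"
  then show ?thesis
    by (simp add: ennreal_powr_ennreal powr_mult flip: ennreal_mult)
qed (auto simp: ennreal_powr_ennreal ennreal_mult_top ennreal_top_mult)

lemma ennreal_powr_powr: "ennreal_powr (ennreal_powr x s) t = ennreal_powr x (s * t)"
  by (cases x) (auto simp: ennreal_powr_ennreal powr_powr)

lemma ennreal_powr_add: "ennreal_powr x (s + t) = ennreal_powr x s * ennreal_powr x t"
  by (cases x) (auto simp: ennreal_powr_ennreal powr_add simp flip: ennreal_mult)

lemma ennreal_powr_mono: "0 \<le> s \<Longrightarrow> x \<le> y \<Longrightarrow> ennreal_powr x s \<le> ennreal_powr y s"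
  by (cases x; cases y) (auto simp: ennreal_powr_ennreal powr_mono2 top_unique)

lemma ennreal_powr_le_iff: "0 < s \<Longrightarrow> ennreal_powr x s \<le> y \<longleftrightarrow> x \<le> ennreal_powr y (1 / s)"
  using ennreal_powr_mono[of "1/s" "ennreal_powr x s" y] ennreal_powr_mono[of s x "ennreal_powr y (1/s)"]
  by (auto simp: ennreal_powr_powr)

lemma measurable_ennreal_powr [measurable]:
  assumes [measurable]: "f \<in> borel_measurable M"
  shows "(\<lambda>x. ennreal_powr (f x) s) \<in> borel_measurable M"
  unfolding ennreal_powr_def by measurable

text \<open>Bounding the sum by the number of terms times the largest one treats s < 1 and s > 1
  alike; the resulting constant is good enough everywhere below.\<close>

lemma ennreal_powr_sum_le:
  assumes "finite I" "0 \<le> s"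
  shows "ennreal_powr (\<Sum>i\<in>I. f i) s \<le> ennreal (real (card I) powr s) * (\<Sum>i\<in>I. ennreal_powr (f i) s)"
proof (cases "I = {}")
  case False
  define m where "m = Max (f ` I)"
  have m: "m \<in> f ` I" "\<And>i. i \<in> I \<Longrightarrow> f i \<le> m"
    using assms False by (auto simp: m_def)
  have "ennreal_powr (\<Sum>i\<in>I. f i) s \<le> ennreal_powr (ennreal (real (card I)) * m) s"
    using sum_bounded_above[of I f m] m(2) assms
    by (intro ennreal_powr_mono) (auto simp: ennreal_of_nat_eq_real_of_nat)
  also have "\<dots> = ennreal (real (card I) powr s) * ennreal_powr m s"
    by (simp add: ennreal_powr_mult ennreal_powr_ennreal)
  also have "ennreal_powr m s \<le> (\<Sum>i\<in>I. ennreal_powr (f i) s)"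
    using m(1) assms(1) by (auto intro: member_le_sum[where f="\<lambda>i. ennreal_powr (f i) s"])
  finally show ?thesis by (simp add: mult_left_mono)
qed simp

lemma ennreal_Youngs_inequality:
  assumes "1 < p" "1 < q" "1 / p + 1 / q = 1"
  shows "a * b \<le> ennreal (1 / p) * ennreal_powr a p + ennreal (1 / q) * ennreal_powr b q"
proof (cases "a = top \<or> b = top")
  case True
  then show ?thesis using assms
    by (auto simp: ennreal_mult_top)
next
  case False
  then obtain x y where "a = ennreal x" "b = ennreal y" "0 \<le> x" "0 \<le> y"
    by (metis ennreal_cases)
  then show ?thesis
    using Youngs_inequality[of p q x y] assms
    by (simp add: ennreal_powr_ennreal flip: ennreal_mult ennreal_plus)
qed

text \<open>After scaling both norms to 1, Young's inequality integrates to 1 / p + 1 / q = 1. Norms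
  0 and \<infinity> admit no scaling and are split off: a vanishing norm kills the product almost
  everywhere, and otherwise an infinite one makes the right side infinite.\<close>

lemma nn_integral_Holder:
  assumes pq: "1 < p" "1 < q" "1 / p + 1 / q = 1"
    and [measurable]: "f \<in> borel_measurable M" "g \<in> borel_measurable M"
  shows "(\<integral>\<^sup>+x. f x * g x \<partial>M) \<le>
    ennreal_powr (\<integral>\<^sup>+x. ennreal_powr (f x) p \<partial>M) (1 / p) * ennreal_powr (\<integral>\<^sup>+x. ennreal_powr (g x) q \<partial>M) (1 / q)"
proof -
  define F where "F = (\<integral>\<^sup>+x. ennreal_powr (f x) p \<partial>M)"
  define G where "G = (\<integral>\<^sup>+x. ennreal_powr (g x) q \<partial>M)"
  consider "F = 0" | "G = 0" | "F = top" "G \<noteq> 0" | "G = top" "F \<noteq> 0"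
    | "F \<noteq> 0" "G \<noteq> 0" "F < top" "G < top"
    by (auto simp: less_top[symmetric])
  then show ?thesis
  proof cases
    case 1
    then have "AE x in M. f x = 0" by (simp add: F_def nn_integral_0_iff_AE)
    then have "AE x in M. f x * g x = 0" by eventually_elim simp
    then have "(\<integral>\<^sup>+x. f x * g x \<partial>M) = 0"
      by (subst nn_integral_0_iff_AE) auto
    then show ?thesis by simp
  next
    case 2
    then have "AE x in M. g x = 0" by (simp add: G_def nn_integral_0_iff_AE)
    then have "AE x in M. f x * g x = 0" by eventually_elim simp
    then have "(\<integral>\<^sup>+x. f x * g x \<partial>M) = 0"
      by (subst nn_integral_0_iff_AE) auto
    then show ?thesis by simp
  next
    case 3 then show ?thesis by (simp add: F_def[symmetric] G_def[symmetric] ennreal_top_mult)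
  next
    case 4 then show ?thesis by (simp add: F_def[symmetric] G_def[symmetric] ennreal_mult_top)
  next
    case 5
    then obtain a b where ab: "F = ennreal a" "G = ennreal b" "0 < a" "0 < b"
      by (metis ennreal_0 ennreal_cases less_eq_real_def less_top)
    define c where "c = a powr (1 / p)"
    define d where "d = b powr (1 / q)"
    have cd: "0 < c" "0 < d" "c powr p = a" "d powr q = b"
      using ab pq by (auto simp: c_def d_def powr_powr)
    have *: "f x * g x \<le> ennreal (c * d) * (ennreal (1 / p / a) * ennreal_powr (f x) p + ennreal (1 / q / b) * ennreal_powr (g x) q)" for x
    proof -
      have "f x * g x = ennreal (c * d) * ((ennreal (1 / c) * f x) * (ennreal (1 / d) * g x))"
      proof -
        have "ennreal (c * d) * ((ennreal (1 / c) * f x) * (ennreal (1 / d) * g x))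
          = (ennreal (c * d) * ennreal (1 / c) * ennreal (1 / d)) * (f x * g x)"
          by (simp only: mult_ac)
        also have "ennreal (c * d) * ennreal (1 / c) * ennreal (1 / d) = 1"
          using cd by (simp flip: ennreal_mult)
        finally show ?thesis by simp
      qed
      also have "\<dots> \<le> ennreal (c * d) * (ennreal (1 / p) * ennreal_powr (ennreal (1 / c) * f x) p +
         ennreal (1 / q) * ennreal_powr (ennreal (1 / d) * g x) q)"
        using pq by (intro mult_left_mono ennreal_Youngs_inequality) auto
      also have "ennreal (1 / p) * ennreal_powr (ennreal (1 / c) * f x) p = ennreal (1 / p / a) * ennreal_powr (f x) p"
        using cd pq by (simp add: ennreal_powr_mult ennreal_powr_ennreal powr_divide mult.assoc[symmetric] ennreal_mult'[symmetric])
      also have "ennreal (1 / q) * ennreal_powr (ennreal (1 / d) * g x) q = ennreal (1 / q / b) * ennreal_powr (g x) q"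
        using cd pq by (simp add: ennreal_powr_mult ennreal_powr_ennreal powr_divide mult.assoc[symmetric] ennreal_mult'[symmetric])
      finally show ?thesis .
    qed
    have "(\<integral>\<^sup>+x. f x * g x \<partial>M) \<le> (\<integral>\<^sup>+x. ennreal (c * d) * (ennreal (1 / p / a) * ennreal_powr (f x) p + ennreal (1 / q / b) * ennreal_powr (g x) q) \<partial>M)"
      by (intro nn_integral_mono *)
    also have "\<dots> = ennreal (c * d) * (ennreal (1 / p / a) * F + ennreal (1 / q / b) * G)"
      by (simp add: nn_integral_cmult nn_integral_add F_def G_def)
    also have "\<dots> = ennreal (c * d)"
      using ab cd pq by (simp flip: ennreal_mult ennreal_plus)
    also have "\<dots> = ennreal_powr F (1 / p) * ennreal_powr G (1 / q)"
      using ab by (simp add: ennreal_powr_ennreal c_def d_def ennreal_mult)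
    finally show ?thesis by (simp add: F_def G_def)
  qed
qed

section \<open>Operator norm, measurability, and approximate Auerbach bases\<close>

lemma op_norm_bounded_linear: "bounded_linear (\<lambda>v. (A::real^'d^'d) *v v)"
  by (rule matrix_vector_mul_bounded_linear)

lemma op_norm_nonneg [simp]: "0 \<le> op_norm A"
  unfolding op_norm_def by (rule onorm_pos_le[OF op_norm_bounded_linear])

lemma norm_mult_le_op_norm: "norm (A *v v) \<le> op_norm A * norm v"
  unfolding op_norm_def by (rule onorm[OF op_norm_bounded_linear])

lemma op_norm_le: "(\<And>v. norm (A *v v) \<le> c * norm v) \<Longrightarrow> op_norm A \<le> c"
  unfolding op_norm_def by (rule onorm_le)

lemma op_norm_mult_le: "op_norm (A ** B) \<le> op_norm A * op_norm B"
proof (rule op_norm_le)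
  fix v
  have "norm ((A ** B) *v v) \<le> op_norm A * norm (B *v v)"
    by (metis matrix_vector_mul_assoc norm_mult_le_op_norm)
  also have "\<dots> \<le> op_norm A * (op_norm B * norm v)"
    by (intro mult_left_mono norm_mult_le_op_norm) simp
  finally show "norm ((A ** B) *v v) \<le> op_norm A * op_norm B * norm v" by simp
qed

lemma op_norm_triangle: "op_norm (A + B) \<le> op_norm A + op_norm B"
  unfolding op_norm_def matrix_vector_mult_add_rdistrib
  by (rule onorm_triangle[OF op_norm_bounded_linear op_norm_bounded_linear])

lemma op_norm_scaleR [simp]: "op_norm (c *\<^sub>R A) = \<bar>c\<bar> * op_norm A"
  unfolding op_norm_def scaleR_matrix_vector_assoc[symmetric]
  by (rule onorm_scaleR[OF op_norm_bounded_linear])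

lemma op_norm_eq_0_iff [simp]: "op_norm A = 0 \<longleftrightarrow> A = 0"
proof
  assume "op_norm A = 0"
  then have "A *v v = 0" for v
    using norm_mult_le_op_norm[of A v] by simp
  then have "\<forall>v. A *v v = 0 *v v" by simp
  then show "A = 0" by (simp only: matrix_eq[symmetric])
qed (simp add: op_norm_def onorm_zero)

lemma op_norm_transpose_le: "op_norm A \<le> op_norm (transpose A)"
proof (rule op_norm_le)
  fix v
  have "norm (A *v v) * norm (A *v v) = (A *v v) \<bullet> (A *v v)"
    by (simp add: dot_square_norm power2_eq_square)
  also have "\<dots> = (transpose A *v (A *v v)) \<bullet> v"
    using dot_lmul_matrix[of "A *v v" A v] by (simp add: inner_commute)
  also have "\<dots> \<le> (op_norm (transpose A) * norm (A *v v)) * norm v"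
    by (rule order_trans[OF norm_cauchy_schwarz]) (intro mult_right_mono norm_mult_le_op_norm norm_ge_zero)
  finally show "norm (A *v v) \<le> op_norm (transpose A) * norm v"
    by (cases "norm (A *v v) = 0") (auto simp: mult_ac)
qed

lemma op_norm_transpose [simp]: "op_norm (transpose A) = op_norm A"
  using op_norm_transpose_le[of A] op_norm_transpose_le[of "transpose A"] by simp

lemma op_norm_mult_commute:
  assumes "transpose A = A" "transpose B = B"
  shows "op_norm (A ** B) = op_norm (B ** A)"
  using op_norm_transpose[of "A ** B"] by (simp add: matrix_transpose_mul assms)

lemma op_norm_le_sum_columns: "op_norm (A::real^'d^'d) \<le> (\<Sum>j\<in>UNIV. norm (A *v axis j 1))"
proof (rule op_norm_le)
  fix v :: "real^'d"
  have "A *v v = A *v (\<Sum>j\<in>UNIV. v $ j *\<^sub>R axis j 1)"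
    using basis_expansion[of v] by (simp add: scalar_mult_eq_scaleR)
  also have "\<dots> = (\<Sum>j\<in>UNIV. v $ j *\<^sub>R (A *v axis j 1))"
    by (simp add: linear_sum[OF matrix_vector_mul_linear] linear_scale[OF matrix_vector_mul_linear])
  finally have "norm (A *v v) \<le> (\<Sum>j\<in>UNIV. norm (v $ j *\<^sub>R (A *v axis j 1)))"
    by (metis norm_sum)
  also have "\<dots> \<le> (\<Sum>j\<in>UNIV. norm v * norm (A *v axis j 1))"
    by (intro sum_mono) (auto intro!: mult_right_mono component_le_norm_cart)
  finally show "norm (A *v v) \<le> (\<Sum>j\<in>UNIV. norm (A *v axis j 1)) * norm v"
    by (simp add: sum_distrib_left mult.commute)
qed

lemma norm_column_le_op_norm: "norm (A *v axis j 1) \<le> op_norm A"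
  using norm_mult_le_op_norm[of A "axis j 1"] by (simp add: norm_axis_1)

section \<open>Borel measurability of matrix operations\<close>

lemma measurable_op_norm [measurable]: "op_norm \<in> borel_measurable borel"
proof -
  \<comment> \<open>A finite convex function on a whole Euclidean space is continuous, so the
    triangle inequality and homogeneity already yield measurability.\<close>
  have "convex_on UNIV (op_norm :: real^'d^'d \<Rightarrow> real)"
  proof (rule convex_onI)
    fix t :: real and A B :: "real^'d^'d" assume t: "0 < t" "t < 1"
    show "op_norm ((1 - t) *\<^sub>R A + t *\<^sub>R B) \<le> (1 - t) * op_norm A + t * op_norm B"
      using op_norm_triangle[of "(1 - t) *\<^sub>R A" "t *\<^sub>R B"] t by simp
  qed simp
  then show ?thesis
    by (intro borel_measurable_continuous_onI convex_on_continuous) auto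
qed

lemma measurable_matrix_iff:
  fixes f :: "'a \<Rightarrow> real^'m^'k"
  shows "f \<in> borel_measurable M \<longleftrightarrow> (\<forall>i j. (\<lambda>x. f x $ i $ j) \<in> borel_measurable M)"
proof safe
  fix i j assume "f \<in> borel_measurable M"
  then show "(\<lambda>x. f x $ i $ j) \<in> borel_measurable M"
    by (rule borel_measurable_continuous_on[rotated, where f="\<lambda>A. A $ i $ j"]) (intro continuous_intros)
next
  assume *: "\<forall>i j. (\<lambda>x. f x $ i $ j) \<in> borel_measurable M"
  show "f \<in> borel_measurable M"
  proof (subst borel_measurable_euclidean_space, safe)
    fix b :: "real^'m^'k" assume "b \<in> Basis"
    then obtain i j where "b = axis i (axis j 1)"
      by (auto simp: Basis_vec_def)
    then show "(\<lambda>x. f x \<bullet> b) \<in> borel_measurable M"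
      using * by (simp add: inner_axis)
  qed
qed

lemma measurable_matrix_mult [measurable]:
  fixes A B :: "'a \<Rightarrow> real^'d^'d"
  assumes "A \<in> borel_measurable M" "B \<in> borel_measurable M"
  shows "(\<lambda>x. A x ** B x) \<in> borel_measurable M"
  using assms unfolding measurable_matrix_iff matrix_matrix_mult_def
  by (auto intro!: borel_measurable_sum borel_measurable_times)

lemma measurable_matrix_vector_mult [measurable]:
  fixes A :: "'a \<Rightarrow> real^'d^'d"
  assumes "A \<in> borel_measurable M"
  shows "(\<lambda>x. A x *v v) \<in> borel_measurable M"
  by (rule borel_measurable_continuous_on[OF _ assms])
    (auto intro!: linear_continuous_on simp: linear_linear linear_iff matrix_vector_mult_add_rdistrib
      scaleR_matrix_vector_assoc[symmetric])

lemma measurable_det: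
  fixes A :: "'a \<Rightarrow> real^'d^'d"
  assumes "A \<in> borel_measurable M"
  shows "(\<lambda>x. det (A x)) \<in> borel_measurable M"
  using assms unfolding measurable_matrix_iff det_def
  by (intro borel_measurable_sum borel_measurable_times borel_measurable_prod) auto

lemma matrix_inv_right: "invertible (A::real^'d^'d) \<Longrightarrow> A ** matrix_inv A = mat 1"
  and matrix_inv_left: "invertible A \<Longrightarrow> matrix_inv A ** A = mat 1"
  unfolding invertible_def matrix_inv_def by (rule someI2_ex; simp)+

text \<open>Cramer's rule writes each entry of the inverse as a quotient of determinants.
  Invertibility is demanded at every point because \<open>matrix_inv\<close> is an arbitrary choice
  on singular matrices.\<close>

lemma measurable_matrix_inv:
  fixes A :: "'a \<Rightarrow> real^'d^'d"
  assumes A: "A \<in> borel_measurable M" and inv: "\<And>x. invertible (A x)"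
  shows "(\<lambda>x. matrix_inv (A x)) \<in> borel_measurable M"
  unfolding measurable_matrix_iff
proof safe
  fix i j
  have "matrix_inv (A x) $ i $ j =
      det (\<chi> k l. if l = i then (axis j 1 :: real^'d) $ k else A x $ k $ l) / det (A x)" for x
  proof -
    have "A x *v (matrix_inv (A x) *v axis j 1) = axis j 1"
      by (simp add: matrix_vector_mul_assoc matrix_inv_right inv)
    then have "matrix_inv (A x) *v axis j 1 =
      (\<chi> k. det (\<chi> m l. if l = k then (axis j 1 :: real^'d) $ m else A x $ m $ l) / det (A x))"
      using cramer[of "A x"] inv invertible_det_nz by blast
    then have "(matrix_inv (A x) *v axis j 1) $ i = det (\<chi> k l. if l = i then (axis j 1 :: real^'d) $ k else A x $ k $ l) / det (A x)"
      by simp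
    then show ?thesis
      by (simp add: matrix_vector_mul_component row_def inner_axis matrix_vector_mult_basis column_def)
  qed
  moreover have "(\<lambda>x. det (\<chi> k l. if l = i then (axis j 1 :: real^'d) $ k else A x $ k $ l)) \<in> borel_measurable M"
    using A by (intro measurable_det) (auto simp: measurable_matrix_iff intro!: measurable_If)
  ultimately show "(\<lambda>x. matrix_inv (A x) $ i $ j) \<in> borel_measurable M"
    using measurable_det[OF A] by simp
qed

lemma pd_matrix_invertible: "pd_matrix A \<Longrightarrow> invertible A"
  unfolding pd_matrix_def
  by (metis inner_zero_right less_irrefl invertible_left_inverse matrix_left_invertible_ker)

lemma pd_matrix_symmetric: "pd_matrix A \<Longrightarrow> transpose A = A"
  by (simp add: pd_matrix_def)

lemma pd_matrix_mat_1: "pd_matrix (mat 1)"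
  by (simp add: pd_matrix_def transpose_mat)

lemma matrix_inv_symmetric:
  fixes A :: "real^'d^'d"
  assumes "invertible A" "transpose A = A"
  shows "transpose (matrix_inv A) = matrix_inv A"
proof -
  have "transpose (matrix_inv A) ** A = mat 1"
    using matrix_inv_right[OF assms(1)] assms(2) by (metis matrix_transpose_mul transpose_mat)
  then show ?thesis
    by (metis assms(1) matrix_inv_right matrix_mul_assoc matrix_mul_lid matrix_mul_rid)
qed

text \<open>Tonelli on product spaces and measurability of the inverse call for a Borel map that is
  positive definite everywhere. It is obtained entry by entry and set to the identity matrix on a
  null set; the conditions in question see \<open>W\<close> only up to null sets.\<close>

lemma matrix_weight_borel:
  fixes W :: "real^'n \<Rightarrow> real^'d^'d"
  assumes "matrix_weight W"
  obtains A where "A \<in> borel_measurable borel" "\<And>x. pd_matrix (A x)" "AE x in lborel. W x = A x"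
proof -
  have W: "W \<in> borel_measurable lebesgue" and pd: "AE x in lebesgue. pd_matrix (W x)"
    using assms by (auto simp: matrix_weight_def)
  define g where "g i j = (SOME g. g \<in> borel_measurable lborel \<and> (AE x in lborel. W x $ i $ j = g x))" for i j
  have "\<exists>g. g \<in> borel_measurable lborel \<and> (AE x in lborel. W x $ i $ j = g x)" for i j
    using completion_ex_borel_measurable_real[of "\<lambda>x. W x $ i $ j" lborel] W
    by (auto simp: measurable_matrix_iff)
  from someI_ex[OF this] have g: "g i j \<in> borel_measurable lborel" "AE x in lborel. W x $ i $ j = g i j x" for i j
    unfolding g_def by blast+
  have "AE x in lborel. \<forall>i j. W x $ i $ j = g i j x"
    using g(2) by (simp add: AE_all_countable)
  moreover have "AE x in lborel. pd_matrix (W x)"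
    using pd by (simp add: AE_completion_iff)
  ultimately have "AE x in lborel. W x = (\<chi> i j. g i j x) \<and> pd_matrix (W x)"
    by eventually_elim (simp add: vec_eq_iff)
  then obtain N where N: "N \<in> null_sets lborel" "{x. \<not> (W x = (\<chi> i j. g i j x) \<and> pd_matrix (W x))} \<subseteq> N"
    by (elim AE_E) (auto simp: null_sets_def)
  define A where "A x = (if x \<in> N then mat 1 else (\<chi> i j. g i j x))" for x
  show thesis
  proof
    have [measurable]: "N \<in> sets borel" using N by auto
    show "A \<in> borel_measurable borel"
      unfolding A_def using g(1) by (intro measurable_If_set) (auto simp: measurable_matrix_iff)
    show "pd_matrix (A x)" for x
      using N(2) by (auto simp: A_def pd_matrix_mat_1)
    show "AE x in lborel. W x = A x"
      using AE_not_in[OF N(1)] by eventually_elim (use N(2) in \<open>auto simp: A_def\<close>)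
  qed
qed

section \<open>Nearly maximal determinants and Auerbach bases\<close>

lemma abs_det_le:
  fixes A :: "real^'d^'d"
  assumes "\<And>i. norm (A $ i) \<le> r"
  shows "\<bar>det A\<bar> \<le> (\<Sum>p\<in>{p. p permutes (UNIV::'d set)}. r ^ CARD('d))"
  unfolding det_def
proof (rule order_trans[OF sum_abs], rule sum_mono)
  fix p :: "'d \<Rightarrow> 'd"
  have "(\<Prod>i\<in>UNIV. \<bar>A $ i $ p i\<bar>) \<le> (\<Prod>i\<in>(UNIV::'d set). r)"
    using assms component_le_norm_cart[of "A $ _"] by (intro prod_mono) (auto intro: order_trans)
  then show "\<bar>of_int (sign p) * (\<Prod>i\<in>UNIV. A $ i $ p i)\<bar> \<le> r ^ CARD('d)"
    by (simp add: abs_mult abs_prod sign_def)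
qed

text \<open>The vectors nearly maximise the determinant over the unit ball of \<open>\<psi>\<close>; Cramer's rule
  then bounds the coordinates.\<close>

lemma approximate_Auerbach_basis:
  fixes \<psi> :: "real^'d \<Rightarrow> real"
  assumes q: "0 < q" and c: "0 < c"
    and hom: "\<And>a v. \<psi> (a *\<^sub>R v) = \<bar>a\<bar> powr q * \<psi> v"
    and lower: "\<And>v. c * norm v powr q \<le> \<psi> v"
  shows "\<exists>v :: 'd \<Rightarrow> real^'d. (\<forall>i. \<psi> (v i) \<le> 1) \<and>
    (\<forall>u. \<exists>a. u = (\<Sum>i\<in>UNIV. a i *\<^sub>R v i) \<and> (\<forall>i. \<bar>a i\<bar> powr q \<le> 2 powr q * \<psi> u))"
proof -
  \<comment> \<open>The vectors are the rows of a matrix whose determinant is to be nearly maximal,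
    subject to \<psi> <= 1 on every row.\<close>
  define S where "S = {\<bar>det (\<chi> i. v i)\<bar> | v :: 'd \<Rightarrow> real^'d. \<forall>i. \<psi> (v i) \<le> 1}"
  have pos: "0 < \<psi> v" if "v \<noteq> 0" for v
    by (rule less_le_trans[OF _ lower]) (use c that in simp)
  define r where "r = (1 / c) powr (1 / q)"
  have r: "norm v \<le> r" if "\<psi> v \<le> 1" for v
  proof -
    have "norm v powr q \<le> 1 / c" using lower[of v] that c by (simp add: field_simps)
    then have "(norm v powr q) powr (1 / q) \<le> r"
      unfolding r_def using q by (intro powr_mono2) auto
    then show ?thesis using q by (simp add: powr_powr)
  qed
  have bdd: "bdd_above S"
  proof (rule bdd_aboveI)
    fix s assume "s \<in> S"
 then obtain v :: "'d \<Rightarrow> real^'d" where "s = \<bar>det (\<chi> i. v i)\<bar>" "\<And>i. \<psi> (v i) \<le> 1"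
      by (auto simp: S_def)
    then show "s \<le> (\<Sum>p\<in>{p. p permutes (UNIV::'d set)}. r ^ CARD('d))"
      using r by (auto intro!: abs_det_le simp del: sum_constant)
  qed
  have scale: "\<psi> ((1 / \<psi> u powr (1 / q)) *\<^sub>R u) = 1" if "u \<noteq> 0" for u
    using pos[OF that] q by (simp add: hom powr_divide powr_powr)
  obtain s where s: "s \<in> S" "0 < s"
  proof
    let ?v = "\<lambda>i. (1 / \<psi> (axis i 1) powr (1 / q)) *\<^sub>R axis i 1 :: real^'d"
    show "\<bar>det (\<chi> i. ?v i)\<bar> \<in> S"
      unfolding S_def using scale by (intro CollectI exI[of _ ?v]) simp
    have "det (\<chi> i. ?v i) = (\<Prod>i\<in>UNIV. (\<chi> i. ?v i) $ i $ i)"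
      by (rule det_diagonal) (auto simp: axis_def)
    moreover have "0 < \<psi> (axis i 1)" for i
      by (rule pos) (simp add: axis_eq_0_iff)
    ultimately show "0 < \<bar>det (\<chi> i. ?v i)\<bar>"
      by (auto simp: less_le)
  qed
  have "0 < Sup S" using cSup_upper[OF s(1) bdd] s(2) by simp
  \<comment> \<open>Attaining the supremum would require compactness of the unit ball of \<psi>.
    Half the supremum is always exceeded, and this half is the origin of the 2 in the bound on the
    coordinates.\<close>
  then have "Sup S / 2 < Sup S" by simp
  then obtain v where v: "\<And>i. \<psi> (v i) \<le> 1" "Sup S / 2 < \<bar>det (\<chi> i. v i)\<bar>"
    using less_cSup_iff[OF _ bdd, of "Sup S / 2"] s(1) by (auto simp: S_def)
  define A where "A = (\<chi> i. v i)"
  have A: "det A \<noteq> 0" "row i A = v i" "A $ i = v i" for i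
    using v(2) \<open>0 < Sup S\<close> by (auto simp: A_def row_def vec_eq_iff)
  show ?thesis
  proof (intro exI[of _ v] conjI allI)
    show "\<psi> (v i) \<le> 1" for i by fact
    fix u :: "real^'d"
    have "invertible (transpose A)" using A by (simp add: invertible_det_nz)
    define x where "x = matrix_inv (transpose A) *v u"
    have "transpose A *v x = u"
      by (simp add: x_def matrix_vector_mul_assoc matrix_inv_right \<open>invertible (transpose A)\<close>)
    then have u: "u = (\<Sum>i\<in>UNIV. x $ i *s v i)"
      unfolding matrix_mult_sum by (simp add: A)
    have "\<bar>x $ k\<bar> powr q \<le> 2 powr q * \<psi> u" for k
    proof (cases "u = 0")
      case True
      then have "x = 0" by (simp add: x_def)
      then show ?thesis using True hom[of 0 0] q by simp
    next
      case False
      define t where "t = \<psi> u powr (1 / q)"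
      have t: "0 < t" using pos[OF False] by (simp add: t_def)
      \<comment> \<open>Putting \<open>u\<close>, scaled to \<psi> = 1, in row \<open>k\<close>
        gives a competitor in \<open>S\<close>. By Cramer its determinant is, up to the scaling, the
        k-th coordinate of \<open>u\<close> times det A.\<close>
      have "\<bar>det (\<chi> i. if i = k then (1 / t) *\<^sub>R u else v i)\<bar> \<in> S"
        unfolding S_def using v(1) scale[OF False]
        by (intro CollectI exI[of _ "\<lambda>i. if i = k then (1 / t) *\<^sub>R u else v i"]) (auto simp: t_def)
      then have "\<bar>det (\<chi> i. if i = k then (1 / t) *\<^sub>R u else v i)\<bar> \<le> Sup S"
        by (rule cSup_upper[OF _ bdd])
      also have "det (\<chi> i. if i = k then (1 / t) *\<^sub>R u else v i) = (1 / t) * det (\<chi> i. if i = k then u else v i)"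
        using det_row_mul[of k "1 / t" "\<lambda>_. u" v] by (simp add: scalar_mult_eq_scaleR cong: if_cong)
      also have "det (\<chi> i. if i = k then u else v i) = x $ k * det A"
        using cramer_lemma_transpose[of k x A] unfolding A(2) u[symmetric] .
      finally have "\<bar>x $ k\<bar> * \<bar>det A\<bar> \<le> t * Sup S"
        using t by (simp add: abs_mult field_simps)
      also have "\<dots> \<le> (2 * t) * \<bar>det A\<bar>"
        using v(2) t by (simp add: A_def)
      finally have "\<bar>x $ k\<bar> \<le> 2 * t" using A by simp
      then have "\<bar>x $ k\<bar> powr q \<le> (2 * t) powr q"
        using q by (intro powr_mono2) auto
      also have "\<dots> = 2 powr q * \<psi> u"
        using q pos[OF False] t by (simp add: powr_mult t_def powr_powr)
      finally show ?thesis .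
    qed
    then show "\<exists>a. u = (\<Sum>i\<in>UNIV. a i *\<^sub>R v i) \<and> (\<forall>i. \<bar>a i\<bar> powr q \<le> 2 powr q * \<psi> u)"
      using u by (intro exI[of _ "\<lambda>i. x $ i"]) (simp add: scalar_mult_eq_scaleR)
  qed
qed

section \<open>Averages and reducing bases\<close>

lemma average_borel: "Q \<in> sets borel \<Longrightarrow> average Q f = (\<integral>\<^sup>+x\<in>Q. f x \<partial>lborel) / emeasure lborel Q"
  by (simp add: average_def nn_integral_completion)

text \<open>Shared by the closed cubes of the definitions and the half-open dyadic cells: on such
  sets the quotient defining \<open>average\<close> is a genuine mean value.\<close>

definition avg_set :: "(real^'n) set \<Rightarrow> bool" where
  "avg_set Q \<longleftrightarrow> Q \<in> sets borel \<and> 0 < emeasure lborel Q \<and> emeasure lborel Q < top"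

lemma avg_setD:
  assumes "avg_set Q"
  shows "Q \<in> sets borel" "emeasure lborel Q \<noteq> 0" "emeasure lborel Q \<noteq> top"
  using assms by (auto simp: avg_set_def)

lemma average_eq: "avg_set Q \<Longrightarrow> average Q f = (\<integral>\<^sup>+x\<in>Q. f x \<partial>lborel) / emeasure lborel Q"
  by (simp add: avg_set_def average_borel)

lemma emeasure_mult_average:
  assumes "avg_set Q"
  shows "emeasure lborel Q * average Q f = (\<integral>\<^sup>+x\<in>Q. f x \<partial>lborel)"
  using avg_setD[OF assms] by (simp add: average_eq[OF assms] ennreal_times_divide mult_divide_eq_ennreal
      mult.commute[of "emeasure lborel Q"])

lemma average_const: "avg_set Q \<Longrightarrow> average Q (\<lambda>x. c) = c"
  by (simp add: average_eq nn_integral_cmult_indicator avg_setD mult_divide_eq_ennreal)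

lemma average_mono_AE:
  assumes "avg_set Q" "AE x in lborel. x \<in> Q \<longrightarrow> f x \<le> g x"
  shows "average Q f \<le> average Q g"
proof -
  have "(\<integral>\<^sup>+x\<in>Q. f x \<partial>lborel) \<le> (\<integral>\<^sup>+x\<in>Q. g x \<partial>lborel)"
    using assms(2) by (intro nn_integral_mono_AE) (auto simp: indicator_def elim!: eventually_mono)
  then show ?thesis
    by (simp add: average_eq[OF assms(1)] divide_right_mono_ennreal)
qed

lemma average_mono: "avg_set Q \<Longrightarrow> (\<And>x. x \<in> Q \<Longrightarrow> f x \<le> g x) \<Longrightarrow> average Q f \<le> average Q g"
  by (rule average_mono_AE) auto

lemma average_cong_AE:
  assumes "avg_set Q" "AE x in lborel. x \<in> Q \<longrightarrow> f x = g x"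
  shows "average Q f = average Q g"
  using assms by (intro antisym average_mono_AE) auto

lemma measurable_mult_indicator_lborel [measurable]:
  fixes f :: "real^'n \<Rightarrow> ennreal"
  assumes "avg_set Q" "f \<in> borel_measurable borel"
  shows "(\<lambda>x. f x * indicator Q x) \<in> borel_measurable lborel"
  using assms by (auto simp: avg_set_def)

lemma average_cmult:
  assumes "avg_set Q" "f \<in> borel_measurable borel"
  shows "average Q (\<lambda>x. c * f x) = c * average Q f"
  using nn_integral_cmult[OF measurable_mult_indicator_lborel[OF assms], of c]
  by (simp add: average_eq assms(1) mult.assoc ennreal_times_divide)

lemma average_sum:
  assumes "avg_set Q" "\<And>i. i \<in> I \<Longrightarrow> f i \<in> borel_measurable borel"
  shows "average Q (\<lambda>x. \<Sum>i\<in>I. f i x) = (\<Sum>i\<in>I. average Q (f i))"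
proof -
  have "(\<integral>\<^sup>+x\<in>Q. (\<Sum>i\<in>I. f i x) \<partial>lborel) = (\<Sum>i\<in>I. \<integral>\<^sup>+x\<in>Q. f i x \<partial>lborel)"
    unfolding sum_distrib_right
    by (intro nn_integral_sum measurable_mult_indicator_lborel assms)
  then show ?thesis
    by (simp add: average_eq[OF assms(1)] divide_ennreal_def sum_distrib_right)
qed

lemma measurable_average [measurable]:
  fixes f :: "'a \<times> (real^'n) \<Rightarrow> ennreal"
  assumes [measurable]: "f \<in> borel_measurable (M \<Otimes>\<^sub>M borel)" and Q: "avg_set Q"
  shows "(\<lambda>x. average Q (\<lambda>y. f (x, y))) \<in> borel_measurable M"
proof -
  have [measurable]: "Q \<in> sets borel" using Q by (simp add: avg_set_def)
  show ?thesis
    unfolding average_eq[OF Q] by measurable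
qed

lemma average_Holder:
  assumes pq: "1 < p" "1 < q" "1 / p + 1 / q = 1" and Q: "avg_set Q"
    and [measurable]: "f \<in> borel_measurable borel" "g \<in> borel_measurable borel"
  shows "average Q (\<lambda>x. f x * g x) \<le>
    ennreal_powr (average Q (\<lambda>x. ennreal_powr (f x) p)) (1 / p) * ennreal_powr (average Q (\<lambda>x. ennreal_powr (g x) q)) (1 / q)"
proof -
  have [measurable]: "Q \<in> sets borel" using Q by (simp add: avg_set_def)
  have *: "ennreal_powr (h x) s * indicator Q x = ennreal_powr (h x * indicator Q x) s" for h s and x :: "real^'a"
    by (simp add: indicator_def)
  have e: "ennreal_powr (emeasure lborel Q) (1 / p) * ennreal_powr (emeasure lborel Q) (1 / q) = emeasure lborel Q"
    by (simp add: pq flip: ennreal_powr_add)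
  have "emeasure lborel Q * average Q (\<lambda>x. f x * g x) = (\<integral>\<^sup>+x. (f x * indicator Q x) * (g x * indicator Q x) \<partial>lborel)"
    unfolding emeasure_mult_average[OF Q] by (intro nn_integral_cong) (auto simp: indicator_def)
  also have "\<dots> \<le> ennreal_powr (\<integral>\<^sup>+x. ennreal_powr (f x * indicator Q x) p \<partial>lborel) (1 / p) *
     ennreal_powr (\<integral>\<^sup>+x. ennreal_powr (g x * indicator Q x) q \<partial>lborel) (1 / q)"
    by (intro nn_integral_Holder pq) measurable
  also have "\<dots> = ennreal_powr (emeasure lborel Q * average Q (\<lambda>x. ennreal_powr (f x) p)) (1 / p) *
     ennreal_powr (emeasure lborel Q * average Q (\<lambda>x. ennreal_powr (g x) q)) (1 / q)"
    by (simp add: emeasure_mult_average[OF Q] *)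
  also have "\<dots> = emeasure lborel Q * (ennreal_powr (average Q (\<lambda>x. ennreal_powr (f x) p)) (1 / p) * ennreal_powr (average Q (\<lambda>x. ennreal_powr (g x) q)) (1 / q))"
    unfolding ennreal_powr_mult by (subst (2) e[symmetric]) (simp only: mult_ac)
  finally show ?thesis
    using avg_setD[OF Q] by (simp add: ennreal_mult_le_mult_iff)
qed

lemma average_pos:
  assumes Q: "avg_set Q" and [measurable]: "f \<in> borel_measurable borel" and "AE x in lborel. 0 < f x"
  shows "0 < average Q f"
proof -
  have [measurable]: "Q \<in> sets borel" using Q by (simp add: avg_set_def)
  have "(\<integral>\<^sup>+x\<in>Q. f x \<partial>lborel) \<noteq> 0"
  proof
    assume "(\<integral>\<^sup>+x\<in>Q. f x \<partial>lborel) = 0"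
    then have "AE x in lborel. f x * indicator Q x = 0"
      by (subst (asm) nn_integral_0_iff_AE) auto
    with assms(3) have "AE x in lborel. x \<notin> Q"
      by eventually_elim (auto simp: indicator_def)
    then have "emeasure lborel Q = 0"
      by (subst (asm) AE_iff_null) auto
    then show False using Q by (simp add: avg_set_def)
  qed
  then show ?thesis
    using Q by (auto simp: average_eq avg_set_def zero_less_iff_neq_zero ennreal_divide_eq_0_iff less_top[symmetric])
qed

lemma powr_sum_le:
  fixes f :: "'i \<Rightarrow> real"
  assumes "finite I" "0 \<le> s" "\<And>i. i \<in> I \<Longrightarrow> 0 \<le> f i"
  shows "(\<Sum>i\<in>I. f i) powr s \<le> real (card I) powr s * (\<Sum>i\<in>I. f i powr s)"
proof -
  have "ennreal ((\<Sum>i\<in>I. f i) powr s) = ennreal_powr (\<Sum>i\<in>I. ennreal (f i)) s"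
    using assms by (simp add: ennreal_powr_ennreal sum_nonneg)
  also have "\<dots> \<le> ennreal (real (card I) powr s) * (\<Sum>i\<in>I. ennreal_powr (ennreal (f i)) s)"
    by (intro ennreal_powr_sum_le assms)
  also have "\<dots> = ennreal (real (card I) powr s * (\<Sum>i\<in>I. f i powr s))"
    using assms by (simp add: ennreal_powr_ennreal ennreal_mult sum_nonneg)
  finally show ?thesis
    by (subst (asm) ennreal_le_iff) (auto intro!: mult_nonneg_nonneg sum_nonneg)
qed

lemma mat_1_neq_0: "mat 1 \<noteq> (0 :: real^'d^'d)"
  by (simp add: mat_def vec_eq_iff)

text \<open>Each factor d^q comes from raising a sum of d terms to the power q, once for the columns
  of a matrix and once for the coordinates in the basis; d counts the columns, and 2^q is the loss
  of the approximate basis.\<close>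

definition domination_const :: "nat \<Rightarrow> real \<Rightarrow> real" where
  "domination_const d q = real d powr q * real d * (real d powr q * 2 powr q)"

text \<open>The role of a reducing operator is played by an approximate Auerbach basis of the
  \<open>q\<close>-average of \<open>\<bar>B y v\<bar>\<close> over \<open>Q\<close>.\<close>

lemma reducing_basis:
  fixes B :: "real^'n \<Rightarrow> real^'d^'d"
  assumes q: "0 < q" and Q: "avg_set Q" and [measurable]: "B \<in> borel_measurable borel"
    and inv: "\<And>y. invertible (B y)"
    and fin: "\<And>v. average Q (\<lambda>y. ennreal (norm (B y *v v) powr q)) < top"
  obtains v :: "'d \<Rightarrow> real^'d"
  where "\<And>i. average Q (\<lambda>y. ennreal (norm (B y *v v i) powr q)) \<le> 1"
    and "\<And>M y. ennreal (op_norm (B y ** M) powr q) \<le>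
      ennreal (domination_const CARD('d) q) * average Q (\<lambda>z. ennreal (op_norm (B z ** M) powr q)) *
      (\<Sum>i\<in>UNIV. ennreal (norm (B y *v v i) powr q))"
proof -
  define \<psi> where "\<psi> v = enn2real (average Q (\<lambda>y. ennreal (norm (B y *v v) powr q)))" for v
  have \<psi>: "ennreal (\<psi> v) = average Q (\<lambda>y. ennreal (norm (B y *v v) powr q))" for v
    using fin[of v] by (simp add: \<psi>_def)
  \<comment> \<open>Averaging |v|^q <= |B(y)^-1|^q |B(y) v|^q shows \<psi> v >= \<open>k\<close>
    |v|^q. Thus \<open>k\<close>, which is positive by invertibility, supplies the lower bound asked
    for by the Auerbach lemma.\<close>
  define k where "k = average Q (\<lambda>y. ennreal ((1 / op_norm (matrix_inv (B y))) powr q))"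
  have [measurable]: "(\<lambda>y. matrix_inv (B y)) \<in> borel_measurable borel"
    by (intro measurable_matrix_inv inv) simp
  have inv_pos: "0 < op_norm (matrix_inv (B y))" for y
    using matrix_inv_right[OF inv[of y]] by (auto simp: less_le mat_1_neq_0)
  have "0 < k"
    unfolding k_def using inv_pos by (intro average_pos Q) (auto simp: less_le)
  have lower: "k * ennreal (norm v powr q) \<le> ennreal (\<psi> v)" for v
  proof -
    have "k * ennreal (norm v powr q) = average Q (\<lambda>y. ennreal (norm v powr q) * ennreal ((1 / op_norm (matrix_inv (B y))) powr q))"
      unfolding k_def by (subst average_cmult[OF Q]) (auto simp: mult.commute)
    also have "\<dots> \<le> ennreal (\<psi> v)"
      unfolding \<psi>
    proof (rule average_mono[OF Q])
      fix y
      have "norm v = norm (matrix_inv (B y) *v (B y *v v))"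
        by (simp add: matrix_vector_mul_assoc matrix_inv_left inv)
      also have "\<dots> \<le> op_norm (matrix_inv (B y)) * norm (B y *v v)"
        by (rule norm_mult_le_op_norm)
      finally have "norm v * (1 / op_norm (matrix_inv (B y))) \<le> norm (B y *v v)"
        using inv_pos[of y] by (simp add: field_simps)
      then have "(norm v * (1 / op_norm (matrix_inv (B y)))) powr q \<le> norm (B y *v v) powr q"
        using q by (intro powr_mono2) auto
      then show "ennreal (norm v powr q) * ennreal ((1 / op_norm (matrix_inv (B y))) powr q) \<le> ennreal (norm (B y *v v) powr q)"
        by (simp add: ennreal_leI powr_mult[symmetric] ennreal_mult'[symmetric])
    qed
    finally show ?thesis .
  qed
  have "k < top"
    using lower[of "axis undefined 1"] by (auto simp: norm_axis_1 less_top[symmetric] top_unique)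
  then obtain c where c: "k = ennreal c" "0 < c"
    using \<open>0 < k\<close> by (cases k) auto
  have hom: "\<psi> (a *\<^sub>R v) = \<bar>a\<bar> powr q * \<psi> v" for a v
  proof -
    have "ennreal (\<psi> (a *\<^sub>R v)) = average Q (\<lambda>y. ennreal (\<bar>a\<bar> powr q) * ennreal (norm (B y *v v) powr q))"
      unfolding \<psi> by (simp add: linear_scale[OF matrix_vector_mul_linear] powr_mult flip: ennreal_mult)
    also have "\<dots> = ennreal (\<bar>a\<bar> powr q) * ennreal (\<psi> v)"
      unfolding \<psi> by (intro average_cmult Q) simp
    finally show ?thesis
      by (simp add: \<psi>_def flip: ennreal_mult)
  qed
  have lower': "c * norm v powr q \<le> \<psi> v" for v
    using lower[of v] c by (simp add: \<psi>_def flip: ennreal_mult)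
  obtain v :: "'d \<Rightarrow> real^'d" where va: "(\<forall>i. \<psi> (v i) \<le> 1) \<and>
    (\<forall>u. \<exists>a. u = (\<Sum>i\<in>UNIV. a i *\<^sub>R v i) \<and> (\<forall>i. \<bar>a i\<bar> powr q \<le> 2 powr q * \<psi> u))"
    using approximate_Auerbach_basis[OF q c(2) hom lower'] by (rule exE)
  note v = va[THEN conjunct1, rule_format] and coords = va[THEN conjunct2, rule_format]
  show thesis
  proof
    show "average Q (\<lambda>y. ennreal (norm (B y *v v i) powr q)) \<le> 1" for i
      using v[of i] by (simp flip: \<psi>)
    fix M :: "real^'d^'d" and y
    let ?d = "real CARD('d)"
    let ?K = "average Q (\<lambda>z. ennreal (op_norm (B z ** M) powr q))"
    let ?U = "\<Sum>i\<in>UNIV. norm (B y *v v i) powr q"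
    \<comment> \<open>Expanding \<open>u\<close> in the basis leaves the dependence on
      \<open>u\<close> in \<psi> u and that on \<open>y\<close> in the basis vectors: this is where
      the variables separate.\<close>
    have column: "norm (B y *v u) powr q \<le> ?d powr q * (2 powr q * \<psi> u * ?U)" for u
    proof -
      obtain a where "u = (\<Sum>i\<in>UNIV. a i *\<^sub>R v i) \<and> (\<forall>i. \<bar>a i\<bar> powr q \<le> 2 powr q * \<psi> u)"
        using coords by (rule exE)
      then have a: "u = (\<Sum>i\<in>UNIV. a i *\<^sub>R v i)" "\<And>i. \<bar>a i\<bar> powr q \<le> 2 powr q * \<psi> u"
        by blast+
      have "norm (B y *v u) \<le> (\<Sum>i\<in>UNIV. \<bar>a i\<bar> * norm (B y *v v i))"
        unfolding a(1) by (simp add: linear_sum[OF matrix_vector_mul_linear] linear_scale[OF matrix_vector_mul_linear])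
          (rule order_trans[OF norm_sum], simp)
      then have "norm (B y *v u) powr q \<le> (\<Sum>i\<in>UNIV. \<bar>a i\<bar> * norm (B y *v v i)) powr q"
        using q by (intro powr_mono2) auto
      also have "\<dots> \<le> ?d powr q * (\<Sum>i\<in>UNIV. (\<bar>a i\<bar> * norm (B y *v v i)) powr q)"
        using q by (intro powr_sum_le) auto
      also have "(\<Sum>i\<in>UNIV. (\<bar>a i\<bar> * norm (B y *v v i)) powr q) \<le> (\<Sum>i\<in>UNIV. 2 powr q * \<psi> u * norm (B y *v v i) powr q)"
        by (intro sum_mono) (auto simp: powr_mult intro!: mult_right_mono a(2))
      also have "\<dots> = 2 powr q * \<psi> u * ?U" by (simp add: sum_distrib_left)
      finally show ?thesis by (simp add: mult_left_mono)
    qed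
    have \<psi>M: "ennreal (\<psi> (M *v axis j 1)) \<le> ?K" for j
      unfolding \<psi>
    proof (rule average_mono[OF Q], rule ennreal_leI)
      fix z show "norm (B z *v (M *v axis j 1)) powr q \<le> op_norm (B z ** M) powr q"
        using norm_column_le_op_norm[of "B z ** M" j] q
        by (intro powr_mono2) (auto simp: matrix_vector_mul_assoc)
    qed
    have "op_norm (B y ** M) powr q \<le> (\<Sum>j\<in>UNIV. norm (B y *v (M *v axis j 1))) powr q"
      using q op_norm_le_sum_columns[of "B y ** M"] by (intro powr_mono2) (auto simp: matrix_vector_mul_assoc)
    also have "\<dots> \<le> ?d powr q * (\<Sum>j\<in>UNIV. norm (B y *v (M *v axis j 1)) powr q)"
      using q by (intro powr_sum_le) auto
    also have "\<dots> \<le> ?d powr q * (\<Sum>j\<in>UNIV. ?d powr q * (2 powr q * \<psi> (M *v axis j 1) * ?U))"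
      by (intro mult_left_mono sum_mono column) auto
    finally have "ennreal (op_norm (B y ** M) powr q) \<le> ennreal (?d powr q * (\<Sum>j\<in>UNIV. ?d powr q * (2 powr q * \<psi> (M *v axis j 1) * ?U)))"
      by (rule ennreal_leI)
    also have "\<dots> = ennreal (?d powr q) * (\<Sum>j\<in>(UNIV::'d set). ennreal (?d powr q * 2 powr q) * ennreal (\<psi> (M *v axis j 1)) * ennreal ?U)"
      by (simp add: \<psi>_def sum_nonneg ennreal_mult mult_ac flip: sum_ennreal)
    also have "\<dots> \<le> ennreal (?d powr q) * (\<Sum>j\<in>(UNIV::'d set). ennreal (?d powr q * 2 powr q) * ?K * ennreal ?U)"
      by (intro mult_left_mono sum_mono mult_right_mono \<psi>M) auto
    also have "\<dots> = ennreal (domination_const CARD('d) q) * ?K * ennreal ?U"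
      by (simp add: domination_const_def ennreal_mult mult_ac ennreal_of_nat_eq_real_of_nat)
    finally show "ennreal (op_norm (B y ** M) powr q) \<le> ennreal (domination_const CARD('d) q) * ?K *
        (\<Sum>i\<in>UNIV. ennreal (norm (B y *v v i) powr q))"
      by (simp add: sum_ennreal)
  qed
qed

section \<open>Dyadic grids and the \<open>A\<^sub>\<infinity>\<close> condition\<close>

text \<open>Comparisons made cell by cell add up over a countable disjoint family. Taking
  \<open>E\<close> or \<open>F\<close> to be the whole space gives the forms used with stopping
  cells.\<close>

lemma emeasure_Int_Union_le:
  assumes "countable \<M>" "disjoint \<M>"
    and sets: "sets \<mu> = sets borel" "sets \<nu> = sets borel" "\<M> \<subseteq> sets borel" "E \<in> sets borel" "F \<in> sets borel"
    and le: "\<And>R. R \<in> \<M> \<Longrightarrow> emeasure \<mu> (E \<inter> R) \<le> c * emeasure \<nu> (F \<inter> R)"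
  shows "emeasure \<mu> (E \<inter> \<Union>\<M>) \<le> c * emeasure \<nu> (F \<inter> \<Union>\<M>)"
proof -
  have disj: "disjoint_family_on (\<lambda>R. G \<inter> R) \<M>" for G :: "'a set"
    using \<open>disjoint \<M>\<close> by (auto simp: disjoint_family_on_def disjoint_def)
  have "emeasure \<mu> (E \<inter> \<Union>\<M>) = emeasure \<mu> (\<Union>R\<in>\<M>. E \<inter> R)"
    by (intro arg_cong[where f="emeasure \<mu>"]) auto
  also have "\<dots> = (\<integral>\<^sup>+R. emeasure \<mu> (E \<inter> R) \<partial>count_space \<M>)"
    using assms by (intro emeasure_UN_countable disj) auto
  also have "\<dots> \<le> (\<integral>\<^sup>+R. c * emeasure \<nu> (F \<inter> R) \<partial>count_space \<M>)"
    by (intro nn_integral_mono le) simp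
  also have "\<dots> = c * (\<integral>\<^sup>+R. emeasure \<nu> (F \<inter> R) \<partial>count_space \<M>)"
    by (intro nn_integral_cmult) simp
  also have "(\<integral>\<^sup>+R. emeasure \<nu> (F \<inter> R) \<partial>count_space \<M>) = emeasure \<nu> (\<Union>R\<in>\<M>. F \<inter> R)"
    using assms by (intro emeasure_UN_countable[symmetric] disj) auto
  also have "(\<Union>R\<in>\<M>. F \<inter> R) = F \<inter> \<Union>\<M>" by auto
  finally show ?thesis .
qed

text \<open>Larger indices are finer, and \<open>K\<close> is the ratio of volumes between
  consecutive generations, 2^n in Euclidean space. The axioms record just what the stopping
  arguments use, so that all shifted grids are handled at once.\<close>

locale dyadic_grid =
  fixes cell :: "int \<Rightarrow> real^'n \<Rightarrow> (real^'n) set" and K :: real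
  assumes K: "1 < K"
    and in_cell: "\<And>k x. x \<in> cell k x"
    and cell_eq: "\<And>k x y. y \<in> cell k x \<Longrightarrow> cell k y = cell k x"
    and cell_nested: "\<And>k l x. k \<le> l \<Longrightarrow> cell l x \<subseteq> cell k x"
    and cell_borel [measurable, simp]: "\<And>k x. cell k x \<in> sets borel"
    and emeasure_cell: "\<And>k x. emeasure lborel (cell k x) = ennreal (K powr (- real_of_int k))"
    and cell_small: "\<And>S x. open S \<Longrightarrow> x \<in> S \<Longrightarrow> \<exists>k. cell k x \<subseteq> S"
    and countable_level: "\<And>k. countable (range (cell k))"
begin

definition cells :: "(real^'n) set set" where
  "cells = (\<Union>k. range (cell k))"

lemma countable_cells: "countable cells"
  unfolding cells_def by (intro countable_UN countable_level) auto

lemma cell_in_cells [simp]: "cell k x \<in> cells"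
  by (auto simp: cells_def)

lemma cells_borel: "R \<in> cells \<Longrightarrow> R \<in> sets borel"
  by (auto simp: cells_def)

lemma cellsE: "R \<in> cells \<Longrightarrow> x \<in> R \<Longrightarrow> \<exists>k. R = cell k x"
  by (auto simp: cells_def dest: cell_eq)

lemma avg_set_cell: "R \<in> cells \<Longrightarrow> avg_set R"
  using K by (auto simp: cells_def avg_set_def emeasure_cell)

lemma cell_inject: "cell k x = cell l y \<Longrightarrow> k = l"
  using emeasure_cell[of k x] emeasure_cell[of l y] K by (simp add: powr_inj)

lemma cells_nested_or_disjoint:
  assumes "R \<in> cells" "S \<in> cells"
  shows "R \<subseteq> S \<or> S \<subseteq> R \<or> R \<inter> S = {}"
proof (rule ccontr)
  assume *: "\<not> ?thesis"
  then obtain x where "x \<in> R" "x \<in> S" by auto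
  then obtain k l where "R = cell k x" "S = cell l x" using cellsE assms by metis
  then show False using * cell_nested[of k l x] cell_nested[of l k x] by (cases "k \<le> l") auto
qed

definition maximals :: "(real^'n) set set \<Rightarrow> (real^'n) set set" where
  "maximals \<G> = {R \<in> \<G>. \<forall>S\<in>\<G>. R \<subseteq> S \<longrightarrow> S = R}"

text \<open>There is no largest cell, so an upward chain could be endless; finiteness above each
  member guarantees a maximal one. Inside a fixed cell it follows from
  \<open>finite_cells_between\<close>.\<close>

lemma maximals:
  assumes \<G>: "\<G> \<subseteq> cells" and fin: "\<And>R. R \<in> \<G> \<Longrightarrow> finite {S\<in>\<G>. R \<subseteq> S}"
  shows "maximals \<G> \<subseteq> \<G>" "countable (maximals \<G>)" "disjoint (maximals \<G>)" "\<Union>(maximals \<G>) = \<Union>\<G>"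
    "\<And>R. R \<in> \<G> \<Longrightarrow> \<exists>S\<in>maximals \<G>. R \<subseteq> S"
proof -
  show sub: "maximals \<G> \<subseteq> \<G>" by (auto simp: maximals_def)
  then show "countable (maximals \<G>)"
    using \<G> countable_cells by (meson countable_subset order_trans)
  show "disjoint (maximals \<G>)"
  proof (rule disjointI)
    fix R S assume RS: "R \<in> maximals \<G>" "S \<in> maximals \<G>" "R \<noteq> S"
    then have "R \<in> cells" "S \<in> cells" using sub \<G> by auto
    with RS show "R \<inter> S = {}" using cells_nested_or_disjoint[of R S] unfolding maximals_def by blast
  qed
  show ex: "\<exists>S\<in>maximals \<G>. R \<subseteq> S" if R: "R \<in> \<G>" for R
  proof -
    have "{S\<in>\<G>. R \<subseteq> S} \<noteq> {}" using R by blast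
    from finite_has_maximal[OF fin[OF R] this]
    obtain S where S: "S \<in> \<G>" "R \<subseteq> S" and "\<forall>T\<in>{S\<in>\<G>. R \<subseteq> S}. S \<subseteq> T \<longrightarrow> S = T"
      by (elim bexE) blast
    then have "S \<in> maximals \<G>" unfolding maximals_def by blast
    then show ?thesis using S by blast
  qed
  show "\<Union>(maximals \<G>) = \<Union>\<G>"
    using sub ex by blast
qed

lemma finite_cells_between:
  assumes "R \<in> cells"
  shows "finite {S \<in> cells. R \<subseteq> S \<and> S \<subseteq> cell k x}"
proof -
  obtain l y where R: "R = cell l y" using assms by (auto simp: cells_def)
  have "{S \<in> cells. R \<subseteq> S \<and> S \<subseteq> cell k x} \<subseteq> (\<lambda>j. cell j y) ` {min k l..max k l}"
  proof safe
    fix S assume S: "S \<in> cells" "R \<subseteq> S" "S \<subseteq> cell k x"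
    then have y: "y \<in> S" using R in_cell by auto
    then obtain j where j: "S = cell j y" using cellsE S by blast
    have kx: "cell k x = cell k y" using y S cell_eq by blast
    \<comment> \<open>Cells through \<open>y\<close> are totally ordered by level. Outside the range
      between \<open>k\<close> and \<open>l\<close> the inclusions force equality with an end cell,
      so this finite range of levels lists every candidate.\<close>
    consider "j < min k l" | "j > max k l" | "j \<in> {min k l..max k l}" by fastforce
    then show "S \<in> (\<lambda>j. cell j y) ` {min k l..max k l}"
    proof cases
      case 1
      then have "S = cell k y" using S(3) cell_nested[of j k y] j kx by auto
      then show ?thesis by auto
    next
      case 2
      then have "S = cell l y" using S(2) cell_nested[of l j y] j R by auto
      then show ?thesis by auto
    qed (auto simp: j)
  qed
  then show ?thesis by (rule finite_subset) auto
qed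

text \<open>A Calderon--Zygmund stopping argument: one passage from \<open>E\<close> to the union of the cells in
  which \<open>E\<close> has density above \<open>\<alpha> / K\<close> gains a factor \<open>\<beta>\<close> in \<open>\<nu>\<close> and loses \<open>K / \<alpha>\<close> in volume.\<close>

lemma A_infinity_level_set:
  fixes \<nu> :: "(real^'n) measure"
  assumes \<nu>: "sets \<nu> = sets borel" and \<alpha>: "0 < \<alpha>" "\<alpha> < 1"
    and A: "\<And>R E. R \<in> cells \<Longrightarrow> E \<in> sets borel \<Longrightarrow> E \<subseteq> R \<Longrightarrow>
      emeasure lborel E \<le> ennreal \<alpha> * emeasure lborel R \<Longrightarrow> emeasure \<nu> E \<le> ennreal \<beta> * emeasure \<nu> R"
    and "0 \<le> \<beta>"
    and E: "E \<in> sets borel" "E \<subseteq> cell k z" "k \<le> N" "\<And>x. x \<in> E \<Longrightarrow> cell N x \<subseteq> E"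
    and le: "emeasure lborel E \<le> ennreal ((\<alpha> / K) ^ j) * emeasure lborel (cell k z)"
  shows "emeasure \<nu> E \<le> ennreal (\<beta> ^ j) * emeasure \<nu> (cell k z)"
  using E le
proof (induction j arbitrary: E)
  case 0
  then show ?case by (simp add: emeasure_mono \<nu>)
next
  case (Suc j)
  define \<gamma> where "\<gamma> = \<alpha> / K"
  have \<gamma>: "0 < \<gamma>" "\<gamma> < 1" using \<alpha> K by (auto simp: \<gamma>_def)
  let ?Q = "cell k z"
  \<comment> \<open>The condition on the level-\<open>N\<close> cells says that \<open>R\<close> is
    a union of such cells. It passes to \<open>F\<close>, so that the induction hypothesis applies
    to \<open>F\<close> with the same \<open>N\<close>.\<close>
  define \<G> where "\<G> = {R \<in> cells. R \<subseteq> ?Q \<and> cell N ` R \<subseteq> Pow R \<and> ennreal \<gamma> * emeasure lborel R < emeasure lborel (E \<inter> R)}"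
  have \<G>: "\<G> \<subseteq> cells" by (auto simp: \<G>_def)
  have fin: "finite {S\<in>\<G>. R \<subseteq> S}" if "R \<in> \<G>" for R
    by (rule finite_subset[OF _ finite_cells_between[of R k z]]) (use that in \<open>auto simp: \<G>_def\<close>)
  note max = maximals[OF \<G> fin]
  define F where "F = \<Union>\<G>"
  have "F \<in> sets borel"
    unfolding F_def using \<G> countable_cells cells_borel by (intro sets.countable_Union) (auto intro: countable_subset)
  have cell_strict: "ennreal c * emeasure lborel (cell i x) < emeasure lborel (cell i x)" if "0 < c" "c < 1" for c i x
    using K that by (simp add: emeasure_cell ennreal_lessI flip: ennreal_mult)
  have "E \<subseteq> F"
  proof
    fix x assume x: "x \<in> E"
    then have sub: "cell N x \<subseteq> E" by (rule Suc.prems)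
    then have "E \<inter> cell N x = cell N x" by auto
    moreover have "cell N ` cell N x \<subseteq> Pow (cell N x)" using cell_eq by auto
    moreover have "cell N x \<subseteq> ?Q" using sub Suc.prems(2) by blast
    moreover have "ennreal \<gamma> * emeasure lborel (cell N x) < emeasure lborel (cell N x)"
      using cell_strict \<gamma> by blast
    ultimately have "cell N x \<in> \<G>"
      unfolding \<G>_def by simp
    then show "x \<in> F" using in_cell by (auto simp: F_def)
  qed
  have vol: "emeasure lborel F \<le> ennreal (1 / \<gamma>) * emeasure lborel E"
  proof -
    have "emeasure lborel (UNIV \<inter> \<Union>(maximals \<G>)) \<le> ennreal (1 / \<gamma>) * emeasure lborel (E \<inter> \<Union>(maximals \<G>))"
    proof (rule emeasure_Int_Union_le[OF max(2,3)])
      fix R assume "R \<in> maximals \<G>"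
      then have "ennreal \<gamma> * emeasure lborel R \<le> emeasure lborel (E \<inter> R)"
        using max(1) by (auto simp: \<G>_def)
      then have "ennreal (1 / \<gamma>) * (ennreal \<gamma> * emeasure lborel R) \<le> ennreal (1 / \<gamma>) * emeasure lborel (E \<inter> R)"
        by (rule mult_left_mono) simp
      then show "emeasure lborel (UNIV \<inter> R) \<le> ennreal (1 / \<gamma>) * emeasure lborel (E \<inter> R)"
        using \<gamma> by (simp flip: ennreal_mult mult.assoc)
    qed (use max(1) \<G> cells_borel Suc.prems in auto)
    then show ?thesis using max(4) \<open>E \<subseteq> F\<close> by (simp add: F_def Int_absorb2)
  qed
  have gain: "emeasure \<nu> E \<le> ennreal \<beta> * emeasure \<nu> F"
  proof -
    have "emeasure \<nu> (E \<inter> \<Union>(maximals \<G>)) \<le> ennreal \<beta> * emeasure \<nu> (UNIV \<inter> \<Union>(maximals \<G>))"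
    proof (rule emeasure_Int_Union_le[OF max(2,3)])
      fix R assume R: "R \<in> maximals \<G>"
      then have R\<G>: "R \<in> \<G>" using max(1) by auto
      then obtain i x where Ri: "R = cell i x" by (auto simp: \<G>_def cells_def)
      have "x \<in> R" using in_cell Ri by simp
      then have x: "x \<in> ?Q" "cell N x \<subseteq> R" using R\<G> unfolding \<G>_def by blast+
      have Qx: "?Q = cell k x" using cell_eq x by auto
      \<comment> \<open>\<open>E\<close> has density at most \<gamma>^(j+1) <= \<gamma> in the whole
        cell, so that cell is never selected and every maximal cell has its parent inside
        it.\<close>
      have "\<not> i \<le> k"
      proof
        assume "i \<le> k"
        then have "R = ?Q" using R\<G> cell_nested[of i k x] Ri Qx by (auto simp: \<G>_def)
        then have "ennreal \<gamma> * emeasure lborel ?Q < emeasure lborel E"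
          using R\<G> Suc.prems(2) by (auto simp: \<G>_def Int_absorb2)
        also have "\<dots> \<le> ennreal (\<gamma> ^ Suc j) * emeasure lborel ?Q"
          using Suc.prems by (simp add: \<gamma>_def)
        also have "\<dots> \<le> ennreal \<gamma> * emeasure lborel ?Q"
          using \<gamma> power_le_one[of \<gamma> j] by (intro mult_right_mono ennreal_leI) (auto simp: mult_le_cancel_left1)
        finally show False by simp
      qed
      \<comment> \<open>By maximality the parent was rejected: the density of \<open>E\<close> in it
        is at most \<gamma> = \<alpha> / K. As \<open>R\<close> fills 1 / K of its parent, the
        density of \<open>E\<close> in \<open>R\<close> is at most \<alpha>, which is what the
        hypothesis \<open>A\<close> asks for.\<close>
      define P where "P = cell (i - 1) x"
      have RP: "R \<subseteq> P" using cell_nested[of "i - 1" i x] by (simp add: Ri P_def)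
      have "R \<noteq> P" using cell_inject[of i x "i - 1" x] by (auto simp: Ri P_def)
      then have "P \<notin> \<G>" using R RP by (auto simp: maximals_def)
      moreover have "P \<subseteq> ?Q" using \<open>\<not> i \<le> k\<close> cell_nested[of k "i - 1" x] by (simp add: P_def Qx)
      moreover have "i \<le> N"
      proof (rule ccontr)
        assume "\<not> i \<le> N"
        then have "R = cell N x" using x(2) cell_nested[of N i x] Ri by auto
        then show False using cell_inject Ri \<open>\<not> i \<le> N\<close> by blast
      qed
      then have "cell N ` P \<subseteq> Pow P"
        using cell_nested[of "i - 1" N] cell_eq[of _ "i - 1" x] by (auto simp: P_def)
      moreover have "P \<in> cells" by (simp add: P_def)
      ultimately have "\<not> (ennreal \<gamma> * emeasure lborel P < emeasure lborel (E \<inter> P))"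
        unfolding \<G>_def by blast
      then have "emeasure lborel (E \<inter> P) \<le> ennreal \<gamma> * emeasure lborel P"
        by (simp add: not_less)
      moreover have "emeasure lborel (E \<inter> R) \<le> emeasure lborel (E \<inter> P)"
        using RP Suc.prems(1) by (intro emeasure_mono) (auto simp: P_def)
      ultimately have "emeasure lborel (E \<inter> R) \<le> ennreal \<gamma> * emeasure lborel P"
        by simp
      also have "\<dots> = ennreal \<alpha> * emeasure lborel R"
      proof -
        have "K powr (- real_of_int (i - 1)) = K * K powr (- real_of_int i)"
          using K powr_add[of K 1 "- real_of_int i"] by simp
        then show ?thesis
          using K \<alpha> by (simp add: P_def Ri emeasure_cell \<gamma>_def flip: ennreal_mult)
      qed
      finally have "emeasure \<nu> (E \<inter> R) \<le> ennreal \<beta> * emeasure \<nu> R"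
        using Suc.prems(1) Ri by (intro A) auto
      then show "emeasure \<nu> (E \<inter> R) \<le> ennreal \<beta> * emeasure \<nu> (UNIV \<inter> R)" by simp
    qed (use max(1) \<G> cells_borel Suc.prems \<nu> in auto)
    then show ?thesis using max(4) \<open>E \<subseteq> F\<close> by (simp add: F_def Int_absorb2)
  qed
  have "emeasure \<nu> F \<le> ennreal (\<beta> ^ j) * emeasure \<nu> ?Q"
  proof (rule Suc.IH)
    show "F \<in> sets borel" by fact
    show "F \<subseteq> ?Q" by (auto simp: F_def \<G>_def)
    show "k \<le> N" by fact
    show "cell N x \<subseteq> F" if "x \<in> F" for x
      using that by (auto simp: F_def \<G>_def)
    have "emeasure lborel F \<le> ennreal (1 / \<gamma>) * (ennreal (\<gamma> ^ Suc j) * emeasure lborel ?Q)"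
      using vol Suc.prems by (intro order_trans[OF vol] mult_left_mono) (auto simp: \<gamma>_def)
    also have "\<dots> = ennreal (\<gamma> ^ j) * emeasure lborel ?Q"
      using \<gamma> by (simp flip: ennreal_mult mult.assoc)
    finally show "emeasure lborel F \<le> ennreal ((\<alpha> / K) ^ j) * emeasure lborel ?Q"
      by (simp add: \<gamma>_def)
  qed
  then have "emeasure \<nu> E \<le> ennreal \<beta> * (ennreal (\<beta> ^ j) * emeasure \<nu> ?Q)"
    by (intro order_trans[OF gain] mult_left_mono) auto
  then show ?case
    using \<open>0 \<le> \<beta>\<close> by (simp add: ennreal_mult mult.assoc)
qed

text \<open>The level-set lemma covers unions of cells of one level. A Borel set is reached by outer
  regularity, an open superset being exhausted by the cells of ever finer level that it contains.
  The strict inequality leaves room for this superset.\<close>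

lemma A_infinity_set:
  fixes \<nu> :: "(real^'n) measure"
  assumes \<nu>: "sets \<nu> = sets borel" and \<alpha>: "0 < \<alpha>" "\<alpha> < 1"
    and A: "\<And>R E. R \<in> cells \<Longrightarrow> E \<in> sets borel \<Longrightarrow> E \<subseteq> R \<Longrightarrow>
      emeasure lborel E \<le> ennreal \<alpha> * emeasure lborel R \<Longrightarrow> emeasure \<nu> E \<le> ennreal \<beta> * emeasure \<nu> R"
    and "0 \<le> \<beta>"
    and E: "E \<in> sets borel" "E \<subseteq> cell k z"
    and less: "emeasure lborel E < ennreal ((\<alpha> / K) ^ j) * emeasure lborel (cell k z)"
  shows "emeasure \<nu> E \<le> ennreal (\<beta> ^ j) * emeasure \<nu> (cell k z)"
proof -
  define c where "c = (\<alpha> / K) ^ j * K powr (- real_of_int k)"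
  have c: "ennreal ((\<alpha> / K) ^ j) * emeasure lborel (cell k z) = ennreal c"
    using \<alpha> K by (simp add: c_def emeasure_cell ennreal_mult)
  then obtain m where m: "emeasure lborel E = ennreal m" "0 \<le> m" "m < c"
    using less by (cases "emeasure lborel E") (auto simp: ennreal_less_iff)
  obtain U where U: "open U" "E \<subseteq> U" "emeasure lborel (U - E) < ennreal (c - m)"
    using outer_regular_lborel[OF E(1), of "c - m"] m by auto
  have [measurable]: "U \<in> sets borel" using U by auto
  have "emeasure lborel U = emeasure lborel E + emeasure lborel (U - E)"
    using E(1) U(2) by (subst plus_emeasure) (auto intro!: arg_cong[where f="emeasure _"])
  also have "\<dots> \<le> ennreal m + ennreal (c - m)"
    using m U by (intro add_mono) auto
  also have "\<dots> = ennreal c" using m by (simp flip: ennreal_plus)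
  finally have Uc: "emeasure lborel U \<le> ennreal c" .
  define G where "G i = \<Union>{R \<in> range (cell (k + int i)). R \<subseteq> U \<inter> cell k z}" for i
  have G_borel: "G i \<in> sets borel" for i
    unfolding G_def by (intro sets.countable_Union countable_subset[OF _ countable_level]) auto
  have G_iff: "x \<in> G i \<longleftrightarrow> x \<in> cell k z \<and> cell (k + int i) x \<subseteq> U" for x i
  proof
    assume "x \<in> G i"
    then obtain y where y: "x \<in> cell (k + int i) y" "cell (k + int i) y \<subseteq> U \<inter> cell k z"
      unfolding G_def by blast
    then show "x \<in> cell k z \<and> cell (k + int i) x \<subseteq> U"
      using cell_eq[OF y(1)] by blast
  next
    assume x: "x \<in> cell k z \<and> cell (k + int i) x \<subseteq> U"
    then have "cell (k + int i) x \<subseteq> U \<inter> cell k z"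
      using cell_nested[of k "k + int i" x] cell_eq[of x k z] by simp
    then show "x \<in> G i"
      unfolding G_def using in_cell[of x "k + int i"] by blast
  qed
  have "incseq G"
  proof (rule incseq_SucI, rule subsetI)
    fix i x assume "x \<in> G i"
    then show "x \<in> G (Suc i)"
      using cell_nested[of "k + int i" "k + int (Suc i)" x] unfolding G_iff by force
  qed
  have "E \<subseteq> (\<Union>i. G i)"
  proof
    fix x assume x: "x \<in> E"
    then obtain l where "cell l x \<subseteq> U" using cell_small U by blast
    then have "x \<in> G (nat (l - k))"
      using x E(2) cell_nested[of l "k + int (nat (l - k))" x] unfolding G_iff by force
    then show "x \<in> (\<Union>i. G i)" by auto
  qed
  then have "emeasure \<nu> E \<le> emeasure \<nu> (\<Union>i. G i)"
    using G_borel by (intro emeasure_mono) (auto simp: \<nu>)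
  also have "\<dots> = (SUP i. emeasure \<nu> (G i))"
    using G_borel \<open>incseq G\<close> by (intro SUP_emeasure_incseq[symmetric]) (auto simp: \<nu>)
  also have "\<dots> \<le> ennreal (\<beta> ^ j) * emeasure \<nu> (cell k z)"
  proof (rule SUP_least)
    fix i
    show "emeasure \<nu> (G i) \<le> ennreal (\<beta> ^ j) * emeasure \<nu> (cell k z)"
    proof (rule A_infinity_level_set[OF \<nu> \<alpha> A \<open>0 \<le> \<beta>\<close> G_borel, where N="k + int i"])
      show "G i \<subseteq> cell k z" by (auto simp: G_iff)
      show "cell (k + int i) x \<subseteq> G i" if "x \<in> G i" for x
      proof
        fix y assume y: "y \<in> cell (k + int i) x"
        then have "y \<in> cell k z"
          using that cell_nested[of k "k + int i" x] cell_eq[of x k z] by (auto simp: G_iff)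
        then show "y \<in> G i" using that cell_eq[OF y] by (simp add: G_iff)
      qed
      have "G i \<subseteq> U"
        using in_cell unfolding subset_iff G_iff by blast
      then have "emeasure lborel (G i) \<le> emeasure lborel U"
        by (intro emeasure_mono) auto
      then show "emeasure lborel (G i) \<le> ennreal ((\<alpha> / K) ^ j) * emeasure lborel (cell k z)"
        using Uc c by simp
    qed auto
  qed
  finally show ?thesis .
qed

end

section \<open>Reverse Hoelder inequality and weak-type bounds\<close>

context dyadic_grid
begin

text \<open>The Coifman-Fefferman form of the dyadic A_infinity condition at a single pair \<alpha>,
  \<beta>; the preceding lemmas upgrade it to the pairs (\<alpha> / K)^j, \<beta>^j.\<close>

definition A_infinity :: "real \<Rightarrow> real \<Rightarrow> (real^'n \<Rightarrow> ennreal) \<Rightarrow> bool" where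
  "A_infinity \<alpha> \<beta> w \<longleftrightarrow>
    (\<forall>R\<in>cells. \<forall>E\<in>sets borel. E \<subseteq> R \<longrightarrow> emeasure lborel E \<le> ennreal \<alpha> * emeasure lborel R \<longrightarrow>
      (\<integral>\<^sup>+x\<in>E. w x \<partial>lborel) \<le> ennreal \<beta> * (\<integral>\<^sup>+x\<in>R. w x \<partial>lborel))"

text \<open>The level set w > 2 \<gamma>^(-j) has relative volume at most \<gamma>^j / 2, hence
  carries at most the fraction \<beta>^j of the mass, and a small power of \<open>w\<close> cannot
  outgrow this decay. Both \<epsilon> and \<open>C\<close> are chosen before \<open>w\<close> and
  \<open>Q\<close>, so the gain is uniform over all reducing bases.\<close>

lemma reverse_Holder:
  assumes \<alpha>: "0 < \<alpha>" "\<alpha> < 1" and \<beta>: "0 < \<beta>" "\<beta> < 1"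
  shows "\<exists>\<epsilon>>0. \<exists>C. \<forall>w Q. w \<in> borel_measurable borel \<longrightarrow>
    A_infinity \<alpha> \<beta> w \<longrightarrow> Q \<in> cells \<longrightarrow> average Q w \<le> 1 \<longrightarrow> average Q (\<lambda>x. ennreal_powr (w x) (1 + \<epsilon>)) \<le> ennreal C"
proof -
  define \<gamma> where "\<gamma> = \<alpha> / K"
  have \<gamma>: "0 < \<gamma>" "\<gamma> < 1" using \<alpha> K by (auto simp: \<gamma>_def)
  \<comment> \<open>Chosen so that (1 / \<gamma>)^\<epsilon> = \<beta>^(-1/2): the growth of
    w^\<epsilon> times the decay of the mass is then a geometric series of ratio sqrt
    \<beta>.\<close>
  define \<epsilon> where "\<epsilon> = ln (1 / \<beta>) / (2 * ln (1 / \<gamma>))"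
  have \<epsilon>: "0 < \<epsilon>" using \<beta> \<gamma> by (simp add: \<epsilon>_def)
  have "(1 / \<gamma>) powr \<epsilon> = exp (ln (1 / \<beta>) / 2)"
    using \<gamma> by (simp add: powr_def \<epsilon>_def)
  also have "\<dots> < exp (ln (1 / \<beta>))" using \<beta> ln_gt_zero[of "1 / \<beta>"] unfolding exp_less_cancel_iff by simp
  also have "\<dots> = 1 / \<beta>" using \<beta> by (intro exp_ln) simp
  finally have r: "(1 / \<gamma>) powr \<epsilon> * \<beta> < 1" using \<beta> by (simp add: field_simps)
  define r where "r = (1 / \<gamma>) powr \<epsilon> * \<beta>"
  have r: "0 \<le> r" "r < 1" using r \<beta> by (auto simp: r_def)
  define c where "c j = (2 * (1 / \<gamma>) ^ Suc j) powr \<epsilon>" for j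
  have c: "c j * \<beta> ^ j = 2 powr \<epsilon> * (1 / \<gamma>) powr \<epsilon> * r ^ j" for j
  proof -
    have "((1 / \<gamma>) ^ Suc j) powr \<epsilon> = ((1 / \<gamma>) powr \<epsilon>) ^ Suc j"
      using \<gamma> by (subst powr_power) (simp_all add: powr_powr mult.commute flip: powr_realpow del: power_Suc)
    moreover have "c j = 2 powr \<epsilon> * ((1 / \<gamma>) ^ Suc j) powr \<epsilon>"
      unfolding c_def by (rule powr_mult)
    ultimately show ?thesis
      unfolding r_def power_mult_distrib power_Suc by (simp only: mult_ac)
  qed
  define C where "C = 2 powr \<epsilon> + 2 powr \<epsilon> * (1 / \<gamma>) powr \<epsilon> * (1 / (1 - r))"
  have main: "average Q (\<lambda>x. ennreal_powr (w x) (1 + \<epsilon>)) \<le> ennreal C"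
    if w [measurable]: "w \<in> borel_measurable borel"
    and A: "\<And>R E. R \<in> cells \<Longrightarrow> E \<in> sets borel \<Longrightarrow> E \<subseteq> R \<Longrightarrow> emeasure lborel E \<le> ennreal \<alpha> * emeasure lborel R \<Longrightarrow>
      (\<integral>\<^sup>+x\<in>E. w x \<partial>lborel) \<le> ennreal \<beta> * (\<integral>\<^sup>+x\<in>R. w x \<partial>lborel)"
    and Q: "Q \<in> cells" "average Q w \<le> 1" for w Q
  proof -
    have aQ: "avg_set Q" and [measurable]: "Q \<in> sets borel"
      using Q avg_set_cell cells_borel by auto
    have wQ: "(\<integral>\<^sup>+x\<in>Q. w x \<partial>lborel) \<le> emeasure lborel Q"
      using mult_left_mono[OF Q(2), of "emeasure lborel Q"] by (simp add: emeasure_mult_average[OF aQ])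
    obtain k z where Qk: "Q = cell k z" using Q by (auto simp: cells_def)
    \<comment> \<open>The factor 2 makes Chebyshev's bound strict, as \<open>A_infinity_set\<close>
      requires.\<close>
    define E where "E j = {x \<in> Q. ennreal (2 * (1 / \<gamma>) ^ j) < w x}" for j
    have E [measurable]: "E j \<in> sets borel" for j
    proof -
      have "E j = Q \<inter> {x \<in> space borel. ennreal (2 * (1 / \<gamma>) ^ j) < w x}"
        by (auto simp: E_def)
      also have "\<dots> \<in> sets borel" by measurable
      finally show ?thesis .
    qed
    have ind: "w x * indicator (E j) x * indicator Q x = w x * indicator (E j) x" for x j
      by (auto simp: E_def indicator_def)
    have mass: "(\<integral>\<^sup>+x. w x * indicator (E j) x \<partial>lborel) \<le> ennreal (\<beta> ^ j) * emeasure lborel Q" for j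
    proof -
      have "ennreal (2 * (1 / \<gamma>) ^ j) * emeasure lborel (E j) = (\<integral>\<^sup>+x\<in>E j. ennreal (2 * (1 / \<gamma>) ^ j) \<partial>lborel)"
        by (simp add: nn_integral_cmult_indicator)
      also have "\<dots> \<le> (\<integral>\<^sup>+x\<in>Q. w x \<partial>lborel)"
        by (intro nn_integral_mono) (auto simp: E_def indicator_def less_imp_le)
      finally have le: "ennreal (2 * (1 / \<gamma>) ^ j) * emeasure lborel (E j) \<le> emeasure lborel Q" using wQ by simp
      have "ennreal (\<gamma> ^ j / 2) * (ennreal (2 * (1 / \<gamma>) ^ j) * emeasure lborel (E j)) \<le> ennreal (\<gamma> ^ j / 2) * emeasure lborel Q"
        using le by (rule mult_left_mono) simp
      then have "emeasure lborel (E j) \<le> ennreal (\<gamma> ^ j / 2) * emeasure lborel Q"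
        using \<gamma> by (simp add: power_one_over field_simps flip: ennreal_mult mult.assoc)
      also have "\<dots> < ennreal (\<gamma> ^ j) * emeasure lborel Q"
        using \<gamma> K by (simp add: Qk emeasure_cell ennreal_lessI flip: ennreal_mult)
      finally have "emeasure (density lborel w) (E j) \<le> ennreal (\<beta> ^ j) * emeasure (density lborel w) (cell k z)"
        using A \<alpha> \<beta> E[of j]
        by (intro A_infinity_set[where \<alpha>=\<alpha>]) (auto simp: emeasure_density cells_borel \<gamma>_def Qk E_def)
      then have "(\<integral>\<^sup>+x. w x * indicator (E j) x \<partial>lborel) \<le> ennreal (\<beta> ^ j) * (\<integral>\<^sup>+x\<in>Q. w x \<partial>lborel)"
        by (simp add: emeasure_density Qk)
      also have "\<dots> \<le> ennreal (\<beta> ^ j) * emeasure lborel Q"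
        using wQ by (rule mult_left_mono) simp
      finally show ?thesis .
    qed
    have pointwise: "ennreal_powr (w x) (1 + \<epsilon>) * indicator Q x \<le>
      ennreal (2 powr \<epsilon>) * (w x * indicator Q x) + (\<Sum>j. ennreal (c j) * (w x * indicator (E j) x))"
      if "w x \<noteq> top" for x
    proof (cases "x \<in> Q \<and> 2 < w x")
      case False
      have "ennreal_powr (w x) (1 + \<epsilon>) * indicator Q x \<le> ennreal (2 powr \<epsilon>) * (w x * indicator Q x)"
      proof (cases "x \<in> Q")
        case True
        then have "ennreal_powr (w x) \<epsilon> \<le> ennreal_powr 2 \<epsilon>"
          using False \<epsilon> by (intro ennreal_powr_mono) auto
        also have "\<dots> = ennreal (2 powr \<epsilon>)"
          using ennreal_powr_ennreal[of 2 \<epsilon>] by simp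
        finally have "w x * ennreal_powr (w x) \<epsilon> \<le> w x * ennreal (2 powr \<epsilon>)"
          by (rule mult_left_mono) simp
        then show ?thesis using True by (simp add: ennreal_powr_add mult.commute)
      qed simp
      then show ?thesis by (rule order_trans) simp
    next
      case True
      obtain y where y: "w x = ennreal y" "0 \<le> y" using \<open>w x \<noteq> top\<close> by (cases "w x") auto
      have "2 < y" using True y by (metis ennreal_less_iff ennreal_numeral zero_le_numeral)
      have "\<exists>m. y < 2 * (1 / \<gamma>) ^ m"
        using real_arch_pow[of "1 / \<gamma>" "y / 2"] \<gamma> by (auto simp: field_simps)
      \<comment> \<open>The least such \<open>m\<close> brackets \<open>y\<close> between
        consecutive levels. Since y > 2 excludes m = 0, the point lies in \<open>E j\<close> for j =
        m - 1, while y^\<epsilon> is at most \<open>c j\<close>.\<close>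
      then obtain m where m: "y \<le> 2 * (1 / \<gamma>) ^ m" "\<And>i. i < m \<Longrightarrow> \<not> y \<le> 2 * (1 / \<gamma>) ^ i"
        using exists_least_iff[of "\<lambda>m. y \<le> 2 * (1 / \<gamma>) ^ m"] by (auto intro: less_imp_le)
      then obtain j where j: "m = Suc j" using \<open>2 < y\<close> by (cases m) auto
      have "x \<in> E j"
        using m(2)[of j] True y \<gamma> by (simp add: j E_def ennreal_less_iff)
      have "y powr \<epsilon> \<le> c j"
        unfolding c_def using m(1) \<open>2 < y\<close> \<epsilon> by (intro powr_mono2) (auto simp: j)
      then have "ennreal (y powr \<epsilon>) * w x \<le> ennreal (c j) * w x"
        by (intro mult_right_mono ennreal_leI) auto
      then have "ennreal_powr (w x) (1 + \<epsilon>) * indicator Q x \<le> ennreal (c j) * (w x * indicator (E j) x)"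
        using True \<open>x \<in> E j\<close> y by (simp add: ennreal_powr_add ennreal_powr_ennreal mult.commute)
      also have "\<dots> \<le> (\<Sum>i. ennreal (c i) * (w x * indicator (E i) x))"
        using ennreal_suminf_lessD le_less_linear less_irrefl by blast
      finally show ?thesis by (rule order_trans) simp
    qed
    have fin: "AE x in lborel. x \<in> Q \<longrightarrow> w x \<noteq> top"
    proof -
      have "(\<integral>\<^sup>+x\<in>Q. w x \<partial>lborel) \<noteq> top" using wQ avg_setD(3)[OF aQ] by (auto simp: top_unique)
      then have "AE x in lborel. w x * indicator Q x \<noteq> top"
        using nn_integral_PInf_AE[of "\<lambda>x. w x * indicator Q x" lborel] by simp
      then show ?thesis by eventually_elim (auto simp: indicator_def)
    qed
    have "(\<integral>\<^sup>+x\<in>Q. ennreal_powr (w x) (1 + \<epsilon>) \<partial>lborel) \<le>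
      (\<integral>\<^sup>+x. ennreal (2 powr \<epsilon>) * (w x * indicator Q x) + (\<Sum>j. ennreal (c j) * (w x * indicator (E j) x)) \<partial>lborel)"
    proof (rule nn_integral_mono_AE, use fin in eventually_elim)
      fix x assume *: "x \<in> Q \<longrightarrow> w x \<noteq> top"
      show "ennreal_powr (w x) (1 + \<epsilon>) * indicator Q x \<le>
        ennreal (2 powr \<epsilon>) * (w x * indicator Q x) + (\<Sum>j. ennreal (c j) * (w x * indicator (E j) x))"
        by (cases "x \<in> Q") (use * pointwise[of x] in auto)
    qed
    also have "\<dots> = ennreal (2 powr \<epsilon>) * (\<integral>\<^sup>+x\<in>Q. w x \<partial>lborel) + (\<Sum>j. ennreal (c j) * (\<integral>\<^sup>+x. w x * indicator (E j) x \<partial>lborel))"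
      by (simp add: nn_integral_add nn_integral_cmult nn_integral_suminf)
    also have "\<dots> \<le> ennreal (2 powr \<epsilon>) * emeasure lborel Q + (\<Sum>j. ennreal (c j) * (ennreal (\<beta> ^ j) * emeasure lborel Q))"
      by (intro add_mono mult_left_mono suminf_le wQ mass) auto
    also have "(\<Sum>j. ennreal (c j) * (ennreal (\<beta> ^ j) * emeasure lborel Q)) = (\<Sum>j. ennreal (c j * \<beta> ^ j)) * emeasure lborel Q"
      using \<beta> by (subst ennreal_suminf_multc[symmetric]) (simp add: c_def ennreal_mult mult.assoc)
    also have "(\<Sum>j. ennreal (c j * \<beta> ^ j)) = ennreal (2 powr \<epsilon> * (1 / \<gamma>) powr \<epsilon> * (1 / (1 - r)))"
    proof -
      have "(\<lambda>j. c j * \<beta> ^ j) sums (2 powr \<epsilon> * (1 / \<gamma>) powr \<epsilon> * (1 / (1 - r)))"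
        unfolding c using r by (intro sums_mult geometric_sums) auto
      then show ?thesis
        using \<beta> by (intro suminf_ennreal_eq) (auto simp: c_def)
    qed
    also have "ennreal (2 powr \<epsilon>) * emeasure lborel Q + ennreal (2 powr \<epsilon> * (1 / \<gamma>) powr \<epsilon> * (1 / (1 - r))) * emeasure lborel Q
      = ennreal C * emeasure lborel Q"
      using r by (simp add: C_def ennreal_plus distrib_right)
    finally have "emeasure lborel Q * average Q (\<lambda>x. ennreal_powr (w x) (1 + \<epsilon>)) \<le> emeasure lborel Q * ennreal C"
      by (simp add: emeasure_mult_average[OF aQ] mult.commute)
    then show ?thesis
      using avg_setD[OF aQ] by (simp add: ennreal_mult_le_mult_iff)
  qed
  show ?thesis
  proof (rule exI[of _ \<epsilon>], rule conjI[OF \<epsilon>], rule exI[of _ C], intro allI impI)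
    fix w :: "real^'n \<Rightarrow> ennreal" and Q
    assume w: "w \<in> borel_measurable borel" "A_infinity \<alpha> \<beta> w" and Q: "Q \<in> cells" "average Q w \<le> 1"
    show "average Q (\<lambda>x. ennreal_powr (w x) (1 + \<epsilon>)) \<le> ennreal C"
      using w(2) by (intro main w(1) Q) (auto simp: A_infinity_def)
  qed
qed

lemma finite_maximals:
  assumes "finite \<F>" "\<F> \<subseteq> cells"
  shows "finite (maximals \<F>)" "maximals \<F> \<subseteq> \<F>" "disjoint (maximals \<F>)" "\<Union>(maximals \<F>) = \<Union>\<F>"
    "\<And>R. R \<in> \<F> \<Longrightarrow> \<exists>S\<in>maximals \<F>. R \<subseteq> S" "countable (maximals \<F>)"
  using maximals[OF assms(2)] assms(1) finite_subset[of "maximals \<F>" \<F>] by auto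

lemma emeasure_Union_maximals_le:
  assumes \<F>: "finite \<F>" "\<F> \<subseteq> cells" and [measurable]: "f \<in> borel_measurable borel"
    and le: "\<And>R. R \<in> \<F> \<Longrightarrow> emeasure lborel R \<le> c * (\<integral>\<^sup>+x\<in>R. f x \<partial>lborel)"
  shows "emeasure lborel (\<Union>\<F>) \<le> c * (\<integral>\<^sup>+x\<in>\<Union>\<F>. f x \<partial>lborel)"
proof -
  note max = finite_maximals[OF \<F>]
  have borel: "R \<in> sets borel" if "R \<in> \<F>" for R using that \<F> cells_borel by auto
  have "\<Union>\<F> \<in> sets borel" using \<F> borel by (intro sets.finite_Union) auto
  moreover have "emeasure lborel (UNIV \<inter> \<Union>(maximals \<F>)) \<le> c * emeasure (density lborel f) (UNIV \<inter> \<Union>(maximals \<F>))"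
    using max(2) borel le by (intro emeasure_Int_Union_le max) (auto simp: emeasure_density subset_iff)
  ultimately show ?thesis by (simp add: max(4) emeasure_density)
qed

text \<open>The part of \<open>f\<close> below height \<open>l\<close> contributes at most
  \<open>l\<close> to an average exceeding 2 l, so the rest supplies the other half. Keeping only f
  > l on the right makes the sum over dyadic heights converge later.\<close>

lemma maximal_weak_type:
  assumes \<F>: "finite \<F>" "\<F> \<subseteq> cells" and [measurable]: "f \<in> borel_measurable borel"
    and l: "0 < l" and gt: "\<And>R. R \<in> \<F> \<Longrightarrow> ennreal (2 * l) < average R f"
  shows "emeasure lborel (\<Union>\<F>) \<le> ennreal (1 / l) * (\<integral>\<^sup>+x. f x * indicator {x. ennreal l < f x} x \<partial>lborel)"
proof -
  have [measurable]: "{x. ennreal l < f x} \<in> sets borel"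
    by measurable
  have "emeasure lborel (\<Union>\<F>) \<le> ennreal (1 / l) * (\<integral>\<^sup>+x\<in>\<Union>\<F>. f x * indicator {x. ennreal l < f x} x \<partial>lborel)"
  proof (rule emeasure_Union_maximals_le[OF \<F>])
    fix R assume R: "R \<in> \<F>"
    have a: "avg_set R" and [measurable]: "R \<in> sets borel" using R \<F> avg_set_cell cells_borel by auto
    let ?m = "emeasure lborel R" and ?I = "\<integral>\<^sup>+x\<in>R. f x * indicator {x. ennreal l < f x} x \<partial>lborel"
    have "ennreal (2 * l) * ?m \<le> average R f * ?m"
      using gt[OF R] by (intro mult_right_mono) auto
    also have "\<dots> = (\<integral>\<^sup>+x\<in>R. f x \<partial>lborel)"
      using emeasure_mult_average[OF a, of f] by (simp add: mult.commute)
    also have "\<dots> \<le> (\<integral>\<^sup>+x. f x * indicator {x. ennreal l < f x} x * indicator R x + ennreal l * indicator R x \<partial>lborel)"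
      by (intro nn_integral_mono) (auto simp: indicator_def not_less)
    also have "\<dots> = ?I + ennreal l * ?m"
      by (subst nn_integral_add) (auto simp: nn_integral_cmult_indicator)
    finally have "ennreal (2 * l) * ?m \<le> ?I + ennreal l * ?m" .
    then have "ennreal l * ?m + ennreal l * ?m \<le> ennreal l * ?m + ?I"
    proof -
      have "ennreal (2 * l) = ennreal l + ennreal l" using l by (simp flip: ennreal_plus)
      then show ?thesis using \<open>ennreal (2 * l) * ?m \<le> ?I + ennreal l * ?m\<close>
        by (simp only: distrib_right add.commute)
    qed
    then have "ennreal l * ?m \<le> ?I"
      using avg_setD(3)[OF a] by (simp add: ennreal_add_left_cancel_le ennreal_mult_eq_top_iff)
    then have "ennreal (1 / l) * (ennreal l * ?m) \<le> ennreal (1 / l) * ?I"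
      by (rule mult_left_mono) simp
    then show "?m \<le> ennreal (1 / l) * ?I"
      using l by (simp flip: ennreal_mult mult.assoc)
  qed measurable
  also have "\<dots> \<le> ennreal (1 / l) * (\<integral>\<^sup>+x. f x * indicator {x. ennreal l < f x} x \<partial>lborel)"
    by (intro mult_left_mono nn_integral_mono) (auto simp: indicator_def)
  finally show ?thesis .
qed

end

section \<open>A Carleson-type estimate and a weighted maximal theorem\<close>

lemma nn_integral_SUP_finite_le_sum:
  assumes "finite I" "\<And>i. i \<in> I \<Longrightarrow> f i \<in> borel_measurable M"
  shows "(\<integral>\<^sup>+x. (SUP i\<in>I. f i x) \<partial>M) \<le> (\<Sum>i\<in>I. \<integral>\<^sup>+x. f i x \<partial>M)"
proof -
  have "(\<integral>\<^sup>+x. (SUP i\<in>I. f i x) \<partial>M) \<le> (\<integral>\<^sup>+x. (\<Sum>i\<in>I. f i x) \<partial>M)"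
  proof (intro nn_integral_mono SUP_least)
    fix x i assume "i \<in> I"
    then show "f i x \<le> (\<Sum>i\<in>I. f i x)"
      using assms(1) by (intro member_le_sum) auto
  qed
  also have "\<dots> = (\<Sum>i\<in>I. \<integral>\<^sup>+x. f i x \<partial>M)"
    using assms by (intro nn_integral_sum) auto
  finally show ?thesis .
qed

lemma geometric_layers_le:
  assumes "0 < \<theta>" "0 \<le> y"
  shows "(\<integral>\<^sup>+k. ennreal (2 powr (real_of_int k * \<theta>)) * indicator {k. 2 powr real_of_int k < y} k \<partial>count_space UNIV)
    \<le> ennreal (1 / (1 - 2 powr (- \<theta>)) * y powr \<theta>)"
proof (cases "y = 0")
  case True
  have [simp]: "\<not> 2 powr real_of_int k < 0" for k by (simp add: not_less)
  show ?thesis using True by simp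
next
  case False
  then have "0 < y" using assms by simp
  \<comment> \<open>The largest integer with 2^m < y; as the inequality is strict, this is a ceiling
    minus one rather than a floor.\<close>
  define m where "m = \<lceil>log 2 y\<rceil> - 1"
  have m: "2 powr real_of_int k < y \<longleftrightarrow> k \<le> m" for k
    using \<open>0 < y\<close> by (simp add: m_def powr_less_iff less_ceiling_iff flip: less_log_iff)
  have q: "0 \<le> 2 powr (- \<theta>)" "2 powr (- \<theta>) < 1"
    using assms powr_less_mono[of "- \<theta>" 0 2] by auto
  have bij: "bij_betw (\<lambda>j. m - int j) UNIV {..m}"
    by (rule bij_betwI[where g="\<lambda>k. nat (m - k)"]) auto
  have "(\<integral>\<^sup>+k. ennreal (2 powr (real_of_int k * \<theta>)) * indicator {k. 2 powr real_of_int k < y} k \<partial>count_space UNIV)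
    = (\<integral>\<^sup>+k. ennreal (2 powr (real_of_int k * \<theta>)) \<partial>count_space {..m})"
    by (subst nn_integral_count_space_indicator) (auto simp: m intro!: nn_integral_cong split: split_indicator)
  also have "\<dots> = (\<integral>\<^sup>+j. ennreal (2 powr (real_of_int (m - int j) * \<theta>)) \<partial>count_space UNIV)"
    by (rule nn_integral_bij_count_space[OF bij, symmetric])
  also have "\<dots> = (\<Sum>j. ennreal (2 powr (real_of_int m * \<theta>) * (2 powr (- \<theta>)) ^ j))"
    unfolding nn_integral_count_space_nat
    by (intro suminf_cong arg_cong[where f=ennreal])
      (simp add: powr_power algebra_simps flip: powr_add)
  also have "\<dots> = ennreal (2 powr (real_of_int m * \<theta>) * (1 / (1 - 2 powr (- \<theta>))))"
    using q by (intro suminf_ennreal_eq sums_mult geometric_sums) auto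
  also have "\<dots> \<le> ennreal (1 / (1 - 2 powr (- \<theta>)) * y powr \<theta>)"
  proof (rule ennreal_leI)
    have "(2 powr real_of_int m) powr \<theta> \<le> y powr \<theta>"
      using m[of m] assms by (intro powr_mono2) auto
    then have "2 powr (real_of_int m * \<theta>) \<le> y powr \<theta>" by (simp add: powr_powr)
    then show "2 powr (real_of_int m * \<theta>) * (1 / (1 - 2 powr (- \<theta>))) \<le> 1 / (1 - 2 powr (- \<theta>)) * y powr \<theta>"
      using q by (subst mult.commute) (intro mult_left_mono, auto)
  qed
  finally show ?thesis .
qed

context dyadic_grid
begin

lemma average_cell_le:
  assumes "R \<in> cells" "average R f \<le> c"
  shows "(\<integral>\<^sup>+x\<in>R. f x \<partial>lborel) \<le> c * emeasure lborel R"
  using mult_right_mono[OF assms(2), of "emeasure lborel R"] emeasure_mult_average[OF avg_set_cell[OF assms(1)], of f]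
  by (simp add: mult.commute)

text \<open>Stop at the cells where the average of \<open>U Q\<close> exceeds 2 C2. They fill at
  most half of \<open>Q\<close>, and on unstopped cells \<Psi> R is at most 2 C2 times \<Psi> Q.
  With c = (2 C2)^\<sigma> C1 the bound 2 c |Q| reproduces itself: c |Q| from the unstopped cells
  plus 2 c |Q| / 2 from the stopped ones. The induction runs on the number of members of the family
  inside \<open>Q\<close>.\<close>

lemma Carleson_supremum:
  fixes \<Psi> U :: "(real^'n) set \<Rightarrow> real^'n \<Rightarrow> ennreal"
  assumes \<F>: "finite \<F>" "\<F> \<subseteq> cells"
    and \<Psi> [measurable]: "\<And>R. \<Psi> R \<in> borel_measurable borel" and U [measurable]: "\<And>R. U R \<in> borel_measurable borel"
    and dom: "\<And>Q R x. Q \<in> cells \<Longrightarrow> R \<in> cells \<Longrightarrow> R \<subseteq> Q \<Longrightarrow> \<Psi> R x \<le> \<Psi> Q x * average R (U Q)"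
    and C2: "0 < C2" "\<And>Q. Q \<in> cells \<Longrightarrow> average Q (U Q) \<le> ennreal C2"
    and C1: "0 \<le> C1" "\<And>Q. Q \<in> cells \<Longrightarrow> average Q (\<lambda>x. ennreal_powr (\<Psi> Q x) \<sigma>) \<le> ennreal C1"
    and \<sigma>: "0 < \<sigma>"
    and Q: "Q \<in> \<F>"
  shows "(\<integral>\<^sup>+x. (SUP R\<in>{R\<in>\<F>. R \<subseteq> Q}. ennreal_powr (\<Psi> R x) \<sigma> * indicator R x) \<partial>lborel)
    \<le> ennreal (2 * (2 * C2) powr \<sigma> * C1) * emeasure lborel Q"
  using Q
proof (induction "card {R\<in>\<F>. R \<subseteq> Q}" arbitrary: Q rule: less_induct)
  case less
  define N where "N Q x = (SUP R\<in>{R\<in>\<F>. R \<subseteq> Q}. ennreal_powr (\<Psi> R x) \<sigma> * indicator R x)" for Q x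
  define c where "c = (2 * C2) powr \<sigma> * C1"
  have c: "0 \<le> c" using C1 by (simp add: c_def)
  have fin: "finite {R\<in>\<F>. R \<subseteq> Q}" for Q using \<F> by simp
  have [measurable]: "R \<in> sets borel" if "R \<in> \<F>" for R using that \<F> cells_borel by auto
  have N_meas [measurable]: "N Q \<in> borel_measurable borel" for Q
    unfolding N_def by (intro borel_measurable_SUP countable_finite fin) auto
  define \<G> where "\<G> = {R\<in>\<F>. R \<subseteq> Q \<and> ennreal (2 * C2) < average R (U Q)}"
  have \<G>: "finite \<G>" "\<G> \<subseteq> cells" "\<G> \<subseteq> \<F>" using \<F> by (auto simp: \<G>_def)
  note max = finite_maximals[OF \<G>(1,2)]
  have Qc: "Q \<in> cells" using less \<F> by auto
  have [measurable]: "Q \<in> sets borel" using Qc cells_borel by auto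
  have IH: "(\<integral>\<^sup>+x. N M x \<partial>lborel) \<le> ennreal (2 * c) * emeasure lborel M" if M: "M \<in> maximals \<G>" for M
  proof -
    have "M \<in> \<G>" using M max(2) by auto
    \<comment> \<open>\<open>Q\<close> itself is not stopped, its average being at most C2; hence a
      stopped cell contains strictly fewer members of the family.\<close>
    have "ennreal C2 < ennreal (2 * C2)" using C2(1) by (simp add: ennreal_lessI)
    then have "Q \<notin> \<G>" using C2(2)[OF Qc] by (auto simp: \<G>_def not_less dest: order.strict_trans1)
    then have "\<not> Q \<subseteq> M" using \<open>M \<in> \<G>\<close> by (auto simp: \<G>_def)
    then have "{R\<in>\<F>. R \<subseteq> M} \<subset> {R\<in>\<F>. R \<subseteq> Q}"
      using \<open>M \<in> \<G>\<close> less(2) by (auto simp: \<G>_def)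
    then have "card {R\<in>\<F>. R \<subseteq> M} < card {R\<in>\<F>. R \<subseteq> Q}"
      by (rule psubset_card_mono[OF fin])
    then show ?thesis
      using less(1)[of M] \<open>M \<in> \<G>\<close> \<G>(3) by (auto simp: N_def c_def mult.assoc)
  qed
  have vol: "emeasure lborel (\<Union>\<G>) \<le> ennreal (1 / 2) * emeasure lborel Q"
  proof -
    have "emeasure lborel (\<Union>\<G>) \<le> ennreal (1 / (2 * C2)) * (\<integral>\<^sup>+x\<in>\<Union>\<G>. U Q x \<partial>lborel)"
    proof (rule emeasure_Union_maximals_le[OF \<G>(1,2)])
      fix R assume R: "R \<in> \<G>"
      have "emeasure lborel R * ennreal (2 * C2) \<le> emeasure lborel R * average R (U Q)"
        using R by (intro mult_left_mono) (auto simp: \<G>_def)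
      then have "ennreal (1 / (2 * C2)) * (emeasure lborel R * ennreal (2 * C2)) \<le> ennreal (1 / (2 * C2)) * (emeasure lborel R * average R (U Q))"
        by (rule mult_left_mono) simp
      also have "ennreal (1 / (2 * C2)) * (emeasure lborel R * ennreal (2 * C2)) = (ennreal (1 / (2 * C2)) * ennreal (2 * C2)) * emeasure lborel R"
        by (simp only: mult_ac)
      also have "ennreal (1 / (2 * C2)) * ennreal (2 * C2) = 1"
        using C2 by (subst ennreal_mult[symmetric]) auto
      also have "emeasure lborel R * average R (U Q) = (\<integral>\<^sup>+x\<in>R. U Q x \<partial>lborel)"
        using R \<G> by (intro emeasure_mult_average avg_set_cell) auto
      finally show "emeasure lborel R \<le> ennreal (1 / (2 * C2)) * (\<integral>\<^sup>+x\<in>R. U Q x \<partial>lborel)" by simp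
    qed simp
    also have "(\<integral>\<^sup>+x\<in>\<Union>\<G>. U Q x \<partial>lborel) \<le> (\<integral>\<^sup>+x\<in>Q. U Q x \<partial>lborel)"
      by (intro nn_integral_mono mult_left_mono) (auto simp: \<G>_def indicator_def)
    also have "(\<integral>\<^sup>+x\<in>Q. U Q x \<partial>lborel) \<le> ennreal C2 * emeasure lborel Q"
      by (rule average_cell_le[OF Qc C2(2)[OF Qc]])
    also have "ennreal (1 / (2 * C2)) * (ennreal C2 * emeasure lborel Q) = ennreal (1 / 2) * emeasure lborel Q"
      using C2 by (subst mult.assoc[symmetric], subst ennreal_mult[symmetric]) auto
    finally show ?thesis by (simp add: mult_left_mono)
  qed
  have sum_vol: "(\<Sum>M\<in>maximals \<G>. emeasure lborel M) = emeasure lborel (\<Union>\<G>)"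
  proof -
    have "disjoint_family_on (\<lambda>M. M) (maximals \<G>)"
      using max(3) by (auto simp: disjoint_family_on_def disjoint_def)
    then have "(\<Sum>M\<in>maximals \<G>. emeasure lborel M) = emeasure lborel (\<Union>M\<in>maximals \<G>. M)"
      using max(1,2) \<G>(2) cells_borel by (intro sum_emeasure) auto
    then show ?thesis using max(4) by simp
  qed
  have pointwise: "N Q x \<le> ennreal ((2 * C2) powr \<sigma>) * (ennreal_powr (\<Psi> Q x) \<sigma> * indicator Q x) + (\<Sum>M\<in>maximals \<G>. N M x)" for x
    unfolding N_def[of Q]
  proof (rule SUP_least)
    fix R assume R: "R \<in> {R \<in> \<F>. R \<subseteq> Q}"
    show "ennreal_powr (\<Psi> R x) \<sigma> * indicator R x \<le> ennreal ((2 * C2) powr \<sigma>) * (ennreal_powr (\<Psi> Q x) \<sigma> * indicator Q x) + (\<Sum>M\<in>maximals \<G>. N M x)"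
    proof (cases "R \<in> \<G>")
      case True
      then obtain M where M: "M \<in> maximals \<G>" "R \<subseteq> M" using max(5) by blast
      have "ennreal_powr (\<Psi> R x) \<sigma> * indicator R x \<le> N M x"
        unfolding N_def using R M by (intro SUP_upper) auto
      also have "\<dots> \<le> (\<Sum>M\<in>maximals \<G>. N M x)"
        using M max(1) by (intro member_le_sum) auto
      finally show ?thesis by (rule order_trans) simp
    next
      case False
      then have "average R (U Q) \<le> ennreal (2 * C2)" using R by (auto simp: \<G>_def)
      then have "\<Psi> Q x * average R (U Q) \<le> \<Psi> Q x * ennreal (2 * C2)"
        by (rule mult_left_mono) simp
      moreover have "\<Psi> R x \<le> \<Psi> Q x * average R (U Q)"
        using R \<F> Qc by (intro dom) auto
      ultimately have "\<Psi> R x \<le> \<Psi> Q x * ennreal (2 * C2)" by (rule order_trans[rotated])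
      then have "ennreal_powr (\<Psi> R x) \<sigma> \<le> ennreal_powr (\<Psi> Q x * ennreal (2 * C2)) \<sigma>"
        using \<sigma> by (intro ennreal_powr_mono) auto
      also have "\<dots> = ennreal ((2 * C2) powr \<sigma>) * ennreal_powr (\<Psi> Q x) \<sigma>"
        using C2 by (simp add: ennreal_powr_mult ennreal_powr_ennreal mult.commute)
      finally have "ennreal_powr (\<Psi> R x) \<sigma> * indicator R x \<le> (ennreal ((2 * C2) powr \<sigma>) * ennreal_powr (\<Psi> Q x) \<sigma>) * indicator Q x"
        using R by (intro mult_mono) (auto simp: indicator_def)
      then show ?thesis unfolding mult.assoc by (rule order_trans) simp
    qed
  qed
  have "(\<integral>\<^sup>+x. N Q x \<partial>lborel) \<le> (\<integral>\<^sup>+x. ennreal ((2 * C2) powr \<sigma>) * (ennreal_powr (\<Psi> Q x) \<sigma> * indicator Q x) + (\<Sum>M\<in>maximals \<G>. N M x) \<partial>lborel)"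
    by (intro nn_integral_mono pointwise)
  also have "\<dots> = ennreal ((2 * C2) powr \<sigma>) * (\<integral>\<^sup>+x\<in>Q. ennreal_powr (\<Psi> Q x) \<sigma> \<partial>lborel) + (\<Sum>M\<in>maximals \<G>. \<integral>\<^sup>+x. N M x \<partial>lborel)"
    by (simp add: nn_integral_add nn_integral_cmult nn_integral_sum)
  also have "\<dots> \<le> ennreal ((2 * C2) powr \<sigma>) * (ennreal C1 * emeasure lborel Q) + (\<Sum>M\<in>maximals \<G>. ennreal (2 * c) * emeasure lborel M)"
    by (intro add_mono mult_left_mono sum_mono IH average_cell_le Qc C1) auto
  also have "(\<Sum>M\<in>maximals \<G>. ennreal (2 * c) * emeasure lborel M) = ennreal (2 * c) * emeasure lborel (\<Union>\<G>)"
    by (simp add: sum_vol flip: sum_distrib_left)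
  also have "\<dots> \<le> ennreal (2 * c) * (ennreal (1 / 2) * emeasure lborel Q)"
    by (intro mult_left_mono vol) simp
  also have "ennreal ((2 * C2) powr \<sigma>) * (ennreal C1 * emeasure lborel Q) + ennreal (2 * c) * (ennreal (1 / 2) * emeasure lborel Q)
    = (ennreal c + ennreal c) * emeasure lborel Q"
  proof -
    have "ennreal (2 * c) * (ennreal (1 / 2) * emeasure lborel Q) = ennreal c * emeasure lborel Q"
      using c by (subst mult.assoc[symmetric], subst ennreal_mult[symmetric]) auto
    moreover have "ennreal ((2 * C2) powr \<sigma>) * (ennreal C1 * emeasure lborel Q) = ennreal c * emeasure lborel Q"
      using C1 by (simp add: c_def ennreal_mult mult.assoc)
    ultimately show ?thesis by (simp add: distrib_right)
  qed
  also have "ennreal c + ennreal c = ennreal (2 * (2 * C2) powr \<sigma> * C1)"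
  proof -
    have "2 * (2 * C2) powr \<sigma> * C1 = c + c" by (simp add: c_def)
    then show ?thesis using c by (simp only: ennreal_plus)
  qed
  finally show ?case by (simp add: N_def add_left_mono)
qed

text \<open>A Carleson embedding in which \<open>G\<close> may be unbounded. Cells are sorted by the
  dyadic size of the average of \<open>f\<close>; within one layer the hypothesis on
  \<open>C\<close> turns the supremum of \<open>G\<close> into the volume of the maximal cells,
  which the weak-type bound controls. Summing the layers leaves the integral of \<open>f\<close>
  times the sum of 2^(k (s - 1)) over 2^k < f, a geometric series because s > 1.\<close>

lemma weighted_maximal:
  assumes \<F>: "finite \<F>" "\<F> \<subseteq> cells" and s: "1 < s"
    and G [measurable]: "\<And>R. G R \<in> borel_measurable borel"
    and C: "\<And>Q. Q \<in> \<F> \<Longrightarrow> (\<integral>\<^sup>+x. (SUP R\<in>{R\<in>\<F>. R \<subseteq> Q}. G R x * indicator R x) \<partial>lborel) \<le> C * emeasure lborel Q"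
    and f [measurable]: "f \<in> borel_measurable borel" and f_nonneg: "\<And>x. 0 \<le> f x"
    and avg_fin: "\<And>Q. Q \<in> \<F> \<Longrightarrow> average Q (\<lambda>x. ennreal (f x)) < top"
  shows "(\<integral>\<^sup>+x. (SUP Q\<in>\<F>. G Q x * indicator Q x * ennreal_powr (average Q (\<lambda>x. ennreal (f x))) s) \<partial>lborel)
    \<le> C * ennreal (4 powr s / (1 - 2 powr (- (s - 1)))) * (\<integral>\<^sup>+x. ennreal (f x powr s) \<partial>lborel)"
proof -
  define \<F>' where "\<F>' k = {Q\<in>\<F>. ennreal (2 * 2 powr real_of_int k) < average Q (\<lambda>x. ennreal (f x))}" for k
  define H where "H k x = (SUP Q\<in>\<F>' k. G Q x * indicator Q x)" for k x
  define c where "c k = (4 * 2 powr real_of_int k) powr s" for k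
  have \<F>': "finite (\<F>' k)" "\<F>' k \<subseteq> cells" "\<F>' k \<subseteq> \<F>" for k using \<F> by (auto simp: \<F>'_def)
  have borel [measurable]: "R \<in> sets borel" if "R \<in> \<F>" for R using that \<F> cells_borel by auto
  have H_meas [measurable]: "H k \<in> borel_measurable borel" for k
    unfolding H_def using borel \<F>'(3)[of k]
    by (intro borel_measurable_SUP countable_finite \<F>' borel_measurable_times_ennreal borel_measurable_indicator) auto
  have pointwise: "(SUP Q\<in>\<F>. G Q x * indicator Q x * ennreal_powr (average Q (\<lambda>x. ennreal (f x))) s) \<le> (\<integral>\<^sup>+k. ennreal (c k) * H k x \<partial>count_space UNIV)" for x
  proof (rule SUP_least)
    fix Q assume Q: "Q \<in> \<F>"
    obtain a where a: "average Q (\<lambda>x. ennreal (f x)) = ennreal a" "0 \<le> a"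
      using avg_fin[OF Q] by (cases "average Q (\<lambda>x. ennreal (f x))") auto
    show "G Q x * indicator Q x * ennreal_powr (average Q (\<lambda>x. ennreal (f x))) s \<le> (\<integral>\<^sup>+k. ennreal (c k) * H k x \<partial>count_space UNIV)"
    proof (cases "a = 0")
      case False
      \<comment> \<open>Puts \<open>a\<close> strictly above 2 times 2^k and at most at 4 times 2^k:
        the lower factor 2 is consumed by \<open>maximal_weak_type\<close>, the upper bound gives
        \<open>c k\<close>.\<close>
      define k where "k = \<lceil>log 2 a\<rceil> - 2"
      have "real_of_int k < log 2 a - 1" "log 2 a \<le> real_of_int k + 2"
        by (auto simp: k_def) linarith
      then have "2 powr (real_of_int k + 1) < a" "a \<le> 2 powr (real_of_int k + 2)"
        using False a by (auto simp: powr_less_iff le_powr_iff)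
      then have k: "2 * 2 powr real_of_int k < a" "a \<le> 4 * 2 powr real_of_int k"
        by (auto simp: powr_add mult.commute)
      have "Q \<in> \<F>' k" using Q k by (auto simp: \<F>'_def a ennreal_lessI)
      then have "G Q x * indicator Q x \<le> H k x" unfolding H_def by (rule SUP_upper)
      moreover have "ennreal_powr (ennreal a) s \<le> ennreal (c k)"
        unfolding ennreal_powr_ennreal[OF a(2)] c_def using k a s by (intro ennreal_leI powr_mono2) auto
      ultimately have "G Q x * indicator Q x * ennreal_powr (ennreal a) s \<le> H k x * ennreal (c k)"
        by (rule mult_mono) auto
      also have "\<dots> \<le> (\<integral>\<^sup>+k. ennreal (c k) * H k x \<partial>count_space UNIV)"
        using nn_integral_ge_point[of k UNIV "\<lambda>k. ennreal (c k) * H k x"] by (simp add: mult.commute)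
      finally show ?thesis by (simp add: a)
    qed (simp add: a)
  qed
  have layer: "(\<integral>\<^sup>+x. H k x \<partial>lborel) \<le> C * (ennreal (2 powr (- real_of_int k)) * (\<integral>\<^sup>+x. ennreal (f x) * indicator {x. 2 powr real_of_int k < f x} x \<partial>lborel))" for k
  proof -
    note max = finite_maximals[OF \<F>'(1,2)[of k]]
    define N where "N M x = (SUP R\<in>{R\<in>\<F>. R \<subseteq> M}. G R x * indicator R x)" for M x
    have N_meas: "N M \<in> borel_measurable borel" for M
      unfolding N_def using \<F> by (intro borel_measurable_SUP countable_finite) auto
    have "(\<integral>\<^sup>+x. H k x \<partial>lborel) \<le> (\<integral>\<^sup>+x. (SUP M\<in>maximals (\<F>' k). N M x) \<partial>lborel)"
    proof (rule nn_integral_mono, unfold H_def, rule SUP_least)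
      fix x Q assume Q: "Q \<in> \<F>' k"
      then obtain M where M: "M \<in> maximals (\<F>' k)" "Q \<subseteq> M" using max(5) by blast
      have "G Q x * indicator Q x \<le> N M x"
        unfolding N_def using Q M \<F>'(3)[of k] by (intro SUP_upper) auto
      also have "\<dots> \<le> (SUP M\<in>maximals (\<F>' k). N M x)" using M by (intro SUP_upper)
      finally show "G Q x * indicator Q x \<le> (SUP M\<in>maximals (\<F>' k). N M x)" .
    qed
    also have "\<dots> \<le> (\<Sum>M\<in>maximals (\<F>' k). \<integral>\<^sup>+x. N M x \<partial>lborel)"
      using N_meas by (intro nn_integral_SUP_finite_le_sum max) auto
    also have "\<dots> \<le> (\<Sum>M\<in>maximals (\<F>' k). C * emeasure lborel M)"
      unfolding N_def using max(2) \<F>'(3)[of k] by (intro sum_mono C) auto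
    also have "\<dots> = C * (\<Sum>M\<in>maximals (\<F>' k). emeasure lborel M)"
      by (simp add: sum_distrib_left)
    also have "(\<Sum>M\<in>maximals (\<F>' k). emeasure lborel M) = emeasure lborel (\<Union>(\<F>' k))"
    proof -
      have "disjoint_family_on (\<lambda>M. M) (maximals (\<F>' k))"
        using max(3) by (auto simp: disjoint_family_on_def disjoint_def)
      then have "(\<Sum>M\<in>maximals (\<F>' k). emeasure lborel M) = emeasure lborel (\<Union>M\<in>maximals (\<F>' k). M)"
        using max(1,2) \<F>'(2)[of k] cells_borel by (intro sum_emeasure) auto
      then show ?thesis using max(4) by simp
    qed
    also have "\<dots> \<le> ennreal (1 / 2 powr real_of_int k) * (\<integral>\<^sup>+x. ennreal (f x) * indicator {x. ennreal (2 powr real_of_int k) < ennreal (f x)} x \<partial>lborel)"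
      by (rule maximal_weak_type[OF \<F>'(1,2)]) (auto simp: \<F>'_def)
    also have "{x. ennreal (2 powr real_of_int k) < ennreal (f x)} = {x. 2 powr real_of_int k < f x}"
      using f_nonneg by (auto simp: ennreal_less_iff)
    finally show ?thesis by (simp add: powr_minus_divide mult_left_mono)
  qed
  have c_eq: "c k * 2 powr (- real_of_int k) = 4 powr s * 2 powr (real_of_int k * (s - 1))" for k
    by (simp add: c_def powr_mult powr_powr algebra_simps flip: powr_add)
  have "(\<integral>\<^sup>+x. (SUP Q\<in>\<F>. G Q x * indicator Q x * ennreal_powr (average Q (\<lambda>x. ennreal (f x))) s) \<partial>lborel)
    \<le> (\<integral>\<^sup>+x. (\<integral>\<^sup>+k. ennreal (c k) * H k x \<partial>count_space UNIV) \<partial>lborel)"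
    by (intro nn_integral_mono pointwise)
  also have "\<dots> = (\<integral>\<^sup>+k. (\<integral>\<^sup>+x. ennreal (c k) * H k x \<partial>lborel) \<partial>count_space UNIV)"
    by (intro nn_integral_count_space_nn_integral) auto
  also have "\<dots> \<le> (\<integral>\<^sup>+k. ennreal (c k) * (C * (ennreal (2 powr (- real_of_int k)) * (\<integral>\<^sup>+x. ennreal (f x) * indicator {x. 2 powr real_of_int k < f x} x \<partial>lborel))) \<partial>count_space UNIV)"
    by (intro nn_integral_mono) (simp add: nn_integral_cmult mult_left_mono layer)
  also have "\<dots> = (\<integral>\<^sup>+k. (\<integral>\<^sup>+x. C * ennreal (4 powr s) * ennreal (f x) * (ennreal (2 powr (real_of_int k * (s - 1))) * indicator {x. 2 powr real_of_int k < f x} x) \<partial>lborel) \<partial>count_space UNIV)"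
  proof (rule nn_integral_cong)
    fix k :: int
    let ?I = "\<lambda>x. indicator {x. 2 powr real_of_int k < f x} x :: ennreal"
    have "ennreal (c k) * (C * (ennreal (2 powr (- real_of_int k)) * (\<integral>\<^sup>+x. ennreal (f x) * ?I x \<partial>lborel)))
      = (C * ennreal (c k * 2 powr (- real_of_int k))) * (\<integral>\<^sup>+x. ennreal (f x) * ?I x \<partial>lborel)"
      by (simp add: c_def ennreal_mult mult_ac)
    also have "\<dots> = (\<integral>\<^sup>+x. (C * ennreal (c k * 2 powr (- real_of_int k))) * (ennreal (f x) * ?I x) \<partial>lborel)"
      by (intro nn_integral_cmult[symmetric]) measurable
    also have "\<dots> = (\<integral>\<^sup>+x. C * ennreal (4 powr s) * ennreal (f x) * (ennreal (2 powr (real_of_int k * (s - 1))) * ?I x) \<partial>lborel)"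
      unfolding c_eq by (intro nn_integral_cong) (simp add: ennreal_mult mult_ac)
    finally show "ennreal (c k) * (C * (ennreal (2 powr (- real_of_int k)) * (\<integral>\<^sup>+x. ennreal (f x) * ?I x \<partial>lborel))) =
      (\<integral>\<^sup>+x. C * ennreal (4 powr s) * ennreal (f x) * (ennreal (2 powr (real_of_int k * (s - 1))) * ?I x) \<partial>lborel)" .
  qed
  also have "\<dots> = (\<integral>\<^sup>+x. (\<integral>\<^sup>+k. C * ennreal (4 powr s) * ennreal (f x) * (ennreal (2 powr (real_of_int k * (s - 1))) * indicator {x. 2 powr real_of_int k < f x} x) \<partial>count_space UNIV) \<partial>lborel)"
    by (intro nn_integral_count_space_nn_integral[symmetric]) auto
  also have "\<dots> \<le> (\<integral>\<^sup>+x. C * ennreal (4 powr s / (1 - 2 powr (- (s - 1)))) * ennreal (f x powr s) \<partial>lborel)"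
  proof (rule nn_integral_mono)
    fix x
    define D where "D = 1 / (1 - 2 powr (- (s - 1)))"
    have "2 powr (- (s - 1)) < (1::real)" using s powr_less_mono[of "- (s - 1)" 0 2] by auto
    then have D: "0 \<le> D" by (simp add: D_def)
    have "(\<integral>\<^sup>+k. C * ennreal (4 powr s) * ennreal (f x) * (ennreal (2 powr (real_of_int k * (s - 1))) * indicator {x. 2 powr real_of_int k < f x} x) \<partial>count_space UNIV)
      = C * ennreal (4 powr s) * ennreal (f x) * (\<integral>\<^sup>+k. ennreal (2 powr (real_of_int k * (s - 1))) * indicator {k. 2 powr real_of_int k < f x} k \<partial>count_space UNIV)"
      by (subst nn_integral_cmult) (auto simp: indicator_def)
    also have "\<dots> \<le> C * ennreal (4 powr s) * ennreal (f x) * ennreal (D * f x powr (s - 1))"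
      unfolding D_def using s f_nonneg by (intro mult_left_mono geometric_layers_le) auto
    also have "\<dots> = C * ennreal (4 powr s * f x * (D * f x powr (s - 1)))"
      using f_nonneg[of x] D by (simp add: ennreal_mult mult.assoc)
    also have "4 powr s * f x * (D * f x powr (s - 1)) = (4 powr s * D) * (f x powr 1 * f x powr (s - 1))"
      using f_nonneg[of x] by simp
    also have "f x powr 1 * f x powr (s - 1) = f x powr s"
      by (subst powr_add[symmetric]) simp
    also have "C * ennreal (4 powr s * D * f x powr s) = C * ennreal (4 powr s * D) * ennreal (f x powr s)"
      using D by (simp add: ennreal_mult mult.assoc)
    also have "4 powr s * D = 4 powr s / (1 - 2 powr (- (s - 1)))"
      by (simp add: D_def)
    finally show "(\<integral>\<^sup>+k. C * ennreal (4 powr s) * ennreal (f x) * (ennreal (2 powr (real_of_int k * (s - 1))) * indicator {x. 2 powr real_of_int k < f x} x) \<partial>count_space UNIV)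
       \<le> C * ennreal (4 powr s / (1 - 2 powr (- (s - 1)))) * ennreal (f x powr s)" .
  qed
  also have "\<dots> = C * ennreal (4 powr s / (1 - 2 powr (- (s - 1)))) * (\<integral>\<^sup>+x. ennreal (f x powr s) \<partial>lborel)"
    by (intro nn_integral_cmult) measurable
  finally show ?thesis .
qed

end

section \<open>The kernel of a matrix \<open>A\<^sub>p\<close> weight\<close>

text \<open>A bound for the p-th power of the characteristic on one set. The inverse weight is a
  separate argument, so that duality becomes the exchange of \<open>A\<close>, \<open>p\<close> with
  \<open>B\<close>, \<open>q\<close>.\<close>

definition Ap_bound :: "(real^'n \<Rightarrow> real^'d^'d) \<Rightarrow> (real^'n \<Rightarrow> real^'d^'d) \<Rightarrow> real \<Rightarrow> real \<Rightarrow> real \<Rightarrow> (real^'n) set \<Rightarrow> bool" where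
  "Ap_bound A B p q C Q \<longleftrightarrow>
    average Q (\<lambda>x. ennreal_powr (average Q (\<lambda>y. ennreal (op_norm (A x ** B y) powr q))) (p / q)) \<le> ennreal C"

locale matrix_pair =
  fixes A B :: "real^'n \<Rightarrow> real^'d^'d" and p q :: real
  assumes A_borel [measurable]: "A \<in> borel_measurable borel" and B_borel [measurable]: "B \<in> borel_measurable borel"
    and A_sym: "\<And>x. transpose (A x) = A x" and B_sym: "\<And>x. transpose (B x) = B x"
    and A_B: "\<And>x. A x ** B x = mat 1"
    and p: "1 < p" and q: "1 < q" and pq: "1 / p + 1 / q = 1"
begin

lemma B_A: "B x ** A x = mat 1"
  using A_B[of x] by (simp add: matrix_left_right_inverse)

lemma swap: "matrix_pair B A q p"
  by unfold_locales (use p q pq A_sym B_sym B_A in auto)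

lemma B_invertible: "invertible (B x)"
  using A_B[of x] B_A[of x] by (auto simp: invertible_def)

lemma kernel_swap: "op_norm (A x ** B y) = op_norm (B y ** A x)"
  by (rule op_norm_mult_commute[OF A_sym B_sym])

lemma kernel_measurable [measurable]:
  assumes [measurable]: "f \<in> borel_measurable M" "g \<in> borel_measurable M"
  shows "(\<lambda>z. op_norm (A (f z) ** B (g z))) \<in> borel_measurable M"
  by measurable

lemma norm_B_le: "norm (B y *v v) \<le> op_norm (A x ** B y) * norm (B x *v v)"
proof -
  have "B y *v v = (B y ** A x) *v (B x *v v)"
    by (simp add: matrix_vector_mul_assoc flip: matrix_mul_assoc) (simp add: A_B)
  then show ?thesis
    using norm_mult_le_op_norm[of "B y ** A x" "B x *v v"] by (simp add: kernel_swap)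
qed

definition \<Psi> :: "(real^'n) set \<Rightarrow> real^'n \<Rightarrow> ennreal" where
  "\<Psi> Q x = average Q (\<lambda>y. ennreal (op_norm (A x ** B y) powr q))"

lemma \<Psi>_measurable: "avg_set Q \<Longrightarrow> \<Psi> Q \<in> borel_measurable borel"
  unfolding \<Psi>_def
  by (rule measurable_average[where f="\<lambda>(x, y). ennreal (op_norm (A x ** B y) powr q)", simplified]) auto

lemma q_div_p: "q / p = q - 1" "p / q = p - 1" "0 < p" "0 < q" "p * (q - 1) = q" "q * (p - 1) = p"
proof -
  show pos: "0 < p" "0 < q" using p q by auto
  then have "q + p = p * q" using pq by (simp add: field_simps)
  then show "q / p = q - 1" "p / q = p - 1" "p * (q - 1) = q" "q * (p - 1) = p"
    using pos by (auto simp: field_simps)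
qed

text \<open>The bound makes \<Psi> Q finite almost everywhere on \<open>Q\<close>. One point x0 with
  a finite value suffices, since |B(y) v| <= |A(x0) B(y)| |B(x0) v|.\<close>

lemma average_norm_finite:
  assumes Q: "avg_set Q" and bound: "Ap_bound A B p q C Q"
  shows "average Q (\<lambda>y. ennreal (norm (B y *v v) powr q)) < top"
proof -
  have [measurable]: "Q \<in> sets borel" "\<Psi> Q \<in> borel_measurable borel"
    using Q \<Psi>_measurable by (auto simp: avg_set_def)
  have "emeasure lborel Q * average Q (\<lambda>x. ennreal_powr (\<Psi> Q x) (p / q)) \<le> emeasure lborel Q * ennreal C"
    using bound by (intro mult_left_mono) (auto simp: Ap_bound_def \<Psi>_def)
  also have "\<dots> < top" using Q by (simp add: avg_set_def ennreal_mult_less_top)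
  finally have "(\<integral>\<^sup>+x\<in>Q. ennreal_powr (\<Psi> Q x) (p / q) \<partial>lborel) \<noteq> top"
    by (simp add: emeasure_mult_average[OF Q])
  then have "AE x in lborel. ennreal_powr (\<Psi> Q x) (p / q) * indicator Q x \<noteq> top"
    using nn_integral_PInf_AE[of "\<lambda>x. ennreal_powr (\<Psi> Q x) (p / q) * indicator Q x" lborel] by simp
  then have AE_fin: "AE x in lborel. x \<in> Q \<longrightarrow> \<Psi> Q x \<noteq> top"
    by eventually_elim (auto simp: indicator_def)
  obtain x0 where x0: "\<Psi> Q x0 < top"
  proof (rule ccontr)
    assume "\<not> thesis"
    then have "\<Psi> Q x = top" for x using that by (auto simp: less_top[symmetric])
    then have "AE x in lborel. x \<notin> Q" using AE_fin by auto
    then have "emeasure lborel Q = 0" by (subst (asm) AE_iff_null) auto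
    then show False using Q by (simp add: avg_set_def)
  qed
    have "average Q (\<lambda>y. ennreal (norm (B y *v v) powr q)) \<le>
        average Q (\<lambda>y. ennreal (norm (B x0 *v v) powr q) * ennreal (op_norm (A x0 ** B y) powr q))"
    proof (rule average_mono[OF Q])
      fix y
      have "norm (B y *v v) powr q \<le> (op_norm (A x0 ** B y) * norm (B x0 *v v)) powr q"
        using q by (intro powr_mono2 norm_B_le) auto
      then show "ennreal (norm (B y *v v) powr q) \<le> ennreal (norm (B x0 *v v) powr q) * ennreal (op_norm (A x0 ** B y) powr q)"
        by (simp add: powr_mult mult.commute flip: ennreal_mult)
    qed
    also have "\<dots> = ennreal (norm (B x0 *v v) powr q) * \<Psi> Q x0"
      unfolding \<Psi>_def by (intro average_cmult Q) measurable
    also have "\<dots> < top" using x0 by (simp add: ennreal_mult_less_top)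
    finally show ?thesis .
qed

text \<open>In \<open>reducing_basis\<close> take M = A(x): the average over z of |B(z) A(x)|^q is
  \<Psi> Q x, and the remaining factor contains no x.\<close>

lemma separation:
  assumes Q: "avg_set Q" and bound: "Ap_bound A B p q C Q"
  shows "\<exists>v :: 'd \<Rightarrow> real^'d. (\<forall>i. average Q (\<lambda>y. ennreal (norm (B y *v v i) powr q)) \<le> 1) \<and>
    (\<forall>x y. ennreal (op_norm (A x ** B y) powr q) \<le>
      \<Psi> Q x * (ennreal (domination_const CARD('d) q) * (\<Sum>i\<in>UNIV. ennreal (norm (B y *v v i) powr q))))"
proof -
  obtain v :: "'d \<Rightarrow> real^'d" where v: "\<And>i. average Q (\<lambda>y. ennreal (norm (B y *v v i) powr q)) \<le> 1"
    and dom: "\<And>M y. ennreal (op_norm (B y ** M) powr q) \<le>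
      ennreal (domination_const CARD('d) q) * average Q (\<lambda>z. ennreal (op_norm (B z ** M) powr q)) *
      (\<Sum>i\<in>UNIV. ennreal (norm (B y *v v i) powr q))"
    by (rule reducing_basis[OF q_div_p(4) Q B_borel B_invertible average_norm_finite[OF assms]]) (rule that)
  show ?thesis
  proof (intro exI[of _ v] conjI allI v)
    fix x y
    show "ennreal (op_norm (A x ** B y) powr q) \<le>
      \<Psi> Q x * (ennreal (domination_const CARD('d) q) * (\<Sum>i\<in>UNIV. ennreal (norm (B y *v v i) powr q)))"
      using dom[of y "A x"] by (simp add: kernel_swap \<Psi>_def mult_ac)
  qed
qed

text \<open>Fixing one basis per set turns \<open>U\<close> into a function of the set and the
  point. The choice is controlled only where \<open>Ap_bound\<close> holds.\<close>

definition reducing :: "(real^'n) set \<Rightarrow> 'd \<Rightarrow> real^'d" where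
  "reducing Q = (SOME v. (\<forall>i. average Q (\<lambda>y. ennreal (norm (B y *v v i) powr q)) \<le> 1) \<and>
    (\<forall>x y. ennreal (op_norm (A x ** B y) powr q) \<le>
      \<Psi> Q x * (ennreal (domination_const CARD('d) q) * (\<Sum>i\<in>UNIV. ennreal (norm (B y *v v i) powr q)))))"

definition U :: "(real^'n) set \<Rightarrow> real^'n \<Rightarrow> ennreal" where
  "U Q y = ennreal (domination_const CARD('d) q) * (\<Sum>i\<in>UNIV. ennreal (norm (B y *v reducing Q i) powr q))"

lemma U_measurable [measurable]: "U Q \<in> borel_measurable borel"
  unfolding U_def by measurable

lemma
  assumes "avg_set Q" "Ap_bound A B p q C Q"
  shows average_reducing: "average Q (\<lambda>y. ennreal (norm (B y *v reducing Q i) powr q)) \<le> 1"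
    and kernel_le: "ennreal (op_norm (A x ** B y) powr q) \<le> \<Psi> Q x * U Q y"
  using someI_ex[OF separation[OF assms]] unfolding U_def reducing_def by blast+

lemma average_U:
  assumes "avg_set Q" "Ap_bound A B p q C Q"
  shows "average Q (U Q) \<le> ennreal (domination_const CARD('d) q * real CARD('d))"
proof -
  have "average Q (U Q) = ennreal (domination_const CARD('d) q) * (\<Sum>i\<in>(UNIV::'d set). average Q (\<lambda>y. ennreal (norm (B y *v reducing Q i) powr q)))"
    unfolding U_def by (subst average_cmult[OF assms(1)], measurable) (subst average_sum[OF assms(1)], auto)
  also have "\<dots> \<le> ennreal (domination_const CARD('d) q) * (\<Sum>i\<in>(UNIV::'d set). 1)"
    by (intro mult_left_mono sum_mono average_reducing[OF assms]) auto
  also have "\<dots> = ennreal (domination_const CARD('d) q * real CARD('d))"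
    by (simp add: ennreal_mult ennreal_of_nat_eq_real_of_nat domination_const_def)
  finally show ?thesis .
qed

definition dual_const :: "real \<Rightarrow> real" where
  "dual_const C = C powr (q / p) * (domination_const CARD('d) q * real CARD('d))"

text \<open>For a scalar weight the kernel is a product and the two averages separate at once. Here
  the separated bound takes that role: the average in x meets only a power of \<Psi> Q and is at
  most \<open>C\<close>, and what remains in y is a multiple of \<open>U Q\<close>, whose average is
  bounded.\<close>

lemma dual_bound:
  assumes Q: "avg_set Q" and bound: "Ap_bound A B p q C Q" and C: "0 \<le> C"
  shows "Ap_bound B A q p (dual_const C) Q"
proof -
  have [measurable]: "\<Psi> Q \<in> borel_measurable borel" by (rule \<Psi>_measurable[OF Q])
  have inner: "ennreal_powr (average Q (\<lambda>x. ennreal (op_norm (B y ** A x) powr p))) (q / p) \<le> ennreal (C powr (q / p)) * U Q y" for y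
  proof -
    have "average Q (\<lambda>x. ennreal (op_norm (B y ** A x) powr p)) \<le> average Q (\<lambda>x. ennreal_powr (U Q y) (p / q) * ennreal_powr (\<Psi> Q x) (p / q))"
    proof (rule average_mono[OF Q])
      fix x
      have "ennreal_powr (ennreal (op_norm (A x ** B y) powr q)) (p / q) \<le> ennreal_powr (\<Psi> Q x * U Q y) (p / q)"
        using p q by (intro ennreal_powr_mono kernel_le[OF Q bound]) auto
      moreover have "ennreal_powr (ennreal (op_norm (A x ** B y) powr q)) (p / q) = ennreal (op_norm (A x ** B y) powr p)"
        using q by (simp add: ennreal_powr_ennreal powr_powr)
      ultimately show "ennreal (op_norm (B y ** A x) powr p) \<le> ennreal_powr (U Q y) (p / q) * ennreal_powr (\<Psi> Q x) (p / q)"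
        by (simp add: kernel_swap ennreal_powr_mult mult.commute)
    qed
    also have "\<dots> = ennreal_powr (U Q y) (p / q) * average Q (\<lambda>x. ennreal_powr (\<Psi> Q x) (p / q))"
      by (intro average_cmult Q) measurable
    also have "\<dots> \<le> ennreal_powr (U Q y) (p / q) * ennreal C"
      using bound by (intro mult_left_mono) (auto simp: Ap_bound_def \<Psi>_def)
    finally have "ennreal_powr (average Q (\<lambda>x. ennreal (op_norm (B y ** A x) powr p))) (q / p) \<le> ennreal_powr (ennreal_powr (U Q y) (p / q) * ennreal C) (q / p)"
      using p q by (intro ennreal_powr_mono) auto
    also have "\<dots> = ennreal (C powr (q / p)) * U Q y"
      using p q C by (simp add: ennreal_powr_mult ennreal_powr_powr ennreal_powr_ennreal mult.commute)
    finally show ?thesis .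
  qed
  have "average Q (\<lambda>y. ennreal_powr (average Q (\<lambda>x. ennreal (op_norm (B y ** A x) powr p))) (q / p)) \<le> average Q (\<lambda>y. ennreal (C powr (q / p)) * U Q y)"
    by (intro average_mono Q inner)
  also have "\<dots> = ennreal (C powr (q / p)) * average Q (U Q)"
    by (intro average_cmult Q) measurable
  also have "\<dots> \<le> ennreal (C powr (q / p)) * ennreal (domination_const CARD('d) q * real CARD('d))"
    by (intro mult_left_mono average_U[OF Q bound]) auto
  also have "\<dots> = ennreal (dual_const C)"
    by (simp add: dual_const_def ennreal_mult domination_const_def)
  finally show ?thesis unfolding Ap_bound_def .
qed

text \<open>Let \<open>F\<close> be the rest of \<open>R\<close>, at least half of it. Averaging
  |B(y) v| <= |B(y) A(x)| |B(x) v| over x in \<open>F\<close> by Hoelder and integrating over y in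
  \<open>R\<close> shows that \<open>F\<close> carries at least the fraction (1/2)^q / C of the mass
  of \<open>R\<close>. This fraction is independent of \<open>v\<close>.\<close>

lemma A_infinity_vector:
  assumes R: "avg_set R" and bound: "Ap_bound B A q p C R" and C: "1 \<le> C"
    and [measurable]: "E \<in> sets borel" and E: "E \<subseteq> R" "emeasure lborel E \<le> ennreal (1 / 2) * emeasure lborel R"
    and fin: "(\<integral>\<^sup>+y\<in>R. ennreal (norm (B y *v v) powr q) \<partial>lborel) < top"
  shows "(\<integral>\<^sup>+y\<in>E. ennreal (norm (B y *v v) powr q) \<partial>lborel) \<le>
    ennreal (1 - (1 / 2) powr q / C) * (\<integral>\<^sup>+y\<in>R. ennreal (norm (B y *v v) powr q) \<partial>lborel)"
proof -
  have [measurable]: "R \<in> sets borel" using R by (simp add: avg_set_def)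
  define w where "w y = ennreal (norm (B y *v v) powr q)" for y
  have [measurable]: "w \<in> borel_measurable borel" unfolding w_def by measurable
  define I where "I S = (\<integral>\<^sup>+y\<in>S. w y \<partial>lborel)" for S
  define m where "m = emeasure lborel R"
  define F where "F = R - E"
  have F [measurable]: "F \<in> sets borel" "F \<subseteq> R" by (auto simp: F_def)
  define k where "k y = (\<integral>\<^sup>+x\<in>R. ennreal (op_norm (B y ** A x) powr p) \<partial>lborel)" for y
  have k: "k y = m * average R (\<lambda>x. ennreal (op_norm (B y ** A x) powr p))" for y
    by (simp add: k_def m_def emeasure_mult_average[OF R])
  have pointwise: "ennreal_powr (emeasure lborel F) q * w y \<le> ennreal_powr (k y) (q / p) * I F" for y
  proof -
    have "emeasure lborel F * ennreal (norm (B y *v v)) = (\<integral>\<^sup>+x. ennreal (norm (B y *v v)) * indicator F x \<partial>lborel)"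
      by (subst nn_integral_cmult_indicator) (auto simp: mult.commute)
    also have "\<dots> \<le> (\<integral>\<^sup>+x. (ennreal (op_norm (B y ** A x)) * indicator F x) * (ennreal (norm (B x *v v)) * indicator F x) \<partial>lborel)"
      using norm_B_le[of y v]
      by (intro nn_integral_mono) (auto simp: indicator_def kernel_swap ennreal_leI simp flip: ennreal_mult)
    also have "\<dots> \<le> ennreal_powr (\<integral>\<^sup>+x. ennreal_powr (ennreal (op_norm (B y ** A x)) * indicator F x) p \<partial>lborel) (1 / p) *
       ennreal_powr (\<integral>\<^sup>+x. ennreal_powr (ennreal (norm (B x *v v)) * indicator F x) q \<partial>lborel) (1 / q)"
      by (intro nn_integral_Holder p q pq) measurable
    also have "(\<integral>\<^sup>+x. ennreal_powr (ennreal (norm (B x *v v)) * indicator F x) q \<partial>lborel) = I F"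
      unfolding I_def w_def by (intro nn_integral_cong) (auto simp: indicator_def ennreal_powr_ennreal)
    also have "ennreal_powr (\<integral>\<^sup>+x. ennreal_powr (ennreal (op_norm (B y ** A x)) * indicator F x) p \<partial>lborel) (1 / p) \<le> ennreal_powr (k y) (1 / p)"
      unfolding k_def using p F(2)
      by (intro ennreal_powr_mono nn_integral_mono) (auto simp: indicator_def ennreal_powr_ennreal)
    finally have "emeasure lborel F * ennreal (norm (B y *v v)) \<le> ennreal_powr (k y) (1 / p) * ennreal_powr (I F) (1 / q)"
      by (simp add: mult_right_mono)
    then have "ennreal_powr (emeasure lborel F * ennreal (norm (B y *v v))) q \<le> ennreal_powr (ennreal_powr (k y) (1 / p) * ennreal_powr (I F) (1 / q)) q"
      using q by (intro ennreal_powr_mono) auto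
    then show ?thesis
      using q by (simp add: ennreal_powr_mult ennreal_powr_powr ennreal_powr_ennreal w_def)
  qed
  have k_meas [measurable]: "k \<in> borel_measurable borel"
    unfolding k_def by measurable
  have "ennreal_powr (emeasure lborel F) q * I R = (\<integral>\<^sup>+y. ennreal_powr (emeasure lborel F) q * w y * indicator R y \<partial>lborel)"
    unfolding I_def by (subst nn_integral_cmult[symmetric]) (auto simp: mult.assoc)
  also have "\<dots> \<le> (\<integral>\<^sup>+y. I F * (ennreal_powr (k y) (q / p) * indicator R y) \<partial>lborel)"
    using pointwise by (intro nn_integral_mono) (auto simp: indicator_def mult.commute)
  also have "\<dots> = I F * (\<integral>\<^sup>+y\<in>R. ennreal_powr (k y) (q / p) \<partial>lborel)"
    by (intro nn_integral_cmult) measurable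
  also have "(\<integral>\<^sup>+y\<in>R. ennreal_powr (k y) (q / p) \<partial>lborel) = m * average R (\<lambda>y. ennreal_powr (k y) (q / p))"
    by (simp add: m_def emeasure_mult_average[OF R])
  also have "average R (\<lambda>y. ennreal_powr (k y) (q / p)) = ennreal_powr m (q / p) *
      average R (\<lambda>y. ennreal_powr (average R (\<lambda>x. ennreal (op_norm (B y ** A x) powr p))) (q / p))"
  proof -
    have [measurable]: "(\<lambda>y. average R (\<lambda>x. ennreal (op_norm (B y ** A x) powr p))) \<in> borel_measurable borel"
      by (rule measurable_average[where f="\<lambda>(y, x). ennreal (op_norm (B y ** A x) powr p)", simplified, OF _ R]) measurable
    show ?thesis
      unfolding k ennreal_powr_mult by (intro average_cmult R) measurable
  qed
  also have "I F * (m * (ennreal_powr m (q / p) * average R (\<lambda>y. ennreal_powr (average R (\<lambda>x. ennreal (op_norm (B y ** A x) powr p))) (q / p))))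
    \<le> I F * (m * (ennreal_powr m (q / p) * ennreal C))"
    using bound by (intro mult_left_mono) (auto simp: Ap_bound_def)
  also have "\<dots> = ennreal_powr m q * (ennreal C * I F)"
    using ennreal_powr_add[of m 1 "q / p"] by (simp add: q_div_p mult_ac)
  finally have main: "ennreal_powr (emeasure lborel F) q * I R \<le> ennreal_powr m q * (ennreal C * I F)" .
  have m: "m \<noteq> 0" "m \<noteq> top" using avg_setD[OF R] by (auto simp: m_def)
  have half: "ennreal (1 / 2) * m \<le> emeasure lborel F"
  proof -
    have "m = emeasure lborel E + emeasure lborel F"
      unfolding m_def F_def using E by (subst plus_emeasure) (auto intro!: arg_cong[where f="emeasure _"])
    moreover have "m = ennreal (1 / 2) * m + ennreal (1 / 2) * m"
      unfolding distrib_right[symmetric] by (subst ennreal_plus[symmetric]) auto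
    ultimately have "ennreal (1 / 2) * m + ennreal (1 / 2) * m \<le> ennreal (1 / 2) * m + emeasure lborel F"
      using E(2) m_def by (metis add_right_mono)
    then show ?thesis using m by (simp add: ennreal_add_left_cancel_le ennreal_mult_eq_top_iff)
  qed
  have "ennreal_powr m q * (ennreal ((1 / 2) powr q) * I R) = ennreal_powr (ennreal (1 / 2) * m) q * I R"
  proof -
    have "ennreal_powr (ennreal (1 / 2) * m) q = ennreal ((1 / 2) powr q) * ennreal_powr m q"
      unfolding ennreal_powr_mult by (subst ennreal_powr_ennreal) simp_all
    then show ?thesis by (simp only: mult_ac)
  qed
  also have "\<dots> \<le> ennreal_powr (emeasure lborel F) q * I R"
    using q half by (intro mult_right_mono ennreal_powr_mono) auto
  also note main
  finally have "ennreal ((1 / 2) powr q) * I R \<le> ennreal C * I F"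
    using m by (simp add: ennreal_mult_le_mult_iff)
  then have "ennreal (1 / C) * (ennreal ((1 / 2) powr q) * I R) \<le> ennreal (1 / C) * (ennreal C * I F)"
    by (rule mult_left_mono) simp
  then have lower: "ennreal ((1 / 2) powr q / C) * I R \<le> I F"
    using C by (simp flip: ennreal_mult mult.assoc)
  have "I R = I E + I F"
  proof -
    have "I R = (\<integral>\<^sup>+y. w y * indicator E y + w y * indicator F y \<partial>lborel)"
      unfolding I_def using E(1) by (intro nn_integral_cong) (auto simp: F_def indicator_def)
    then show ?thesis unfolding I_def by (subst (asm) nn_integral_add) auto
  qed
  \<comment> \<open>Finiteness of the mass of \<open>R\<close> allows the mass of \<open>F\<close>
    to be subtracted from it.\<close>
  moreover obtain a b c where abc: "I R = ennreal a" "I E = ennreal b" "I F = ennreal c" "0 \<le> a" "0 \<le> b" "0 \<le> c"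
  proof -
    have "I R < top" using fin by (simp add: I_def w_def)
    moreover from this have "I E < top" "I F < top" using \<open>I R = I E + I F\<close> by (auto simp: less_top[symmetric])
    ultimately show thesis using that
      by (metis ennreal_cases less_irrefl)
  qed
  ultimately have "a = b + c" by (simp flip: ennreal_plus)
  moreover have "(1 / 2) powr q / C * a \<le> c"
    using lower C unfolding abc by (subst (asm) ennreal_mult[symmetric]) (auto simp: abc)
  moreover have "(1 / 2) powr q / C \<le> 1"
    using C q powr_mono2[of q "1 / 2" "1::real"] by (simp add: divide_le_eq_1)
  ultimately have "I E \<le> ennreal (1 - (1 / 2) powr q / C) * I R"
    unfolding abc using abc by (subst ennreal_mult[symmetric]) (auto intro!: ennreal_leI simp: algebra_simps)
  then show ?thesis by (simp add: I_def w_def)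
qed

end

section \<open>The Christ--Goldberg maximal operator\<close>

locale grid_pair = dyadic_grid cell K + matrix_pair A B p q
  for cell :: "int \<Rightarrow> real^'n \<Rightarrow> (real^'n) set" and K :: real
    and A B :: "real^'n \<Rightarrow> real^'d^'d" and p q :: real +
  fixes C :: real
  assumes C: "0 \<le> C" and Ap: "\<And>Q. Q \<in> cells \<Longrightarrow> Ap_bound A B p q C Q"
begin

text \<open>Up to a constant, \<open>U Q\<close> is a sum of d weights |B v|^q, each satisfying
  A_infinity with the same constants and having average at most 1 over \<open>Q\<close>; the gain
  for each passes to the sum.\<close>

lemma reverse_Holder_U:
  "\<exists>\<epsilon>>0. \<exists>C'\<ge>0. \<forall>Q\<in>cells. average Q (\<lambda>y. ennreal_powr (U Q y) (1 + \<epsilon>)) \<le> ennreal C'"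
proof -
  \<comment> \<open>At least 1, so that the fraction 1 - (1/2)^q / D from
    \<open>A_infinity_vector\<close> lies strictly between 0 and 1.\<close>
  define D where "D = max 1 (dual_const C)"
  have D: "1 \<le> D" by (simp add: D_def)
  have dual: "Ap_bound B A q p D Q" if "Q \<in> cells" for Q
    using dual_bound[OF avg_set_cell[OF that] Ap[OF that] C] unfolding Ap_bound_def D_def
    by (rule order_trans) (intro ennreal_leI, simp)
  define \<delta> where "\<delta> = (1 / 2) powr q / D"
  have "(1 / 2) powr q < (1 / 2 :: real) powr 0"
    using q by (intro powr_less_mono') auto
  then have \<delta>: "0 < \<delta>" "\<delta> < 1"
    using D by (auto simp: \<delta>_def divide_less_eq_1 intro: less_le_trans)
  obtain \<epsilon> C' where \<epsilon>: "0 < \<epsilon>" and RH: "\<forall>w Q. w \<in> borel_measurable borel \<longrightarrow> A_infinity (1 / 2) (1 - \<delta>) w \<longrightarrow>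
    Q \<in> cells \<longrightarrow> average Q w \<le> 1 \<longrightarrow> average Q (\<lambda>x. ennreal_powr (w x) (1 + \<epsilon>)) \<le> ennreal C'"
    using reverse_Holder[of "1 / 2" "1 - \<delta>"] \<delta> by auto
  define c where "c = domination_const CARD('d) q"
  have c: "0 \<le> c" by (simp add: c_def domination_const_def)
  define D' where "D' = c powr (1 + \<epsilon>) * real CARD('d) powr (1 + \<epsilon>) * (real CARD('d) * max 0 C')"
  have "average Q (\<lambda>y. ennreal_powr (U Q y) (1 + \<epsilon>)) \<le> ennreal D'" if Q: "Q \<in> cells" for Q
  proof -
    define w where "w i y = ennreal (norm (B y *v reducing Q i) powr q)" for i y
    have [measurable]: "w i \<in> borel_measurable borel" for i unfolding w_def by measurable
    have aQ: "avg_set Q" by (rule avg_set_cell[OF Q])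
    have w: "average Q (\<lambda>y. ennreal_powr (w i y) (1 + \<epsilon>)) \<le> ennreal (max 0 C')" for i
    proof -
      have "average Q (\<lambda>y. ennreal_powr (w i y) (1 + \<epsilon>)) \<le> ennreal C'"
      proof (rule RH[rule_format, OF _ _ Q])
        show "A_infinity (1 / 2) (1 - \<delta>) (w i)"
          unfolding A_infinity_def
        proof (intro ballI impI)
          fix R E assume R: "R \<in> cells" and E: "E \<in> sets borel" "E \<subseteq> R" "emeasure lborel E \<le> ennreal (1 / 2) * emeasure lborel R"
          have aR: "avg_set R" by (rule avg_set_cell[OF R])
          have "emeasure lborel R * average R (\<lambda>y. ennreal (norm (B y *v reducing Q i) powr q)) < top"
            using average_norm_finite[OF aR Ap[OF R]] aR by (simp add: ennreal_mult_less_top avg_set_def)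
          then show "(\<integral>\<^sup>+x\<in>E. w i x \<partial>lborel) \<le> ennreal (1 - \<delta>) * (\<integral>\<^sup>+x\<in>R. w i x \<partial>lborel)"
            unfolding w_def \<delta>_def
            by (intro A_infinity_vector[OF aR dual[OF R] D E]) (simp add: emeasure_mult_average[OF aR])
        qed
        show "average Q (w i) \<le> 1"
          using average_reducing[OF aQ Ap[OF Q]] by (simp add: w_def[abs_def])
      qed measurable
      also have "\<dots> \<le> ennreal (max 0 C')" by (intro ennreal_leI) simp
      finally show ?thesis .
    qed
    have "average Q (\<lambda>y. ennreal_powr (U Q y) (1 + \<epsilon>)) \<le>
      average Q (\<lambda>y. ennreal (c powr (1 + \<epsilon>) * real CARD('d) powr (1 + \<epsilon>)) * (\<Sum>i\<in>UNIV. ennreal_powr (w i y) (1 + \<epsilon>)))"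
    proof (rule average_mono[OF aQ])
      fix y
      have "ennreal_powr (U Q y) (1 + \<epsilon>) = ennreal (c powr (1 + \<epsilon>)) * ennreal_powr (\<Sum>i\<in>UNIV. w i y) (1 + \<epsilon>)"
        using c unfolding U_def w_def c_def[symmetric] ennreal_powr_mult by (simp only: ennreal_powr_ennreal)
      also have "\<dots> \<le> ennreal (c powr (1 + \<epsilon>)) * (ennreal (real CARD('d) powr (1 + \<epsilon>)) * (\<Sum>i\<in>UNIV. ennreal_powr (w i y) (1 + \<epsilon>)))"
        using \<epsilon> by (intro mult_left_mono ennreal_powr_sum_le) auto
      finally show "ennreal_powr (U Q y) (1 + \<epsilon>) \<le> ennreal (c powr (1 + \<epsilon>) * real CARD('d) powr (1 + \<epsilon>)) * (\<Sum>i\<in>UNIV. ennreal_powr (w i y) (1 + \<epsilon>))"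
        by (simp add: ennreal_mult mult.assoc)
    qed
    also have "\<dots> = ennreal (c powr (1 + \<epsilon>) * real CARD('d) powr (1 + \<epsilon>)) * (\<Sum>i\<in>UNIV. average Q (\<lambda>y. ennreal_powr (w i y) (1 + \<epsilon>)))"
      by (subst average_cmult[OF aQ], measurable) (subst average_sum[OF aQ], auto)
    also have "\<dots> \<le> ennreal (c powr (1 + \<epsilon>) * real CARD('d) powr (1 + \<epsilon>)) * (\<Sum>i\<in>(UNIV::'d set). ennreal (max 0 C'))"
      by (intro mult_left_mono sum_mono w) auto
    also have "\<dots> = ennreal D'"
      by (simp add: D'_def ennreal_mult ennreal_of_nat_eq_real_of_nat del: max_def)
    finally show ?thesis .
  qed
  moreover have "0 \<le> D'" by (simp add: D'_def)
  ultimately show ?thesis using \<epsilon> by blast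
qed

definition maximal :: "(real^'n \<Rightarrow> real) \<Rightarrow> real^'n \<Rightarrow> ennreal" where
  "maximal h x = (SUP Q\<in>cells. average Q (\<lambda>y. ennreal (op_norm (A x ** B y) * h y)) * indicator Q x)"

lemma average_kernel_measurable:
  assumes [measurable]: "h \<in> borel_measurable borel" and Q: "Q \<in> cells"
  shows "(\<lambda>x. average Q (\<lambda>y. ennreal (op_norm (A x ** B y) * h y))) \<in> borel_measurable borel"
  by (rule measurable_average[where f="\<lambda>(x, y). ennreal (op_norm (A x ** B y) * h y)", simplified, OF _ avg_set_cell[OF Q]]) measurable

lemma maximal_measurable:
  assumes "h \<in> borel_measurable borel"
  shows "maximal h \<in> borel_measurable borel"
  unfolding maximal_def
  by (intro borel_measurable_SUP countable_cells borel_measurable_times_ennreal average_kernel_measurable assms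
      borel_measurable_indicator) (auto simp: cells_borel)

text \<open>The kernel is at most (\<Psi> U)^(1/q). Hoelder with r = q (1 + \<epsilon>) spends the
  reverse Hoelder bound on \<open>U\<close> and leaves an average of h^s. The conjugate exponent s
  is below p because r > q, so p / s > 1 remains for the weighted maximal theorem applied to h^s.
  The constant is uniform over finite families, in view of monotone convergence.\<close>

lemma maximal_finite_bound:
  "\<exists>C'\<ge>0. \<forall>\<F> h. finite \<F> \<longrightarrow> \<F> \<subseteq> cells \<longrightarrow> h \<in> borel_measurable borel \<longrightarrow> (\<forall>x. 0 \<le> h x) \<longrightarrow>
    (\<integral>\<^sup>+x. ennreal (h x powr p) \<partial>lborel) < top \<longrightarrow>
    (\<integral>\<^sup>+x. (SUP Q\<in>\<F>. ennreal_powr (average Q (\<lambda>y. ennreal (op_norm (A x ** B y) * h y)) * indicator Q x) p) \<partial>lborel)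
    \<le> ennreal C' * (\<integral>\<^sup>+x. ennreal (h x powr p) \<partial>lborel)"
proof -
  obtain \<epsilon> C3 where \<epsilon>: "0 < \<epsilon>" and C3: "0 \<le> C3" "\<And>Q. Q \<in> cells \<Longrightarrow> average Q (\<lambda>y. ennreal_powr (U Q y) (1 + \<epsilon>)) \<le> ennreal C3"
    using reverse_Holder_U by blast
  define r where "r = q * (1 + \<epsilon>)"
  define s where "s = r / (r - 1)"
  have r: "1 < r" "q < r" using q \<epsilon> less_1_mult[of q "1 + \<epsilon>"] by (auto simp: r_def)
  have s: "1 < s" "1 / r + 1 / s = 1" using r by (auto simp: s_def field_simps)
  have "s < p"
  proof -
    have "(p - 1) * (q - 1) = 1" using q_div_p(5) by (simp add: algebra_simps)
    then have "p - 1 = 1 / (q - 1)" using q by (simp add: field_simps)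
    moreover have "s - 1 = 1 / (r - 1)" using r by (simp add: s_def field_simps)
    moreover have "1 / (r - 1) < 1 / (q - 1)" using r q by (intro divide_strict_left_mono) auto
    ultimately show ?thesis by simp
  qed
  then have ps: "1 < p / s" using s by simp
  define C2 where "C2 = domination_const CARD('d) q * real CARD('d)"
  have C2: "0 < C2" by (simp add: C2_def domination_const_def)
  define C' where "C' = 2 * (2 * C2) powr (p / q) * C * (4 powr (p / s) / (1 - 2 powr (- (p / s - 1)))) * C3 powr (p / r)"
  have geo: "2 powr (- (p / s - 1)) < (1::real)" using ps powr_less_mono[of "- (p / s - 1)" 0 2] by auto
  \<comment> \<open>Extended by 0 outside the cells because the Carleson and maximal lemmas ask for
    measurability at every index.\<close>
  define G where "G R = (if R \<in> cells then \<Psi> R else (\<lambda>_. 0))" for R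
  have G_meas [measurable]: "G R \<in> borel_measurable borel" for R
    by (auto simp: G_def \<Psi>_measurable avg_set_cell)
  have \<Psi>_meas: "\<Psi> R \<in> borel_measurable borel" if "R \<in> cells" for R
    by (rule \<Psi>_measurable[OF avg_set_cell[OF that]])
  have dom: "G R x \<le> G Q x * average R (U Q)" if "Q \<in> cells" "R \<in> cells" "R \<subseteq> Q" for Q R x
  proof -
    have "\<Psi> R x \<le> average R (\<lambda>y. \<Psi> Q x * U Q y)"
      unfolding \<Psi>_def[of R] using that by (intro average_mono kernel_le[OF avg_set_cell Ap] avg_set_cell)
    also have "\<dots> = \<Psi> Q x * average R (U Q)"
      using that by (intro average_cmult avg_set_cell) measurable
    finally show ?thesis using that by (simp add: G_def)
  qed
  have main: "(\<integral>\<^sup>+x. (SUP Q\<in>\<F>. ennreal_powr (average Q (\<lambda>y. ennreal (op_norm (A x ** B y) * h y)) * indicator Q x) p) \<partial>lborel)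
    \<le> ennreal C' * (\<integral>\<^sup>+x. ennreal (h x powr p) \<partial>lborel)"
    if \<F>: "finite \<F>" "\<F> \<subseteq> cells" and h [measurable]: "h \<in> borel_measurable borel" and h0: "\<And>x. 0 \<le> h x"
      and fin: "(\<integral>\<^sup>+x. ennreal (h x powr p) \<partial>lborel) < top" for \<F> and h :: "real^'n \<Rightarrow> real"
  proof -
    define f where "f x = h x powr s" for x
    have [measurable]: "f \<in> borel_measurable borel" unfolding f_def by measurable
    have f0: "0 \<le> f x" for x by (simp add: f_def)
    have avg_fin: "average Q (\<lambda>x. ennreal (f x)) < top" if "Q \<in> \<F>" for Q
    proof -
      have Q: "Q \<in> cells" "avg_set Q" using that \<F> avg_set_cell by auto
      have [measurable]: "Q \<in> sets borel" using Q cells_borel by auto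
      \<comment> \<open>Local integrability of h^s, from s < p and the finite measure of a
        cell.\<close>
      have "f x \<le> 1 + h x powr p" for x
      proof (cases "h x \<le> 1")
        case True
        then have "f x \<le> 1 powr s" unfolding f_def using h0 s by (intro powr_mono2) auto
        then show ?thesis by (simp add: add_increasing2)
      next
        case False
        then have "f x \<le> h x powr p" unfolding f_def using \<open>s < p\<close> by (intro powr_mono) auto
        then show ?thesis by simp
      qed
      then have "ennreal (f x) \<le> 1 + ennreal (h x powr p)" for x
        by (metis ennreal_1 ennreal_leI ennreal_plus powr_ge_zero zero_le_one)
      then have "(\<integral>\<^sup>+x\<in>Q. ennreal (f x) \<partial>lborel) \<le> (\<integral>\<^sup>+x. indicator Q x + ennreal (h x powr p) \<partial>lborel)"
        by (intro nn_integral_mono) (auto simp: indicator_def)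
      also have "\<dots> = emeasure lborel Q + (\<integral>\<^sup>+x. ennreal (h x powr p) \<partial>lborel)"
        by (subst nn_integral_add) auto
      also have "\<dots> < top" using fin Q by (simp add: avg_set_def)
      finally show ?thesis
        using avg_setD[OF Q(2)] Q(2) by (simp add: average_eq ennreal_divide_eq_top_iff less_top[symmetric])
    qed
    have pointwise: "ennreal_powr (average Q (\<lambda>y. ennreal (op_norm (A x ** B y) * h y)) * indicator Q x) p \<le>
      ennreal (C3 powr (p / r)) * (ennreal_powr (G Q x) (p / q) * indicator Q x * ennreal_powr (average Q (\<lambda>x. ennreal (f x))) (p / s))"
      if "Q \<in> \<F>" for Q x
    proof -
      have Q: "Q \<in> cells" "avg_set Q" using that \<F> avg_set_cell by auto
      have "average Q (\<lambda>y. ennreal (op_norm (A x ** B y) * h y)) \<le> average Q (\<lambda>y. ennreal_powr (\<Psi> Q x) (1 / q) * (ennreal_powr (U Q y) (1 / q) * ennreal (h y)))"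
      proof (rule average_mono[OF Q(2)])
        fix y
        have "ennreal (op_norm (A x ** B y)) = ennreal_powr (ennreal (op_norm (A x ** B y) powr q)) (1 / q)"
          using q by (simp add: ennreal_powr_ennreal powr_powr)
        also have "\<dots> \<le> ennreal_powr (\<Psi> Q x * U Q y) (1 / q)"
          using q by (intro ennreal_powr_mono kernel_le[OF Q(2) Ap[OF Q(1)]]) auto
        finally have "ennreal (op_norm (A x ** B y)) * ennreal (h y) \<le> ennreal_powr (\<Psi> Q x * U Q y) (1 / q) * ennreal (h y)"
          by (rule mult_right_mono) simp
        then show "ennreal (op_norm (A x ** B y) * h y) \<le> ennreal_powr (\<Psi> Q x) (1 / q) * (ennreal_powr (U Q y) (1 / q) * ennreal (h y))"
          using h0 by (simp add: ennreal_mult ennreal_powr_mult mult.assoc)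
      qed
      also have "\<dots> = ennreal_powr (\<Psi> Q x) (1 / q) * average Q (\<lambda>y. ennreal_powr (U Q y) (1 / q) * ennreal (h y))"
        by (intro average_cmult Q) measurable
      also have "average Q (\<lambda>y. ennreal_powr (U Q y) (1 / q) * ennreal (h y)) \<le>
        ennreal_powr (average Q (\<lambda>y. ennreal_powr (ennreal_powr (U Q y) (1 / q)) r)) (1 / r) *
        ennreal_powr (average Q (\<lambda>y. ennreal_powr (ennreal (h y)) s)) (1 / s)"
        by (intro average_Holder r s Q) measurable
      also have "(\<lambda>y. ennreal_powr (ennreal_powr (U Q y) (1 / q)) r) = (\<lambda>y. ennreal_powr (U Q y) (1 + \<epsilon>))"
        using q by (simp add: ennreal_powr_powr r_def)
      also have "(\<lambda>y. ennreal_powr (ennreal (h y)) s) = (\<lambda>y. ennreal (f y))"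
        using h0 by (simp add: ennreal_powr_ennreal f_def)
      also have "ennreal_powr (average Q (\<lambda>y. ennreal_powr (U Q y) (1 + \<epsilon>))) (1 / r) \<le> ennreal_powr (ennreal C3) (1 / r)"
        using r by (intro ennreal_powr_mono C3 Q) auto
      finally have "average Q (\<lambda>y. ennreal (op_norm (A x ** B y) * h y)) \<le>
          ennreal_powr (\<Psi> Q x) (1 / q) * (ennreal_powr (ennreal C3) (1 / r) * ennreal_powr (average Q (\<lambda>y. ennreal (f y))) (1 / s))"
        by (simp add: mult_left_mono mult_right_mono)
      then have "ennreal_powr (average Q (\<lambda>y. ennreal (op_norm (A x ** B y) * h y))) p \<le>
          ennreal_powr (ennreal_powr (\<Psi> Q x) (1 / q) * (ennreal_powr (ennreal C3) (1 / r) * ennreal_powr (average Q (\<lambda>y. ennreal (f y))) (1 / s))) p"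
        using p by (intro ennreal_powr_mono) auto
      also have "\<dots> = ennreal (C3 powr (p / r)) * (ennreal_powr (\<Psi> Q x) (p / q) * ennreal_powr (average Q (\<lambda>y. ennreal (f y))) (p / s))"
        using C3 by (simp add: ennreal_powr_mult ennreal_powr_powr ennreal_powr_ennreal powr_powr mult_ac)
      finally show ?thesis using Q by (simp add: G_def indicator_def)
    qed
    have Car: "(\<integral>\<^sup>+x. (SUP R\<in>{R\<in>\<F>. R \<subseteq> Q}. ennreal_powr (G R x) (p / q) * indicator R x) \<partial>lborel)
        \<le> ennreal (2 * (2 * C2) powr (p / q) * C) * emeasure lborel Q" if "Q \<in> \<F>" for Q
    proof (rule Carleson_supremum[OF \<F> G_meas U_measurable dom C2 _ C])
      show "average Q (U Q) \<le> ennreal C2" if "Q \<in> cells" for Q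
        unfolding C2_def by (rule average_U[OF avg_set_cell[OF that] Ap[OF that]])
      show "average Q (\<lambda>x. ennreal_powr (G Q x) (p / q)) \<le> ennreal C" if "Q \<in> cells" for Q
        using Ap[OF that] that by (simp add: G_def Ap_bound_def \<Psi>_def)
    qed (use p q that in auto)
    have [measurable]: "R \<in> sets borel" if "R \<in> \<F>" for R using that \<F> cells_borel by auto
    let ?g = "\<lambda>Q x. ennreal_powr (G Q x) (p / q) * indicator Q x * ennreal_powr (average Q (\<lambda>x. ennreal (f x))) (p / s)"
    have "(\<integral>\<^sup>+x. (SUP Q\<in>\<F>. ennreal_powr (average Q (\<lambda>y. ennreal (op_norm (A x ** B y) * h y)) * indicator Q x) p) \<partial>lborel)
      \<le> (\<integral>\<^sup>+x. ennreal (C3 powr (p / r)) * (SUP Q\<in>\<F>. ?g Q x) \<partial>lborel)"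
    proof (intro nn_integral_mono SUP_least)
      fix x Q assume "Q \<in> \<F>"
      then show "ennreal_powr (average Q (\<lambda>y. ennreal (op_norm (A x ** B y) * h y)) * indicator Q x) p \<le> ennreal (C3 powr (p / r)) * (SUP Q\<in>\<F>. ?g Q x)"
        by (intro order_trans[OF pointwise] mult_left_mono SUP_upper) auto
    qed
    also have "\<dots> = ennreal (C3 powr (p / r)) * (\<integral>\<^sup>+x. (SUP Q\<in>\<F>. ?g Q x) \<partial>lborel)"
      using \<F> by (intro nn_integral_cmult borel_measurable_SUP countable_finite) auto
    also have "(\<integral>\<^sup>+x. (SUP Q\<in>\<F>. ?g Q x) \<partial>lborel) \<le>
      ennreal (2 * (2 * C2) powr (p / q) * C) * ennreal (4 powr (p / s) / (1 - 2 powr (- (p / s - 1)))) * (\<integral>\<^sup>+x. ennreal (f x powr (p / s)) \<partial>lborel)"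
      by (rule weighted_maximal[OF \<F> ps _ Car _ f0 avg_fin]) auto
    also have "(\<lambda>x. ennreal (f x powr (p / s))) = (\<lambda>x. ennreal (h x powr p))"
      using s by (simp add: f_def powr_powr)
    also have "ennreal (C3 powr (p / r)) * (ennreal (2 * (2 * C2) powr (p / q) * C) * ennreal (4 powr (p / s) / (1 - 2 powr (- (p / s - 1)))) * (\<integral>\<^sup>+x. ennreal (h x powr p) \<partial>lborel))
      = ennreal C' * (\<integral>\<^sup>+x. ennreal (h x powr p) \<partial>lborel)"
    proof -
      define X where "X = 4 powr (p / s) / (1 - 2 powr (- (p / s - 1)))"
      define Y where "Y = 2 * (2 * C2) powr (p / q) * C"
      have "0 \<le> X" "0 \<le> Y" using geo C by (auto simp: X_def Y_def)
      moreover have "C' = Y * X * C3 powr (p / r)"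
        unfolding C'_def X_def Y_def by (rule refl)
      ultimately have "ennreal (C3 powr (p / r)) * (ennreal Y * ennreal X) = ennreal C'"
        by (simp add: ennreal_mult mult_ac)
      then show ?thesis by (simp add: X_def Y_def mult.assoc[symmetric])
    qed
    finally show ?thesis by (simp add: mult_left_mono)
  qed
  show ?thesis
  proof (rule exI[of _ C'], intro conjI allI impI)
    show "0 \<le> C'" using geo C by (simp add: C'_def)
  qed (rule main; simp)
qed

lemma maximal_bound:
  "\<exists>C'\<ge>0. \<forall>h. h \<in> borel_measurable borel \<longrightarrow> (\<forall>x. 0 \<le> h x) \<longrightarrow> (\<integral>\<^sup>+x. ennreal (h x powr p) \<partial>lborel) < top \<longrightarrow>
    (\<integral>\<^sup>+x. ennreal_powr (maximal h x) p \<partial>lborel) \<le> ennreal C' * (\<integral>\<^sup>+x. ennreal (h x powr p) \<partial>lborel)"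
proof -
  obtain C' where C': "0 \<le> C'" and bound: "\<forall>\<F> h. finite \<F> \<longrightarrow> \<F> \<subseteq> cells \<longrightarrow> h \<in> borel_measurable borel \<longrightarrow> (\<forall>x. 0 \<le> h x) \<longrightarrow>
    (\<integral>\<^sup>+x. ennreal (h x powr p) \<partial>lborel) < top \<longrightarrow>
    (\<integral>\<^sup>+x. (SUP Q\<in>\<F>. ennreal_powr (average Q (\<lambda>y. ennreal (op_norm (A x ** B y) * h y)) * indicator Q x) p) \<partial>lborel)
    \<le> ennreal C' * (\<integral>\<^sup>+x. ennreal (h x powr p) \<partial>lborel)"
    using maximal_finite_bound by (elim exE conjE) (rule that)
  have "(\<integral>\<^sup>+x. ennreal_powr (maximal h x) p \<partial>lborel) \<le> ennreal C' * (\<integral>\<^sup>+x. ennreal (h x powr p) \<partial>lborel)"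
    if h: "h \<in> borel_measurable borel" "\<forall>x. 0 \<le> h x" "(\<integral>\<^sup>+x. ennreal (h x powr p) \<partial>lborel) < top" for h :: "real^'n \<Rightarrow> real"
  proof -
    \<comment> \<open>Enumerating the countably many cells exhausts them by increasing finite
      families, to which one common constant applies.\<close>
    define e where "e = from_nat_into cells"
    have ne: "cells \<noteq> {}" using cell_in_cells by blast
    have e: "range e = cells" unfolding e_def by (rule range_from_nat_into[OF ne countable_cells])
    define g where "g Q x = ennreal_powr (average Q (\<lambda>y. ennreal (op_norm (A x ** B y) * h y)) * indicator Q x) p" for Q x
    have g_meas: "g Q \<in> borel_measurable borel" if "Q \<in> cells" for Q
      unfolding g_def using that
      by (intro measurable_ennreal_powr borel_measurable_times_ennreal average_kernel_measurable h borel_measurable_indicator)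
        (auto simp: cells_borel)
    have le: "ennreal_powr (maximal h x) p \<le> (SUP i. SUP Q\<in>e ` {..i}. g Q x)" for x
    proof -
      have "maximal h x \<le> ennreal_powr (SUP i. SUP Q\<in>e ` {..i}. g Q x) (1 / p)"
        unfolding maximal_def
      proof (rule SUP_least)
        fix Q assume "Q \<in> cells"
        then obtain i where i: "Q = e i" using e by auto
        have "g Q x \<le> (SUP Q\<in>e ` {..i}. g Q x)" using i by (intro SUP_upper) auto
        also have "\<dots> \<le> (SUP i. SUP Q\<in>e ` {..i}. g Q x)" by (intro SUP_upper) auto
        finally show "average Q (\<lambda>y. ennreal (op_norm (A x ** B y) * h y)) * indicator Q x \<le> ennreal_powr (SUP i. SUP Q\<in>e ` {..i}. g Q x) (1 / p)"
          using p by (simp add: g_def ennreal_powr_le_iff)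
      qed
      then show ?thesis using p by (simp add: ennreal_powr_le_iff)
    qed
    have "(\<integral>\<^sup>+x. ennreal_powr (maximal h x) p \<partial>lborel) \<le> (\<integral>\<^sup>+x. (SUP i. SUP Q\<in>e ` {..i}. g Q x) \<partial>lborel)"
      by (intro nn_integral_mono le)
    also have "\<dots> = (SUP i. \<integral>\<^sup>+x. (SUP Q\<in>e ` {..i}. g Q x) \<partial>lborel)"
    proof (rule nn_integral_monotone_convergence_SUP)
      show "incseq (\<lambda>i x. SUP Q\<in>e ` {..i}. g Q x)"
        by (auto simp: incseq_def le_fun_def intro!: SUP_subset_mono)
      show "(\<lambda>x. SUP Q\<in>e ` {..i}. g Q x) \<in> borel_measurable lborel" for i
        using e by (intro borel_measurable_SUP countable_finite) (auto intro!: g_meas)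
    qed
    also have "\<dots> \<le> ennreal C' * (\<integral>\<^sup>+x. ennreal (h x powr p) \<partial>lborel)"
      unfolding g_def using e h by (intro SUP_least bound[rule_format]) auto
    finally show ?thesis .
  qed
  with C' show ?thesis by (intro exI[of _ C'] conjI allI impI)
qed

end

section \<open>Shifted dyadic grids in Euclidean space\<close>

text \<open>The one-third trick: the endpoints of the translates by \<open>\<plusminus>1/3\<close> stay away from those of the
  standard grid, and the alternating sign keeps consecutive levels nested.\<close>

definition grid_shift :: "('n \<Rightarrow> bool) \<Rightarrow> int \<Rightarrow> 'n \<Rightarrow> real" where
  "grid_shift \<sigma> k i = (if \<sigma> i then (if even k then 1 / 3 else - (1 / 3)) else 0)"

definition grid_index :: "('n \<Rightarrow> bool) \<Rightarrow> int \<Rightarrow> real^'n \<Rightarrow> 'n \<Rightarrow> int" where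
  "grid_index \<sigma> k x i = \<lfloor>2 powr real_of_int k * x $ i - grid_shift \<sigma> k i\<rfloor>"

definition grid_cell :: "('n \<Rightarrow> bool) \<Rightarrow> int \<Rightarrow> real^'n \<Rightarrow> (real^'n) set" where
  "grid_cell \<sigma> k x = {y. \<forall>i. grid_index \<sigma> k y i = grid_index \<sigma> k x i}"

text \<open>Consecutive shifts are opposite and three times the shift s is an integer, so doubling
  the scale adds an integer: 2 (u + s) + s = 2 u + 3 s. The index at level k + 1 thus determines the
  one at level k, which is nestedness.\<close>

lemma grid_index_Suc:
  "grid_index \<sigma> k x i = (grid_index \<sigma> (k + 1) x i - \<lfloor>3 * grid_shift \<sigma> k i\<rfloor>) div 2"
proof -
  define u where "u = 2 powr real_of_int k * x $ i - grid_shift \<sigma> k i"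
  have s: "grid_shift \<sigma> (k + 1) i = - grid_shift \<sigma> k i"
    by (auto simp: grid_shift_def)
  have t: "real_of_int \<lfloor>3 * grid_shift \<sigma> k i\<rfloor> = 3 * grid_shift \<sigma> k i"
    by (auto simp: grid_shift_def)
  have "2 powr real_of_int (k + 1) * x $ i - grid_shift \<sigma> (k + 1) i = 2 * u + real_of_int \<lfloor>3 * grid_shift \<sigma> k i\<rfloor>"
    unfolding t s by (simp add: u_def powr_add)
  then have "grid_index \<sigma> (k + 1) x i - \<lfloor>3 * grid_shift \<sigma> k i\<rfloor> = \<lfloor>2 * u\<rfloor>"
    by (simp add: grid_index_def)
  moreover have "\<lfloor>u\<rfloor> = \<lfloor>2 * u\<rfloor> div 2"
    by (metis floor_divide_real_eq_div mult.commute nonzero_mult_div_cancel_right numeral_eq_one_iff of_int_numeral semiring_norm(85) zero_le_numeral zero_neq_numeral)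
  ultimately show ?thesis by (simp add: grid_index_def u_def)
qed

lemma grid_cell_nested_add: "grid_cell \<sigma> (k + int m) x \<subseteq> grid_cell \<sigma> k x"
proof (induction m)
  case (Suc m)
  have "grid_cell \<sigma> (k + int (Suc m)) x \<subseteq> grid_cell \<sigma> (k + int m) x"
    using grid_index_Suc[of \<sigma> "k + int m"] by (auto simp: grid_cell_def add_ac)
  then show ?case using Suc by blast
qed simp

definition grid_corner :: "('n \<Rightarrow> bool) \<Rightarrow> int \<Rightarrow> real^'n \<Rightarrow> real^'n" where
  "grid_corner \<sigma> k x = (\<chi> i. (real_of_int (grid_index \<sigma> k x i) + grid_shift \<sigma> k i) * 2 powr (- real_of_int k))"

lemma grid_cell_eq_box:
  "grid_cell \<sigma> k x = {y. \<forall>i. grid_corner \<sigma> k x $ i \<le> y $ i \<and> y $ i < grid_corner \<sigma> k x $ i + 2 powr (- real_of_int k)}"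
proof -
  define h where "h = 2 powr real_of_int k"
  have h: "0 < h" "2 powr (- real_of_int k) = 1 / h" by (auto simp: h_def powr_minus_divide)
  have "grid_index \<sigma> k y i = grid_index \<sigma> k x i \<longleftrightarrow>
    grid_corner \<sigma> k x $ i \<le> y $ i \<and> y $ i < grid_corner \<sigma> k x $ i + 2 powr (- real_of_int k)" for y i
  proof -
    have "grid_index \<sigma> k y i = grid_index \<sigma> k x i \<longleftrightarrow>
      real_of_int (grid_index \<sigma> k x i) \<le> h * y $ i - grid_shift \<sigma> k i \<and>
      h * y $ i - grid_shift \<sigma> k i < real_of_int (grid_index \<sigma> k x i) + 1"
      unfolding grid_index_def[of \<sigma> k y] h_def[symmetric] by (auto simp: floor_eq_iff)
    then show ?thesis using h(1) unfolding grid_corner_def h(2) by (simp add: field_simps)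
  qed
  then show ?thesis by (simp add: grid_cell_def)
qed

text \<open>The half-open box is squeezed between an open and a closed box of equal volume.\<close>

lemma cart_box_bounds:
  fixes l :: "real^'n"
  assumes "0 < h"
  defines "S \<equiv> {y. \<forall>i. l $ i \<le> y $ i \<and> y $ i < l $ i + h}"
  shows "S \<in> sets borel" "emeasure lborel S = ennreal (h ^ CARD('n))"
    "S \<subseteq> cbox l (\<chi> i. l $ i + h)" "emeasure lborel (cbox l (\<chi> i. l $ i + h)) = ennreal (h ^ CARD('n))"
proof -
  let ?u = "\<chi> i. l $ i + h"
  have S: "S = (\<Inter>i. {y. l $ i \<le> y $ i} \<inter> {y. y $ i < l $ i + h})" by (auto simp: S_def)
  show meas: "S \<in> sets borel"
    unfolding S
    by (intro sets.countable_INT'' sets.Int) (auto intro!: borel_closed closed_Collect_le borel_open open_Collect_less continuous_intros)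
  have "\<forall>b\<in>Basis. l \<bullet> b \<le> ?u \<bullet> b"
    using assms by (auto simp: Basis_vec_def inner_axis)
  moreover have "(\<Prod>b\<in>Basis. (?u - l) \<bullet> b) = h ^ CARD('n)"
  proof -
    have "(\<Prod>b\<in>Basis. (?u - l) \<bullet> b) = (\<Prod>b\<in>(Basis :: (real^'n) set). h)"
      by (intro prod.cong) (auto simp: Basis_vec_def inner_axis)
    then show ?thesis by simp
  qed
  ultimately have vol: "emeasure lborel (box l ?u) = ennreal (h ^ CARD('n))" "emeasure lborel (cbox l ?u) = ennreal (h ^ CARD('n))"
    by (auto simp: emeasure_lborel_box emeasure_lborel_cbox)
  show "S \<subseteq> cbox l ?u" by (auto simp: S_def mem_box_cart less_imp_le)
  moreover have "box l ?u \<subseteq> S" by (auto simp: S_def mem_box_cart less_imp_le)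
  ultimately have "emeasure lborel (box l ?u) \<le> emeasure lborel S" "emeasure lborel S \<le> emeasure lborel (cbox l ?u)"
    using meas by (auto intro!: emeasure_mono)
  then show "emeasure lborel S = ennreal (h ^ CARD('n))" using vol by simp
  show "emeasure lborel (cbox l ?u) = ennreal (h ^ CARD('n))" by (rule vol)
qed

lemma two_powr_pos: "0 < (2::real) powr a" by simp

lemmas grid_cell_bounds = cart_box_bounds[OF two_powr_pos[of "- real_of_int k" for k]]

lemma dyadic_grid_grid_cell: "dyadic_grid (grid_cell \<sigma> :: int \<Rightarrow> real^'n \<Rightarrow> (real^'n) set) (2 ^ CARD('n))"
proof
  fix k l :: int and x y :: "real^'n" and S :: "(real^'n) set"
  show "1 < (2::real) ^ CARD('n)" by simp
  show "x \<in> grid_cell \<sigma> k x" by (simp add: grid_cell_def)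
  show "y \<in> grid_cell \<sigma> k x \<Longrightarrow> grid_cell \<sigma> k y = grid_cell \<sigma> k x" by (auto simp: grid_cell_def)
  show "k \<le> l \<Longrightarrow> grid_cell \<sigma> l x \<subseteq> grid_cell \<sigma> k x"
    using grid_cell_nested_add[of \<sigma> k "nat (l - k)" x] by simp
  show "grid_cell \<sigma> k x \<in> sets borel"
    unfolding grid_cell_eq_box by (rule grid_cell_bounds)
  show "emeasure lborel (grid_cell \<sigma> k x) = ennreal ((2 ^ CARD('n)) powr - real_of_int k)"
    unfolding grid_cell_eq_box grid_cell_bounds(2)
    by (simp add: powr_power powr_powr mult.commute flip: powr_realpow)
  show "open S \<Longrightarrow> x \<in> S \<Longrightarrow> \<exists>k. grid_cell \<sigma> k x \<subseteq> S"
  proof -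
    assume "open S" "x \<in> S"
    then obtain e where e: "0 < e" "ball x e \<subseteq> S" by (meson openE)
    \<comment> \<open>Two points of a level-m cell are at distance at most n 2^(-m), by the l1 norm;
      \<open>m\<close> makes this smaller than \<open>e\<close>.\<close>
    obtain m :: nat where m: "real CARD('n) / e < 2 ^ m"
      using real_arch_pow[of 2 "real CARD('n) / e"] by auto
    have "grid_cell \<sigma> (int m) x \<subseteq> ball x e"
    proof
      fix y assume y: "y \<in> grid_cell \<sigma> (int m) x"
      moreover have "x \<in> grid_cell \<sigma> (int m) x" by (simp add: grid_cell_def)
      ultimately have "\<bar>(y - x) $ i\<bar> \<le> 2 powr (- real_of_int (int m))" for i
        unfolding grid_cell_eq_box by (auto dest!: spec[of _ i] simp: abs_le_iff)
      then have "norm (y - x) \<le> (\<Sum>i\<in>(UNIV::'n set). 2 powr (- real_of_int (int m)))"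
        by (intro order_trans[OF norm_le_l1_cart] sum_mono)
      also have "\<dots> = real CARD('n) / 2 ^ m"
        by (simp add: powr_minus_divide powr_realpow)
      also have "\<dots> < e" using m e by (simp add: field_simps)
      finally show "y \<in> ball x e" by (simp add: dist_norm norm_minus_commute)
    qed
    then show ?thesis using e by blast
  qed
  show "countable (range (grid_cell \<sigma> k :: real^'n \<Rightarrow> (real^'n) set))"
  proof (rule countable_subset)
    show "range (grid_cell \<sigma> k :: real^'n \<Rightarrow> (real^'n) set) \<subseteq> range (\<lambda>m. {y. \<forall>i. grid_index \<sigma> k y i = m i})"
      by (auto simp: grid_cell_def)
  qed simp
qed

lemma avg_set_cube: "Q \<in> cubes \<Longrightarrow> avg_set Q"
  by (auto simp: cubes_def avg_set_def cart_box_bounds(4))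

text \<open>At the level where the rescaled side lies between 1/6 and 1/3, the interval in each
  coordinate crosses at most one integer. The coordinate is shifted exactly when it crosses one;
  both ends then lie within 1/3 of that integer, and the shifted grid has no division point between
  them. The side ratio of at most 6 gives 6^n.\<close>

lemma cube_subset_cell:
  fixes Q :: "(real^'n) set"
  assumes "Q \<in> cubes"
  shows "\<exists>\<sigma> k x. Q \<subseteq> grid_cell \<sigma> k x \<and> emeasure lborel (grid_cell \<sigma> k x) \<le> ennreal (6 ^ CARD('n)) * emeasure lborel Q"
proof -
  obtain a h where Q: "Q = cbox a (\<chi> i. a $ i + h)" "0 < h" using assms by (auto simp: cubes_def)
  define k where "k = \<lceil>log 2 (1 / (3 * h))\<rceil> - 1"
  have "real_of_int k < log 2 (1 / (3 * h))" "log 2 (1 / (3 * h)) \<le> real_of_int k + 1"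
    by (auto simp: k_def) linarith
  then have "2 powr real_of_int k < 1 / (3 * h)" "1 / (3 * h) \<le> 2 powr (real_of_int k + 1)"
    using Q by (auto simp: powr_less_iff le_powr_iff)
  then have k: "2 powr real_of_int k * h < 1 / 3" "1 \<le> 6 * h * 2 powr real_of_int k"
    using Q by (auto simp: powr_add field_simps)
  define r where "r = 2 powr real_of_int k"
  have r: "0 < r" "r * h < 1 / 3" using k by (auto simp: r_def)
  define \<sigma> where "\<sigma> i = (\<lfloor>r * a $ i\<rfloor> \<noteq> \<lfloor>r * a $ i + r * h\<rfloor>)" for i
  have ends: "\<lfloor>r * a $ i + r * h - grid_shift \<sigma> k i\<rfloor> = \<lfloor>r * a $ i - grid_shift \<sigma> k i\<rfloor>" for i
  proof (cases "\<sigma> i")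
    case True
    define u where "u = r * a $ i"
    define w where "w = r * h"
    define m where "m = \<lfloor>u + w\<rfloor>"
    have w: "0 < w" "w < 1 / 3" using r Q by (auto simp: w_def)
    have "\<lfloor>u\<rfloor> \<noteq> m" using True by (simp add: \<sigma>_def u_def w_def m_def)
    moreover have "\<lfloor>u\<rfloor> \<le> m" unfolding m_def using w by (intro floor_mono) simp
    ultimately have "u < real_of_int m" by linarith
    moreover have "real_of_int m \<le> u + w" "u + w < real_of_int m + 1" unfolding m_def by linarith+
    \<comment> \<open>Both signs are covered, since the sign of the shift depends on the parity of
      \<open>k\<close>.\<close>
    ultimately have "\<lfloor>u - 1 / 3\<rfloor> = m - 1" "\<lfloor>u + w - 1 / 3\<rfloor> = m - 1" "\<lfloor>u + 1 / 3\<rfloor> = m" "\<lfloor>u + w + 1 / 3\<rfloor> = m"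
      using w by (auto simp: floor_eq_iff)
    then show ?thesis using True by (auto simp: grid_shift_def u_def w_def)
  qed (auto simp: grid_shift_def \<sigma>_def)
  have "Q \<subseteq> grid_cell \<sigma> k a"
  proof
    fix y assume "y \<in> Q"
    then have "a $ i \<le> y $ i" "y $ i \<le> a $ i + h" for i
      by (auto simp: Q mem_box_cart)
    then have y: "r * a $ i \<le> r * y $ i" "r * y $ i \<le> r * a $ i + r * h" for i
      using r by (auto simp flip: distrib_left)
    have "\<lfloor>r * y $ i - grid_shift \<sigma> k i\<rfloor> = \<lfloor>r * a $ i - grid_shift \<sigma> k i\<rfloor>" for i
    proof (rule antisym)
      show "\<lfloor>r * y $ i - grid_shift \<sigma> k i\<rfloor> \<le> \<lfloor>r * a $ i - grid_shift \<sigma> k i\<rfloor>"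
        unfolding ends[symmetric] using y[where i=i] by (intro floor_mono) simp
    qed (use y[where i=i] in \<open>intro floor_mono, simp\<close>)
    then show "y \<in> grid_cell \<sigma> k a" by (simp add: grid_cell_def grid_index_def r_def)
  qed
  moreover have "emeasure lborel (grid_cell \<sigma> k a) \<le> ennreal (6 ^ CARD('n)) * emeasure lborel Q"
  proof -
    have "2 powr (- real_of_int k) \<le> 6 * h"
      using k by (simp add: powr_minus_divide field_simps)
    then have "(2 powr (- real_of_int k)) ^ CARD('n) \<le> (6 * h) ^ CARD('n)"
      by (intro power_mono) auto
    also have "\<dots> = 6 ^ CARD('n) * h ^ CARD('n)" by (rule power_mult_distrib)
    finally show ?thesis
      unfolding grid_cell_eq_box grid_cell_bounds(2) Q(1) cart_box_bounds(4)[OF Q(2)]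
      using Q(2) by (simp flip: ennreal_mult)
  qed
  ultimately show ?thesis by blast
qed

section \<open>Half-open cells against closed cubes\<close>

lemma grid_cell_cube:
  "\<exists>Q\<in>cubes. grid_cell \<sigma> k x \<subseteq> Q \<and> emeasure lborel (grid_cell \<sigma> k x) = emeasure lborel Q"
proof -
  let ?h = "2 powr (- real_of_int k)" and ?l = "grid_corner \<sigma> k x"
  show ?thesis
  proof (intro bexI conjI)
    show "cbox ?l (\<chi> i. ?l $ i + ?h) \<in> cubes" unfolding cubes_def using two_powr_pos by blast
    show "grid_cell \<sigma> k x \<subseteq> cbox ?l (\<chi> i. ?l $ i + ?h)"
      unfolding grid_cell_eq_box by (rule grid_cell_bounds(3))
    show "emeasure lborel (grid_cell \<sigma> k x) = emeasure lborel (cbox ?l (\<chi> i. ?l $ i + ?h))"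
      unfolding grid_cell_eq_box grid_cell_bounds(2) grid_cell_bounds(4) ..
  qed
qed

text \<open>A cell and the closed cube around it differ by a null set, so bounds on averages pass
  from cubes to cells without loss.\<close>

lemma average_null_difference:
  assumes R: "avg_set R" and Q: "avg_set Q" and sub: "R \<subseteq> Q" and eq: "emeasure lborel R = emeasure lborel Q"
  shows "average R f = average Q f"
proof -
  have [measurable]: "R \<in> sets borel" "Q \<in> sets borel" using R Q by (auto simp: avg_set_def)
  have "emeasure lborel (Q - R) = 0"
    using emeasure_Diff[of lborel R Q] sub eq avg_setD[OF R] by simp
  then have ae: "AE x in lborel. x \<notin> Q - R" by (intro AE_not_in null_setsI) auto
  have "(\<integral>\<^sup>+x\<in>R. f x \<partial>lborel) = (\<integral>\<^sup>+x\<in>Q. f x \<partial>lborel)"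
  proof (rule nn_integral_cong_AE)
    show "AE x in lborel. f x * indicator R x = f x * indicator Q x"
      using ae by eventually_elim (use sub in \<open>auto simp: indicator_def\<close>)
  qed
  then show ?thesis by (simp add: average_eq R Q eq)
qed

lemma Ap_bound_grid_cell:
  assumes "\<And>Q. Q \<in> cubes \<Longrightarrow> Ap_bound A B p q C Q"
  shows "Ap_bound A B p q C (grid_cell \<sigma> k x)"
proof -
  interpret dyadic_grid "grid_cell \<sigma>" "2 ^ CARD('a)" by (rule dyadic_grid_grid_cell)
  obtain Q where Q: "Q \<in> cubes" "grid_cell \<sigma> k x \<subseteq> Q" "emeasure lborel (grid_cell \<sigma> k x) = emeasure lborel Q"
    using grid_cell_cube[of \<sigma> k x] by blast
  have "average (grid_cell \<sigma> k x) = (average Q :: (_ \<Rightarrow> ennreal) \<Rightarrow> ennreal)"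
    using average_null_difference[OF avg_set_cell avg_set_cube, of "grid_cell \<sigma> k x" Q] Q by (simp add: fun_eq_iff)
  then show ?thesis using assms[OF Q(1)] by (simp add: Ap_bound_def)
qed

section \<open>The Rubio de Francia iteration\<close>

text \<open>Convexity of x^\<theta> at the points a k / b k with weights b k / S. The freedom in
  \<open>b\<close> is the point: the iteration adapts it to the point at which its second inequality
  is tested.\<close>

lemma Jensen_powr_sum:
  fixes a b :: "nat \<Rightarrow> real"
  assumes "1 \<le> \<theta>" "finite I" "I \<noteq> {}" "\<And>k. k \<in> I \<Longrightarrow> 0 < a k" "\<And>k. k \<in> I \<Longrightarrow> 0 < b k"
  shows "(\<Sum>k\<in>I. a k) powr \<theta> \<le> (\<Sum>k\<in>I. b k) powr \<theta> * (\<Sum>k\<in>I. b k / (\<Sum>k\<in>I. b k) * (a k / b k) powr \<theta>)"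
proof -
  define S where "S = (\<Sum>k\<in>I. b k)"
  have S: "0 < S" unfolding S_def using assms by (intro sum_pos) auto
  have "(\<Sum>k\<in>I. (b k / S) *\<^sub>R (a k / b k)) powr \<theta> \<le> (\<Sum>k\<in>I. b k / S * (a k / b k) powr \<theta>)"
  proof (rule convex_on_sum[OF _ _ powr_convex])
    show "(\<Sum>k\<in>I. b k / S) = 1" using S by (simp add: S_def flip: sum_divide_distrib)
  qed (use assms S in \<open>auto simp: less_imp_le\<close>)
  moreover have "(\<Sum>k\<in>I. (b k / S) *\<^sub>R (a k / b k)) = (\<Sum>k\<in>I. a k) / S"
    unfolding sum_divide_distrib using assms by (intro sum.cong) (auto dest!: assms(5))
  ultimately have "((\<Sum>k\<in>I. a k) / S) powr \<theta> \<le> (\<Sum>k\<in>I. b k / S * (a k / b k) powr \<theta>)" by simp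
  then have "S powr \<theta> * ((\<Sum>k\<in>I. a k) / S) powr \<theta> \<le> S powr \<theta> * (\<Sum>k\<in>I. b k / S * (a k / b k) powr \<theta>)"
    by (rule mult_left_mono) simp
  moreover have "S powr \<theta> * ((\<Sum>k\<in>I. a k) / S) powr \<theta> = (S * ((\<Sum>k\<in>I. a k) / S)) powr \<theta>"
    by (rule powr_mult[symmetric])
  ultimately show ?thesis using S by (simp add: S_def)
qed

lemma average_suminf:
  assumes "avg_set Q" "\<And>i. f i \<in> borel_measurable borel"
  shows "average Q (\<lambda>x. \<Sum>i. f i x) = (\<Sum>i. average Q (f i))"
proof -
  have "(\<integral>\<^sup>+x\<in>Q. (\<Sum>i. f i x) \<partial>lborel) = (\<Sum>i. \<integral>\<^sup>+x\<in>Q. f i x \<partial>lborel)"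
    unfolding ennreal_suminf_multc[symmetric]
    by (intro nn_integral_suminf measurable_mult_indicator_lborel assms)
  then show ?thesis
    by (simp add: average_eq[OF assms(1)] divide_ennreal_def)
qed

lemma average_le_SUP:
  assumes Q: "avg_set Q" and meas: "\<And>i. f i \<in> borel_measurable borel" and "incseq f"
    and le: "\<And>x. g x \<le> (SUP i. f i x)" and bound: "\<And>i. average Q (f i) \<le> c"
  shows "average Q g \<le> c"
proof -
  have "emeasure lborel Q * average Q g \<le> (\<integral>\<^sup>+x. (SUP i. f i x * indicator Q x) \<partial>lborel)"
    unfolding emeasure_mult_average[OF Q]
    by (intro nn_integral_mono) (auto simp: le SUP_mult_right_ennreal[symmetric] intro!: mult_right_mono)
  also have "\<dots> = (SUP i. \<integral>\<^sup>+x\<in>Q. f i x \<partial>lborel)"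
    using \<open>incseq f\<close>
    by (intro nn_integral_monotone_convergence_SUP measurable_mult_indicator_lborel Q meas)
      (auto simp: incseq_def le_fun_def intro!: mult_right_mono)
  also have "\<dots> \<le> emeasure lborel Q * c"
    by (intro SUP_least) (auto simp: bound mult_left_mono simp flip: emeasure_mult_average[OF Q])
  finally show ?thesis using avg_setD[OF Q] by (simp add: ennreal_mult_le_mult_iff)
qed

text \<open>The second operator is sublinear only after extracting a \<open>\<theta>\<close>-th root, which is where
  \<open>1 \<le> \<theta>\<close> and Jensen's inequality enter.\<close>

lemma Rubio_de_Francia:
  fixes \<kappa>1 \<kappa>2 :: "real^'n \<Rightarrow> real^'n \<Rightarrow> real"
  assumes meas [measurable]: "\<And>x. \<kappa>1 x \<in> borel_measurable borel" "\<And>x. \<kappa>2 x \<in> borel_measurable borel"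
    and nonneg: "\<And>x y. 0 \<le> \<kappa>1 x y" "\<And>x y. 0 \<le> \<kappa>2 x y"
    and \<theta>: "1 \<le> \<theta>" and p: "1 \<le> p" and K: "1 \<le> K" and \<Q>: "\<And>Q. Q \<in> \<Q> \<Longrightarrow> avg_set Q"
    and step: "\<And>h :: real^'n \<Rightarrow> real. h \<in> borel_measurable borel \<Longrightarrow> (\<And>x. 0 < h x) \<Longrightarrow> (\<integral>\<^sup>+x. ennreal (h x powr p) \<partial>lborel) < top \<Longrightarrow>
      \<exists>h'. h' \<in> borel_measurable borel \<and> (\<forall>x. h x \<le> h' x) \<and>
        (\<integral>\<^sup>+x. ennreal (h' x powr p) \<partial>lborel) \<le> ennreal K * (\<integral>\<^sup>+x. ennreal (h x powr p) \<partial>lborel) \<and>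
        (AE x in lborel. \<forall>Q\<in>\<Q>. x \<in> Q \<longrightarrow> average Q (\<lambda>y. ennreal (\<kappa>1 x y * h y)) \<le> ennreal (h' x) \<and>
          average Q (\<lambda>y. ennreal (\<kappa>2 x y * h y powr \<theta>)) \<le> ennreal (h' x powr \<theta>))"
  shows "\<exists>t. t \<in> borel_measurable borel \<and> (\<forall>x. 0 < t x) \<and>
    (AE x in lborel. \<forall>Q\<in>\<Q>. x \<in> Q \<longrightarrow> average Q (\<lambda>y. ennreal (\<kappa>1 x y * t y)) \<le> ennreal (4 * K * t x) \<and>
      average Q (\<lambda>y. ennreal (\<kappa>2 x y * t y powr \<theta>)) \<le> ennreal ((4 * K * t x) powr \<theta>))"
proof -
  define good where "good h \<longleftrightarrow> h \<in> borel_measurable borel \<and> (\<forall>x. 0 < h x) \<and> (\<integral>\<^sup>+x. ennreal (h x powr p) \<partial>lborel) < top" for h :: "real^'n \<Rightarrow> real"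
  define next_to where "next_to h h' \<longleftrightarrow> (\<integral>\<^sup>+x. ennreal (h' x powr p) \<partial>lborel) \<le> ennreal K * (\<integral>\<^sup>+x. ennreal (h x powr p) \<partial>lborel) \<and>
        (AE x in lborel. \<forall>Q\<in>\<Q>. x \<in> Q \<longrightarrow> average Q (\<lambda>y. ennreal (\<kappa>1 x y * h y)) \<le> ennreal (h' x) \<and>
          average Q (\<lambda>y. ennreal (\<kappa>2 x y * h y powr \<theta>)) \<le> ennreal (h' x powr \<theta>))" for h h' :: "real^'n \<Rightarrow> real"
  have step': "\<exists>h'. good h' \<and> next_to h h'" if h: "good h" for h
  proof -
    obtain h' where h': "h' \<in> borel_measurable borel" "\<forall>x. h x \<le> h' x" "next_to h h'"
      using step[of h] h unfolding good_def next_to_def by blast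
    have "(\<integral>\<^sup>+x. ennreal (h' x powr p) \<partial>lborel) < top"
      using h h' unfolding good_def next_to_def by (meson ennreal_less_top ennreal_mult_less_top le_less_trans)
    then have "good h'" using h h' by (auto simp: good_def intro: less_le_trans)
    then show ?thesis using h' by blast
  qed
  have "\<exists>h. good h"
  proof -
    \<comment> \<open>Sigma-finiteness provides a strictly positive integrable function, whose p-th
      root starts the iteration; its positivity keeps the final \<open>t\<close> positive.\<close>
    obtain g :: "real^'n \<Rightarrow> ennreal" where g: "g \<in> borel_measurable lborel" "integral\<^sup>N lborel g \<noteq> \<infinity>" "\<And>x. 0 < g x \<and> g x < \<infinity>"
      using sigma_finite_measure.Ex_finite_integrable_function[OF sigma_finite_lborel] by auto
    have "ennreal ((enn2real (g x) powr (1 / p)) powr p) = g x" for x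
      using g(3)[of x] p by (simp add: powr_powr)
    moreover have "0 < enn2real (g x) powr (1 / p)" for x
      using g(3)[of x] enn2real_positive_iff[of "g x"] by (simp add: less_le)
    ultimately have "good (\<lambda>x. enn2real (g x) powr (1 / p))"
      unfolding good_def using g(1,2) by (auto simp: less_top[symmetric])
    then show ?thesis by blast
  qed
  then obtain H where H: "\<And>k. good (H k)" "\<And>k. next_to (H k) (H (Suc k))"
    using dependent_nat_choice[of "\<lambda>_. good" "\<lambda>_. next_to"] step' by blast
  have H_meas [measurable]: "H k \<in> borel_measurable borel" and H_pos: "0 < H k x" for k x
    using H(1) by (auto simp: good_def)
  define I0 where "I0 = (\<integral>\<^sup>+x. ennreal (H 0 x powr p) \<partial>lborel)"
  have I0: "I0 < top" using H(1)[of 0] by (simp add: good_def I0_def)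
  have H_norm: "(\<integral>\<^sup>+x. ennreal (H k x powr p) \<partial>lborel) \<le> ennreal (K ^ k) * I0" for k
  proof (induction k)
    case (Suc k)
    have "(\<integral>\<^sup>+x. ennreal (H (Suc k) x powr p) \<partial>lborel) \<le> ennreal K * (\<integral>\<^sup>+x. ennreal (H k x powr p) \<partial>lborel)"
      using H(2)[of k] by (simp add: next_to_def)
    also have "\<dots> \<le> ennreal K * (ennreal (K ^ k) * I0)" by (intro mult_left_mono Suc) simp
    finally show ?case using K by (simp add: ennreal_mult mult.assoc)
  qed (simp add: I0_def)
  \<comment> \<open>The integrals of the p-th powers grow at most like K^k, so the weights (4
    K)^(-k) give convergence with room to spare. Passing from k to k + 1 costs a factor 4 K, the
    constant of the conclusion.\<close>
  define c where "c k = (1 / (4 * K)) ^ k" for k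
  have c: "0 < c k" "4 * K * c (Suc k) = c k" for k using K by (auto simp: c_def)
  define T where "T x = (\<Sum>k. ennreal (c k * H k x))" for x
  have T_meas [measurable]: "T \<in> borel_measurable borel" unfolding T_def by measurable
  have T_fin: "AE x in lborel. T x \<noteq> top"
  proof -
    \<comment> \<open>In place of Minkowski's inequality: y <= 1 + y^p for y = 2^k c(k) H_k(x),
      weighted by 2^(-k), reduces finiteness of \<open>T\<close> to a convergent sum of
      integrals.\<close>
    define G where "G x = (\<Sum>k. ennreal ((1 / 2) ^ k * ((2 ^ k * c k) powr p * H k x powr p)))" for x
    have [measurable]: "G \<in> borel_measurable borel" unfolding G_def by measurable
    have le: "T x \<le> 2 + G x" for x
    proof -
      have "T x \<le> (\<Sum>k. ennreal ((1 / 2) ^ k) + ennreal ((1 / 2) ^ k * ((2 ^ k * c k) powr p * H k x powr p)))"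
        unfolding T_def
      proof (intro suminf_le)
        fix k
        let ?y = "2 ^ k * c k * H k x"
        have "0 \<le> ?y" using c[of k] H_pos[of k x] by simp
        have "?y \<le> 1 + ?y powr p"
        proof (cases "?y \<le> 1")
          case False
          then have "?y powr 1 \<le> ?y powr p" using p by (intro powr_mono) auto
          then show ?thesis using \<open>0 \<le> ?y\<close> by simp
        qed (simp add: add_increasing2)
        then have "(1 / 2) ^ k * ?y \<le> (1 / 2) ^ k * (1 + ?y powr p)" by (intro mult_left_mono) auto
        moreover have "(1 / 2) ^ k * ?y = c k * H k x" by (simp add: power_one_over)
        moreover have "?y powr p = (2 ^ k * c k) powr p * H k x powr p"
          by (rule powr_mult)
        ultimately have "c k * H k x \<le> (1 / 2) ^ k + (1 / 2) ^ k * ((2 ^ k * c k) powr p * H k x powr p)"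
          by (simp add: distrib_left)
        then show "ennreal (c k * H k x) \<le> ennreal ((1 / 2) ^ k) + ennreal ((1 / 2) ^ k * ((2 ^ k * c k) powr p * H k x powr p))"
          by (simp add: ennreal_leI flip: ennreal_plus)
      qed auto
      also have "\<dots> = (\<Sum>k. ennreal ((1 / 2) ^ k)) + G x"
        unfolding G_def by (intro suminf_add[symmetric]) auto
      also have "(\<Sum>k. ennreal ((1 / 2) ^ k)) = ennreal 2"
        using geometric_sums[of "1 / 2 :: real"] by (intro suminf_ennreal_eq) auto
      finally show ?thesis by simp
    qed
    have "(\<integral>\<^sup>+x. G x \<partial>lborel) = (\<Sum>k. ennreal ((1 / 2) ^ k * (2 ^ k * c k) powr p) * (\<integral>\<^sup>+x. ennreal (H k x powr p) \<partial>lborel))"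
      unfolding G_def by (subst nn_integral_suminf) (auto simp: ennreal_mult mult.assoc nn_integral_cmult)
    also have "\<dots> \<le> (\<Sum>k. ennreal ((1 / 2) ^ k) * I0)"
    proof (intro suminf_le)
      fix k
      have "2 ^ k * c k = (1 / (2 * K)) ^ k" by (simp add: c_def power_mult_distrib[symmetric])
      moreover have "((1 / (2 * K)) ^ k) powr p \<le> ((1 / (2 * K)) ^ k) powr 1"
        using K p by (intro powr_mono' power_le_one) auto
      moreover have "((1 / (2 * K)) ^ k) powr 1 = (1 / (2 * K)) ^ k"
        using K by simp
      ultimately have "(2 ^ k * c k) powr p * K ^ k \<le> (1 / (2 * K)) ^ k * K ^ k"
        using K by (intro mult_right_mono) auto
      also have "\<dots> \<le> 1"
        using K by (auto simp: power_mult_distrib[symmetric] intro!: power_le_one)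
      finally have *: "(2 ^ k * c k) powr p * K ^ k \<le> 1" .
      have "ennreal ((1 / 2) ^ k * (2 ^ k * c k) powr p) * (\<integral>\<^sup>+x. ennreal (H k x powr p) \<partial>lborel) \<le>
        ennreal ((1 / 2) ^ k * (2 ^ k * c k) powr p) * (ennreal (K ^ k) * I0)"
        by (intro mult_left_mono H_norm) simp
      also have "\<dots> = ennreal ((1 / 2) ^ k * ((2 ^ k * c k) powr p * K ^ k)) * I0"
        using K by (simp add: ennreal_mult mult.assoc)
      also have "\<dots> \<le> ennreal ((1 / 2) ^ k) * I0"
        using * by (intro mult_right_mono ennreal_leI) (auto intro: mult_left_le)
      finally show "ennreal ((1 / 2) ^ k * (2 ^ k * c k) powr p) * (\<integral>\<^sup>+x. ennreal (H k x powr p) \<partial>lborel) \<le> ennreal ((1 / 2) ^ k) * I0" .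
    qed auto
    also have "\<dots> = (\<Sum>k. ennreal ((1 / 2) ^ k)) * I0" by simp
    also have "(\<Sum>k. ennreal ((1 / 2) ^ k)) = ennreal 2"
      using geometric_sums[of "1 / 2 :: real"] by (intro suminf_ennreal_eq) auto
    also have "ennreal 2 * I0 < top" using I0 by (simp add: ennreal_mult_less_top)
    finally have "(\<integral>\<^sup>+x. G x \<partial>lborel) \<noteq> \<infinity>" by simp
    then have "AE x in lborel. G x \<noteq> \<infinity>" by (intro nn_integral_PInf_AE) auto
    then show ?thesis
    proof eventually_elim
      fix x assume "G x \<noteq> \<infinity>"
      then have "2 + G x < top" by (simp add: less_top[symmetric])
      then show "T x \<noteq> top" using le[of x] by (auto simp: top_unique)
    qed
  qed
  \<comment> \<open>The value 1 on the null set where \<open>T\<close> is infinite keeps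
    \<open>t\<close> real and positive everywhere.\<close>
  define t where "t x = (if T x = top then 1 else enn2real (T x))" for x
  have t_meas: "t \<in> borel_measurable borel" unfolding t_def by measurable
  have t_T: "ennreal (t x) = T x" if "T x \<noteq> top" for x
    using that by (simp add: t_def less_top)
  have t_pos: "0 < t x" for x
  proof -
    have "ennreal (c 0 * H 0 x) \<le> T x"
      unfolding T_def using sum_le_suminf[of "\<lambda>k. ennreal (c k * H k x)" "{0}"] by simp
    moreover have "0 < ennreal (c 0 * H 0 x)" using c H_pos by simp
    ultimately have "0 < T x" by (rule less_le_trans[rotated])
    then show ?thesis by (auto simp: t_def enn2real_positive_iff less_top)
  qed
  have "AE x in lborel. \<forall>k. \<forall>Q\<in>\<Q>. x \<in> Q \<longrightarrow> average Q (\<lambda>y. ennreal (\<kappa>1 x y * H k y)) \<le> ennreal (H (Suc k) x) \<and>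
          average Q (\<lambda>y. ennreal (\<kappa>2 x y * H k y powr \<theta>)) \<le> ennreal (H (Suc k) x powr \<theta>)"
    unfolding AE_all_countable using H(2) by (simp add: next_to_def)
  with T_fin have "AE x in lborel. \<forall>Q\<in>\<Q>. x \<in> Q \<longrightarrow> average Q (\<lambda>y. ennreal (\<kappa>1 x y * t y)) \<le> ennreal (4 * K * t x) \<and>
      average Q (\<lambda>y. ennreal (\<kappa>2 x y * t y powr \<theta>)) \<le> ennreal ((4 * K * t x) powr \<theta>)"
  proof (eventually_elim, intro ballI impI)
    fix x Q assume Tx: "T x \<noteq> top" and Q: "Q \<in> \<Q>" "x \<in> Q"
      and "\<forall>k. \<forall>Q\<in>\<Q>. x \<in> Q \<longrightarrow> average Q (\<lambda>y. ennreal (\<kappa>1 x y * H k y)) \<le> ennreal (H (Suc k) x) \<and>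
          average Q (\<lambda>y. ennreal (\<kappa>2 x y * H k y powr \<theta>)) \<le> ennreal (H (Suc k) x powr \<theta>)"
    then have one: "average Q (\<lambda>y. ennreal (\<kappa>1 x y * H k y)) \<le> ennreal (H (Suc k) x)"
      and two: "average Q (\<lambda>y. ennreal (\<kappa>2 x y * H k y powr \<theta>)) \<le> ennreal (H (Suc k) x powr \<theta>)" for k
      by auto
    have aQ: "avg_set Q" by (rule \<Q>[OF Q(1)])
    have tx: "ennreal (4 * K * t x) = ennreal (4 * K) * T x"
      using K t_pos[of x] t_T[OF Tx] by (simp add: ennreal_mult)
    have shift: "(\<Sum>k\<in>I. ennreal (c k * H (Suc k) x)) \<le> ennreal (4 * K) * T x" if "finite I" for I
    proof -
      have "(\<Sum>k\<in>I. ennreal (c k * H (Suc k) x)) = (\<Sum>k\<in>I. ennreal (4 * K) * ennreal (c (Suc k) * H (Suc k) x))"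
        using K c(1) H_pos by (intro sum.cong) (auto simp: mult.assoc[symmetric] c(2) less_imp_le simp flip: ennreal_mult)
      also have "\<dots> = ennreal (4 * K) * (\<Sum>k\<in>Suc ` I. ennreal (c k * H k x))"
        by (simp add: sum_distrib_left sum.reindex)
      also have "\<dots> \<le> ennreal (4 * K) * T x"
        unfolding T_def using that by (intro mult_left_mono sum_le_suminf) auto
      finally show ?thesis .
    qed
    have "average Q (\<lambda>y. ennreal (\<kappa>1 x y * t y)) = average Q (\<lambda>y. \<Sum>k. ennreal (c k) * ennreal (\<kappa>1 x y * H k y))"
    proof (rule average_cong_AE[OF aQ], use T_fin in eventually_elim, rule impI)
      fix y assume "T y \<noteq> top"
      have "ennreal (\<kappa>1 x y * t y) = ennreal (\<kappa>1 x y) * T y"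
        using nonneg t_pos[of y] t_T[OF \<open>T y \<noteq> top\<close>] by (simp add: ennreal_mult)
      also have "\<dots> = (\<Sum>k. ennreal (c k) * ennreal (\<kappa>1 x y * H k y))"
        unfolding T_def ennreal_suminf_cmult[symmetric] using nonneg c(1) H_pos
        by (intro suminf_cong) (simp add: ennreal_mult less_imp_le mult_ac)
      finally show "ennreal (\<kappa>1 x y * t y) = (\<Sum>k. ennreal (c k) * ennreal (\<kappa>1 x y * H k y))" .
    qed
    also have "\<dots> = (\<Sum>k. ennreal (c k) * average Q (\<lambda>y. ennreal (\<kappa>1 x y * H k y)))"
      by (subst average_suminf[OF aQ], measurable) (subst average_cmult[OF aQ], auto)
    also have "\<dots> \<le> (\<Sum>k. ennreal (c k * H (Suc k) x))"
      using c(1) H_pos by (intro suminf_le) (auto simp: ennreal_mult less_imp_le intro!: mult_left_mono one)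
    also have "\<dots> \<le> ennreal (4 * K) * T x"
      by (intro suminf_le_const) (auto intro: shift)
    finally have first: "average Q (\<lambda>y. ennreal (\<kappa>1 x y * t y)) \<le> ennreal (4 * K * t x)"
      by (simp add: tx)
    define f where "f N y = ennreal (\<kappa>2 x y * (\<Sum>k<N. c k * H k y) powr \<theta>)" for N y
    have "average Q (\<lambda>y. ennreal (\<kappa>2 x y) * ennreal_powr (T y) \<theta>) \<le> ennreal ((4 * K * t x) powr \<theta>)"
    proof (rule average_le_SUP[OF aQ, where f=f])
      show "f N \<in> borel_measurable borel" for N unfolding f_def by measurable
      show "incseq f"
      proof (rule incseq_SucI, rule le_funI)
        fix N y
        have "(\<Sum>k<N. c k * H k y) powr \<theta> \<le> (\<Sum>k<Suc N. c k * H k y) powr \<theta>"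
          using \<theta> c(1) H_pos by (intro powr_mono2) (auto intro!: sum_nonneg simp: less_imp_le)
        then show "f N y \<le> f (Suc N) y"
          unfolding f_def using nonneg by (intro ennreal_leI mult_left_mono)
      qed
      show "ennreal (\<kappa>2 x y) * ennreal_powr (T y) \<theta> \<le> (SUP N. f N y)" for y
      proof -
        have s: "ennreal_powr (\<Sum>k<N. ennreal (c k * H k y)) \<theta> = ennreal ((\<Sum>k<N. c k * H k y) powr \<theta>)" for N
          using c(1) H_pos by (simp add: less_imp_le sum_nonneg ennreal_powr_ennreal)
        have "T y \<le> ennreal_powr (SUP N. ennreal_powr (\<Sum>k<N. ennreal (c k * H k y)) \<theta>) (1 / \<theta>)"
          unfolding T_def
        proof (rule suminf_le_const)
          fix N
          have "ennreal_powr (\<Sum>k<N. ennreal (c k * H k y)) \<theta> \<le> (SUP N. ennreal_powr (\<Sum>k<N. ennreal (c k * H k y)) \<theta>)"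
            by (intro SUP_upper) auto
          then show "(\<Sum>k<N. ennreal (c k * H k y)) \<le> ennreal_powr (SUP N. ennreal_powr (\<Sum>k<N. ennreal (c k * H k y)) \<theta>) (1 / \<theta>)"
            using \<theta> by (simp only: ennreal_powr_le_iff less_le_trans[OF zero_less_one])
        qed simp
        then have "ennreal_powr (T y) \<theta> \<le> (SUP N. ennreal_powr (\<Sum>k<N. ennreal (c k * H k y)) \<theta>)"
          using \<theta> by (simp only: ennreal_powr_le_iff less_le_trans[OF zero_less_one])
        then have "ennreal (\<kappa>2 x y) * ennreal_powr (T y) \<theta> \<le> ennreal (\<kappa>2 x y) * (SUP N. ennreal ((\<Sum>k<N. c k * H k y) powr \<theta>))"
          unfolding s by (rule mult_left_mono) simp
        also have "\<dots> = (SUP N. f N y)"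
          unfolding f_def using nonneg by (simp add: SUP_mult_left_ennreal ennreal_mult)
        finally show ?thesis .
      qed
      show "average Q (f N) \<le> ennreal ((4 * K * t x) powr \<theta>)" for N
      proof (cases "N = 0")
        case True
        then have "f N = (\<lambda>y. 0)" by (simp add: f_def fun_eq_iff)
        then show ?thesis using average_const[OF aQ, of 0] by simp
      next
        case False
        \<comment> \<open>The Jensen weights are tied to the fixed point \<open>x\<close>: the ratio
          in Jensen's inequality becomes \<open>H k y / H (Suc k) x\<close>, and the average of its
          \<theta>-th power against \<kappa>2 is at most 1 by \<open>two\<close>. What remains is
          S^\<theta> with S <= 4 K t(x).\<close>
        define b where "b k = c k * H (Suc k) x" for k
        define S where "S = (\<Sum>k<N. b k)"
        have b: "0 < b k" for k using c(1) H_pos by (simp add: b_def)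
        have S: "0 < S" unfolding S_def using False b by (intro sum_pos) auto
        have term_eq: "b k / S * (c k * H k y / b k) powr \<theta> = b k / S * H (Suc k) x powr (- \<theta>) * H k y powr \<theta>" for k y
        proof -
          have eq: "c k * H k y / b k = H k y / H (Suc k) x" using c(1)[of k] by (simp add: b_def)
          show ?thesis
            unfolding eq powr_divide powr_minus by (simp add: divide_inverse mult_ac)
        qed
        have "average Q (f N) \<le> average Q (\<lambda>y. \<Sum>k<N. ennreal (S powr \<theta> * (b k / S) * H (Suc k) x powr (- \<theta>)) * ennreal (\<kappa>2 x y * H k y powr \<theta>))"
        proof (rule average_mono[OF aQ])
          fix y
          have "(\<Sum>k<N. c k * H k y) powr \<theta> \<le> S powr \<theta> * (\<Sum>k<N. b k / S * (c k * H k y / b k) powr \<theta>)"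
            unfolding S_def using \<theta> False b c(1) H_pos by (intro Jensen_powr_sum) (auto simp: lessThan_empty_iff)
          also have "\<dots> = (\<Sum>k<N. (S powr \<theta> * (b k / S) * H (Suc k) x powr (- \<theta>)) * H k y powr \<theta>)"
            unfolding term_eq sum_distrib_left by (simp only: mult.assoc)
          finally have "\<kappa>2 x y * (\<Sum>k<N. c k * H k y) powr \<theta> \<le> \<kappa>2 x y * (\<Sum>k<N. (S powr \<theta> * (b k / S) * H (Suc k) x powr (- \<theta>)) * H k y powr \<theta>)"
            using nonneg(2) by (rule mult_left_mono)
          also have "\<dots> = (\<Sum>k<N. (S powr \<theta> * (b k / S) * H (Suc k) x powr (- \<theta>)) * (\<kappa>2 x y * H k y powr \<theta>))"
            by (simp add: sum_distrib_left mult_ac)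
          finally have "f N y \<le> ennreal (\<Sum>k<N. (S powr \<theta> * (b k / S) * H (Suc k) x powr (- \<theta>)) * (\<kappa>2 x y * H k y powr \<theta>))"
            unfolding f_def by (rule ennreal_leI)
          also have "\<dots> = (\<Sum>k<N. ennreal ((S powr \<theta> * (b k / S) * H (Suc k) x powr (- \<theta>)) * (\<kappa>2 x y * H k y powr \<theta>)))"
            using nonneg b S by (intro sum_ennreal[symmetric]) (auto simp: less_imp_le)
          also have "\<dots> = (\<Sum>k<N. ennreal (S powr \<theta> * (b k / S) * H (Suc k) x powr (- \<theta>)) * ennreal (\<kappa>2 x y * H k y powr \<theta>))"
            using nonneg b S by (intro sum.cong refl ennreal_mult) (auto simp: less_imp_le)
          finally show "f N y \<le> (\<Sum>k<N. ennreal (S powr \<theta> * (b k / S) * H (Suc k) x powr (- \<theta>)) * ennreal (\<kappa>2 x y * H k y powr \<theta>))" .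
        qed
        also have "\<dots> = (\<Sum>k<N. ennreal (S powr \<theta> * (b k / S) * H (Suc k) x powr (- \<theta>)) * average Q (\<lambda>y. ennreal (\<kappa>2 x y * H k y powr \<theta>)))"
          by (subst average_sum[OF aQ], measurable) (subst average_cmult[OF aQ], auto)
        also have "\<dots> \<le> (\<Sum>k<N. ennreal (S powr \<theta> * (b k / S) * H (Suc k) x powr (- \<theta>)) * ennreal (H (Suc k) x powr \<theta>))"
          by (intro sum_mono mult_left_mono two) auto
        also have "\<dots> = (\<Sum>k<N. ennreal (S powr \<theta> * (b k / S)))"
        proof (rule sum.cong[OF refl])
          fix k
          have "H (Suc k) x powr (- \<theta>) * H (Suc k) x powr \<theta> = 1"
            using H_pos[of "Suc k" x] by (simp flip: powr_add)
          then show "ennreal (S powr \<theta> * (b k / S) * H (Suc k) x powr (- \<theta>)) * ennreal (H (Suc k) x powr \<theta>) = ennreal (S powr \<theta> * (b k / S))"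
            using b[of k] S by (simp add: mult.assoc less_imp_le flip: ennreal_mult)
        qed
        also have "\<dots> = ennreal (\<Sum>k<N. S powr \<theta> * (b k / S))"
          using b S by (intro sum_ennreal) (auto simp: less_imp_le)
        also have "(\<Sum>k<N. S powr \<theta> * (b k / S)) = S powr \<theta>"
          using S by (simp add: S_def flip: sum_distrib_left sum_divide_distrib)
        also have "ennreal (S powr \<theta>) \<le> ennreal ((4 * K * t x) powr \<theta>)"
        proof (intro ennreal_leI powr_mono2)
          have "ennreal S \<le> ennreal (4 * K * t x)"
            using shift[of "{..<N}"] b by (simp add: S_def b_def tx less_imp_le)
          then show "S \<le> 4 * K * t x" using K t_pos[of x] by (simp add: less_imp_le)
        qed (use \<theta> S in auto)
        finally show ?thesis .
      qed
    qed
    moreover have "average Q (\<lambda>y. ennreal (\<kappa>2 x y * t y powr \<theta>)) = average Q (\<lambda>y. ennreal (\<kappa>2 x y) * ennreal_powr (T y) \<theta>)"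
    proof (rule average_cong_AE[OF aQ], use T_fin in eventually_elim, rule impI)
      fix y assume "T y \<noteq> top"
      then show "ennreal (\<kappa>2 x y * t y powr \<theta>) = ennreal (\<kappa>2 x y) * ennreal_powr (T y) \<theta>"
        using nonneg t_pos[of y] by (simp add: ennreal_mult ennreal_powr_ennreal less_imp_le flip: t_T)
    qed
    ultimately show "average Q (\<lambda>y. ennreal (\<kappa>1 x y * t y)) \<le> ennreal (4 * K * t x) \<and>
      average Q (\<lambda>y. ennreal (\<kappa>2 x y * t y powr \<theta>)) \<le> ennreal ((4 * K * t x) powr \<theta>)"
      using first by simp
  qed
  then show ?thesis using t_meas t_pos by blast
qed

section \<open>Maximal operators over cubes and the scalar multiplier\<close>

lemma average_le_of_subset:
  assumes Q: "avg_set Q" and R: "avg_set R" and sub: "Q \<subseteq> R" and le: "emeasure lborel R \<le> c * emeasure lborel Q"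
  shows "average Q f \<le> c * average R f"
proof -
  have "emeasure lborel Q * average Q f \<le> emeasure lborel R * average R f"
    unfolding emeasure_mult_average[OF Q] emeasure_mult_average[OF R]
    using sub by (intro nn_integral_mono) (auto simp: indicator_def)
  also have "\<dots> \<le> (c * emeasure lborel Q) * average R f"
    by (intro mult_right_mono le) simp
  also have "\<dots> = emeasure lborel Q * (c * average R f)" by (simp only: mult_ac)
  finally show ?thesis using avg_setD[OF Q] by (simp add: ennreal_mult_le_mult_iff)
qed

context matrix_pair
begin

text \<open>Every cube sits in a cell of one of the 2^n shifted grids with at most 6^n times its
  volume, so 6^n times the sum of the grid operators dominates all cube averages. A measurable
  majorant \<open>g\<close> stands in for the supremum over uncountably many cubes.\<close>

lemma cube_maximal:
  assumes C: "0 \<le> C" and bound: "\<forall>Q\<in>cubes. Ap_bound A B p q C Q"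
  shows "\<exists>K\<ge>0. \<forall>h. h \<in> borel_measurable borel \<longrightarrow> (\<forall>x. 0 \<le> h x) \<longrightarrow> (\<integral>\<^sup>+x. ennreal (h x powr p) \<partial>lborel) < top \<longrightarrow>
    (\<exists>g. g \<in> borel_measurable borel \<and>
      (\<integral>\<^sup>+x. ennreal_powr (g x) p \<partial>lborel) \<le> ennreal K * (\<integral>\<^sup>+x. ennreal (h x powr p) \<partial>lborel) \<and>
      (\<forall>Q\<in>cubes. \<forall>x\<in>Q. average Q (\<lambda>y. ennreal (op_norm (A x ** B y) * h y)) \<le> g x))"
proof -
  have gp: "grid_pair (grid_cell \<sigma>) (2 ^ CARD('n)) A B p q C" for \<sigma> :: "'n \<Rightarrow> bool"
  proof -
    interpret dyadic_grid "grid_cell \<sigma>" "2 ^ CARD('n)" by (rule dyadic_grid_grid_cell)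
    show ?thesis
    proof unfold_locales
      show "Ap_bound A B p q C Q" if "Q \<in> cells" for Q
        using that bound by (auto simp: cells_def intro!: Ap_bound_grid_cell)
    qed (rule C)
  qed
  define M where "M \<sigma> = grid_pair.maximal (grid_cell \<sigma>) A B" for \<sigma> :: "'n \<Rightarrow> bool"
  define P where "P \<sigma> C' \<longleftrightarrow> 0 \<le> C' \<and> (\<forall>h. h \<in> borel_measurable borel \<longrightarrow> (\<forall>x. 0 \<le> h x) \<longrightarrow> (\<integral>\<^sup>+x. ennreal (h x powr p) \<partial>lborel) < top \<longrightarrow>
    (\<integral>\<^sup>+x. ennreal_powr (M \<sigma> h x) p \<partial>lborel) \<le> ennreal C' * (\<integral>\<^sup>+x. ennreal (h x powr p) \<partial>lborel))" for \<sigma> C'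
  have "\<exists>C'. P \<sigma> C'" for \<sigma>
    unfolding P_def M_def by (rule grid_pair.maximal_bound[OF gp])
  then obtain C' where C': "\<And>\<sigma>. P \<sigma> (C' \<sigma>)" by metis
  define N where "N = real CARD('n \<Rightarrow> bool)"
  define K where "K = (6 ^ CARD('n)) powr p * (N powr p * (\<Sum>\<sigma>\<in>UNIV. C' \<sigma>))"
  have K: "0 \<le> K" using C' by (auto simp: K_def P_def intro!: mult_nonneg_nonneg sum_nonneg)
  show ?thesis
  proof (rule exI[of _ K], intro conjI allI impI, rule K)
    fix h :: "real^'n \<Rightarrow> real"
    assume h: "h \<in> borel_measurable borel" "\<forall>x. 0 \<le> h x" "(\<integral>\<^sup>+x. ennreal (h x powr p) \<partial>lborel) < top"
    define g where "g x = ennreal (6 ^ CARD('n)) * (\<Sum>\<sigma>\<in>UNIV. M \<sigma> h x)" for x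
    have [measurable]: "M \<sigma> h \<in> borel_measurable borel" for \<sigma>
      unfolding M_def by (rule grid_pair.maximal_measurable[OF gp h(1)])
    have g_meas: "g \<in> borel_measurable borel" unfolding g_def by measurable
    have "(\<integral>\<^sup>+x. ennreal_powr (g x) p \<partial>lborel) \<le> (\<integral>\<^sup>+x. ennreal ((6 ^ CARD('n)) powr p) * (ennreal (N powr p) * (\<Sum>\<sigma>\<in>UNIV. ennreal_powr (M \<sigma> h x) p)) \<partial>lborel)"
      unfolding g_def ennreal_powr_mult ennreal_powr_ennreal[OF zero_le_power[OF zero_le_numeral]] N_def
      using p by (intro nn_integral_mono mult_left_mono ennreal_powr_sum_le) auto
    also have "\<dots> = ennreal ((6 ^ CARD('n)) powr p) * (ennreal (N powr p) * (\<Sum>\<sigma>\<in>UNIV. \<integral>\<^sup>+x. ennreal_powr (M \<sigma> h x) p \<partial>lborel))"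
      by (simp add: nn_integral_cmult nn_integral_sum)
    also have "\<dots> \<le> ennreal ((6 ^ CARD('n)) powr p) * (ennreal (N powr p) * (\<Sum>\<sigma>\<in>UNIV. ennreal (C' \<sigma>) * (\<integral>\<^sup>+x. ennreal (h x powr p) \<partial>lborel)))"
      using C' h by (intro mult_left_mono sum_mono) (auto simp: P_def)
    also have "\<dots> = ennreal K * (\<integral>\<^sup>+x. ennreal (h x powr p) \<partial>lborel)"
    proof -
      have "(\<Sum>\<sigma>\<in>UNIV. ennreal (C' \<sigma>)) = ennreal (\<Sum>\<sigma>\<in>UNIV. C' \<sigma>)" and "0 \<le> (\<Sum>\<sigma>\<in>UNIV. C' \<sigma>)"
        using C' by (auto simp: P_def intro!: sum_ennreal sum_nonneg)
      then show ?thesis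
        by (simp add: K_def ennreal_mult mult.assoc flip: sum_distrib_right)
    qed
    finally have norm: "(\<integral>\<^sup>+x. ennreal_powr (g x) p \<partial>lborel) \<le> ennreal K * (\<integral>\<^sup>+x. ennreal (h x powr p) \<partial>lborel)" .
    have "average Q (\<lambda>y. ennreal (op_norm (A x ** B y) * h y)) \<le> g x" if Q: "Q \<in> cubes" "x \<in> Q" for Q x
    proof -
      obtain \<sigma> k z where R: "Q \<subseteq> grid_cell \<sigma> k z" "emeasure lborel (grid_cell \<sigma> k z) \<le> ennreal (6 ^ CARD('n)) * emeasure lborel Q"
        using cube_subset_cell[OF Q(1)] by blast
      interpret grid_pair "grid_cell \<sigma>" "2 ^ CARD('n)" A B p q C by (rule gp)
      have "average Q (\<lambda>y. ennreal (op_norm (A x ** B y) * h y)) \<le>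
        ennreal (6 ^ CARD('n)) * average (grid_cell \<sigma> k z) (\<lambda>y. ennreal (op_norm (A x ** B y) * h y))"
        by (intro average_le_of_subset R avg_set_cube avg_set_cell Q) simp
      also have "average (grid_cell \<sigma> k z) (\<lambda>y. ennreal (op_norm (A x ** B y) * h y)) =
        average (grid_cell \<sigma> k z) (\<lambda>y. ennreal (op_norm (A x ** B y) * h y)) * indicator (grid_cell \<sigma> k z) x"
        using Q R by auto
      also have "\<dots> \<le> M \<sigma> h x"
        unfolding M_def maximal_def by (rule SUP_upper) simp
      also have "M \<sigma> h x \<le> (\<Sum>\<sigma>\<in>UNIV. M \<sigma> h x)" by (rule member_le_sum) auto
      finally show ?thesis by (simp add: g_def mult_left_mono)
    qed
    then show "\<exists>g. g \<in> borel_measurable borel \<and>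
      (\<integral>\<^sup>+x. ennreal_powr (g x) p \<partial>lborel) \<le> ennreal K * (\<integral>\<^sup>+x. ennreal (h x powr p) \<partial>lborel) \<and>
      (\<forall>Q\<in>cubes. \<forall>x\<in>Q. average Q (\<lambda>y. ennreal (op_norm (A x ** B y) * h y)) \<le> g x)"
      using g_meas norm by blast
  qed
qed

definition scalar_multiplier :: "(real^'n \<Rightarrow> real) \<Rightarrow> real \<Rightarrow> bool" where
  "scalar_multiplier t C \<longleftrightarrow> t \<in> borel_measurable borel \<and> (\<forall>x. 0 < t x) \<and>
    (AE x in lborel. \<forall>Q\<in>cubes. x \<in> Q \<longrightarrow>
      average Q (\<lambda>y. ennreal (op_norm (A x ** B y) * t y)) \<le> ennreal (C * t x) \<and>
      average Q (\<lambda>y. ennreal (op_norm (B x ** A y) * t y powr (p - 1))) \<le> ennreal (C * t x powr (p - 1)))"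

lemma scalar_multiplier_ge_2:
  assumes "2 \<le> p" and C: "0 \<le> C" and bound: "\<forall>Q\<in>cubes. Ap_bound A B p q C Q"
  shows "\<exists>t C. scalar_multiplier t C"
proof -
  interpret dual: matrix_pair B A q p by (rule swap)
  \<comment> \<open>The iteration asks for \<theta> >= 1, whence p >= 2. As \<theta> q = p, the
    operator with kernel |B(x) A(y)|, bounded on L^q, can act on h^\<theta>, and the \<theta>-th
    root of the result lies in L^p.\<close>
  define \<theta> where "\<theta> = p - 1"
  have \<theta>: "1 \<le> \<theta>" "\<theta> * q = p" "1 / \<theta> * p = q"
    using assms(1) q_div_p(6) p by (auto simp: \<theta>_def mult.commute) (simp add: field_simps)
  obtain K1 where K1: "0 \<le> K1" and M1: "\<forall>h. h \<in> borel_measurable borel \<longrightarrow> (\<forall>x. 0 \<le> h x) \<longrightarrow> (\<integral>\<^sup>+x. ennreal (h x powr p) \<partial>lborel) < top \<longrightarrow>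
    (\<exists>g. g \<in> borel_measurable borel \<and>
      (\<integral>\<^sup>+x. ennreal_powr (g x) p \<partial>lborel) \<le> ennreal K1 * (\<integral>\<^sup>+x. ennreal (h x powr p) \<partial>lborel) \<and>
      (\<forall>Q\<in>cubes. \<forall>x\<in>Q. average Q (\<lambda>y. ennreal (op_norm (A x ** B y) * h y)) \<le> g x))"
    using cube_maximal[OF C bound] by (elim exE conjE) (rule that)
  have dual_C: "0 \<le> dual_const C"
    using C by (simp add: dual_const_def domination_const_def)
  have dual_cubes: "\<forall>Q\<in>cubes. Ap_bound B A q p (dual_const C) Q"
    using bound by (auto intro!: dual_bound avg_set_cube C)
  obtain K2 where K2: "0 \<le> K2" and M2: "\<forall>h. h \<in> borel_measurable borel \<longrightarrow> (\<forall>x. 0 \<le> h x) \<longrightarrow> (\<integral>\<^sup>+x. ennreal (h x powr q) \<partial>lborel) < top \<longrightarrow>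
    (\<exists>g. g \<in> borel_measurable borel \<and>
      (\<integral>\<^sup>+x. ennreal_powr (g x) q \<partial>lborel) \<le> ennreal K2 * (\<integral>\<^sup>+x. ennreal (h x powr q) \<partial>lborel) \<and>
      (\<forall>Q\<in>cubes. \<forall>x\<in>Q. average Q (\<lambda>y. ennreal (op_norm (B x ** A y) * h y)) \<le> g x))"
    using dual.cube_maximal[OF dual_C dual_cubes] by (elim exE conjE) (rule that)
  define K where "K = 3 powr p * (1 + K1 + K2)"
  have "1 \<le> 3 powr p" using p by (intro ge_one_powr_ge_zero) auto
  then have K: "1 \<le> K" using K1 K2 mult_mono[of 1 "3 powr p" 1 "1 + K1 + K2"] by (simp add: K_def)
  have "\<exists>t. t \<in> borel_measurable borel \<and> (\<forall>x. 0 < t x) \<and>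
    (AE x in lborel. \<forall>Q\<in>cubes. x \<in> Q \<longrightarrow> average Q (\<lambda>y. ennreal (op_norm (A x ** B y) * t y)) \<le> ennreal (4 * K * t x) \<and>
      average Q (\<lambda>y. ennreal (op_norm (B x ** A y) * t y powr \<theta>)) \<le> ennreal ((4 * K * t x) powr \<theta>))"
  proof (rule Rubio_de_Francia[where p=p])
    show "1 \<le> p" "1 \<le> \<theta>" "1 \<le> K" using p \<theta> K by auto
    fix h :: "real^'n \<Rightarrow> real"
    assume h [measurable]: "h \<in> borel_measurable borel" and h_pos: "\<And>x. 0 < h x" and fin: "(\<integral>\<^sup>+x. ennreal (h x powr p) \<partial>lborel) < top"
    let ?I = "\<integral>\<^sup>+x. ennreal (h x powr p) \<partial>lborel"
    obtain g1 where g1 [measurable]: "g1 \<in> borel_measurable borel" and g1_norm: "(\<integral>\<^sup>+x. ennreal_powr (g1 x) p \<partial>lborel) \<le> ennreal K1 * ?I"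
      and g1_le: "\<forall>Q\<in>cubes. \<forall>x\<in>Q. average Q (\<lambda>y. ennreal (op_norm (A x ** B y) * h y)) \<le> g1 x"
      using M1[rule_format, OF h _ fin] h_pos by (auto simp: less_imp_le)
    have eq: "(h x powr \<theta>) powr q = h x powr p" for x by (simp add: powr_powr \<theta>)
    obtain g2 where g2 [measurable]: "g2 \<in> borel_measurable borel" and g2_norm: "(\<integral>\<^sup>+x. ennreal_powr (g2 x) q \<partial>lborel) \<le> ennreal K2 * ?I"
      and g2_le: "\<forall>Q\<in>cubes. \<forall>x\<in>Q. average Q (\<lambda>y. ennreal (op_norm (B x ** A y) * h y powr \<theta>)) \<le> g2 x"
      using M2[rule_format, of "\<lambda>x. h x powr \<theta>"] fin unfolding eq by auto
    have g1_fin: "AE x in lborel. g1 x \<noteq> top"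
    proof -
      have "(\<integral>\<^sup>+x. ennreal_powr (g1 x) p \<partial>lborel) \<noteq> \<infinity>"
        using g1_norm fin by (auto simp: less_top ennreal_mult_less_top intro: le_less_trans)
      then have "AE x in lborel. ennreal_powr (g1 x) p \<noteq> \<infinity>" by (intro nn_integral_PInf_AE) auto
      then show ?thesis by simp
    qed
    have g2_fin: "AE x in lborel. g2 x \<noteq> top"
    proof -
      have "(\<integral>\<^sup>+x. ennreal_powr (g2 x) q \<partial>lborel) \<noteq> \<infinity>"
        using g2_norm fin by (auto simp: less_top ennreal_mult_less_top intro: le_less_trans)
      then have "AE x in lborel. ennreal_powr (g2 x) q \<noteq> \<infinity>" by (intro nn_integral_PInf_AE) auto
      then show ?thesis by simp
    qed
    \<comment> \<open>One step adds both maximal functions to \<open>h\<close>; the three summands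
      produce the 3^p in \<open>K\<close>. Infinite values, which \<open>enn2real\<close> sends to
      0, occur on a null set only.\<close>
    define h' where "h' x = h x + enn2real (g1 x) + enn2real (g2 x) powr (1 / \<theta>)" for x
    have h'_meas: "h' \<in> borel_measurable borel" unfolding h'_def by measurable
    have h_h': "h x \<le> h' x" for x by (simp add: h'_def)
    have pointwise: "ennreal (h' x powr p) \<le> ennreal (3 powr p) * (ennreal (h x powr p) + ennreal_powr (g1 x) p + ennreal_powr (g2 x) q)" for x
    proof -
      have real_le: "ennreal (enn2real u powr r) \<le> ennreal_powr u r" for u r
        by (cases u) (auto simp: ennreal_powr_ennreal)
      define f where "f i = (if i = 0 then h x else if i = 1 then enn2real (g1 x) else enn2real (g2 x) powr (1 / \<theta>))" for i :: nat
      have three: "{..<3::nat} = {0, 1, 2}" by auto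
      have "h' x powr p = (\<Sum>i<3. f i) powr p" by (simp add: three f_def h'_def add.assoc)
      also have "\<dots> \<le> real (card {..<3::nat}) powr p * (\<Sum>i<3. f i powr p)"
        using p h_pos by (intro powr_sum_le) (auto simp: f_def less_imp_le)
      also have "\<dots> = 3 powr p * (h x powr p + enn2real (g1 x) powr p + enn2real (g2 x) powr q)"
        using \<theta>(3) by (simp add: three f_def add.assoc powr_powr)
      finally have "ennreal (h' x powr p) \<le> ennreal (3 powr p * (h x powr p + enn2real (g1 x) powr p + enn2real (g2 x) powr q))"
        by (rule ennreal_leI)
      also have "\<dots> = ennreal (3 powr p) * (ennreal (h x powr p) + ennreal (enn2real (g1 x) powr p) + ennreal (enn2real (g2 x) powr q))"
        by (simp add: ennreal_mult)
      also have "\<dots> \<le> ennreal (3 powr p) * (ennreal (h x powr p) + ennreal_powr (g1 x) p + ennreal_powr (g2 x) q)"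
        by (intro mult_left_mono add_mono real_le) auto
      finally show ?thesis .
    qed
    have "(\<integral>\<^sup>+x. ennreal (h' x powr p) \<partial>lborel) \<le> (\<integral>\<^sup>+x. ennreal (3 powr p) * (ennreal (h x powr p) + ennreal_powr (g1 x) p + ennreal_powr (g2 x) q) \<partial>lborel)"
      by (intro nn_integral_mono pointwise)
    also have "\<dots> = ennreal (3 powr p) * (?I + (\<integral>\<^sup>+x. ennreal_powr (g1 x) p \<partial>lborel) + (\<integral>\<^sup>+x. ennreal_powr (g2 x) q \<partial>lborel))"
      by (simp add: nn_integral_cmult nn_integral_add)
    also have "\<dots> \<le> ennreal (3 powr p) * (?I + ennreal K1 * ?I + ennreal K2 * ?I)"
      by (intro mult_left_mono add_mono g1_norm g2_norm) auto
    also have "\<dots> = ennreal K * ?I"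
      using K1 K2 by (simp add: K_def ennreal_mult distrib_right mult.assoc)
    finally have norm: "(\<integral>\<^sup>+x. ennreal (h' x powr p) \<partial>lborel) \<le> ennreal K * ?I" .
    have "AE x in lborel. \<forall>Q\<in>cubes. x \<in> Q \<longrightarrow> average Q (\<lambda>y. ennreal (op_norm (A x ** B y) * h y)) \<le> ennreal (h' x) \<and>
          average Q (\<lambda>y. ennreal (op_norm (B x ** A y) * h y powr \<theta>)) \<le> ennreal (h' x powr \<theta>)"
      using g1_fin g2_fin
    proof (eventually_elim, intro ballI impI conjI)
      fix x Q assume x: "g1 x \<noteq> top" "g2 x \<noteq> top" and Q: "Q \<in> cubes" "x \<in> Q"
      have "average Q (\<lambda>y. ennreal (op_norm (A x ** B y) * h y)) \<le> g1 x" using g1_le Q by blast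
      also have "g1 x = ennreal (enn2real (g1 x))" using x by (simp add: less_top)
      also have "\<dots> \<le> ennreal (h' x)" using h_pos[of x] by (intro ennreal_leI) (simp add: h'_def)
      finally show "average Q (\<lambda>y. ennreal (op_norm (A x ** B y) * h y)) \<le> ennreal (h' x)" .
      have "average Q (\<lambda>y. ennreal (op_norm (B x ** A y) * h y powr \<theta>)) \<le> g2 x" using g2_le Q by blast
      also have "g2 x = ennreal ((enn2real (g2 x) powr (1 / \<theta>)) powr \<theta>)" using x \<theta> by (simp add: less_top powr_powr)
      also have "\<dots> \<le> ennreal (h' x powr \<theta>)"
        using h_pos[of x] \<theta> by (intro ennreal_leI powr_mono2) (auto simp: h'_def)
      finally show "average Q (\<lambda>y. ennreal (op_norm (B x ** A y) * h y powr \<theta>)) \<le> ennreal (h' x powr \<theta>)" .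
    qed
    then show "\<exists>h'. h' \<in> borel_measurable borel \<and> (\<forall>x. h x \<le> h' x) \<and>
        (\<integral>\<^sup>+x. ennreal (h' x powr p) \<partial>lborel) \<le> ennreal K * ?I \<and>
        (AE x in lborel. \<forall>Q\<in>cubes. x \<in> Q \<longrightarrow> average Q (\<lambda>y. ennreal (op_norm (A x ** B y) * h y)) \<le> ennreal (h' x) \<and>
          average Q (\<lambda>y. ennreal (op_norm (B x ** A y) * h y powr \<theta>)) \<le> ennreal (h' x powr \<theta>))"
      using h'_meas h_h' norm by blast
  qed (auto simp: avg_set_cube)
  then obtain t where t: "t \<in> borel_measurable borel" "\<forall>x. 0 < t x"
    "AE x in lborel. \<forall>Q\<in>cubes. x \<in> Q \<longrightarrow> average Q (\<lambda>y. ennreal (op_norm (A x ** B y) * t y)) \<le> ennreal (4 * K * t x) \<and>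
      average Q (\<lambda>y. ennreal (op_norm (B x ** A y) * t y powr \<theta>)) \<le> ennreal ((4 * K * t x) powr \<theta>)"
    by blast
  define D where "D = max (4 * K) ((4 * K) powr \<theta>)"
  have D: "ennreal (4 * K * t x) \<le> ennreal (D * t x)" "ennreal ((4 * K * t x) powr \<theta>) \<le> ennreal (D * t x powr \<theta>)" for x
    using t(2)[rule_format, of x] by (auto simp: D_def powr_mult intro!: ennreal_leI mult_right_mono)
  have "AE x in lborel. \<forall>Q\<in>cubes. x \<in> Q \<longrightarrow> average Q (\<lambda>y. ennreal (op_norm (A x ** B y) * t y)) \<le> ennreal (D * t x) \<and>
      average Q (\<lambda>y. ennreal (op_norm (B x ** A y) * t y powr \<theta>)) \<le> ennreal (D * t x powr \<theta>)"
    using t(3) by eventually_elim (blast intro: order_trans[OF _ D(1)] order_trans[OF _ D(2)])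
  then have "scalar_multiplier t D" using t(1,2) by (simp add: scalar_multiplier_def \<theta>_def)
  then show ?thesis by blast
qed

text \<open>For p < 2 the conjugate exponent is at least 2 and the pair is exchanged. A multiplier
  \<open>u\<close> of the dual pair gives t = u^(q-1): since (p - 1) (q - 1) = 1, the power t^(p-1)
  is \<open>u\<close> again, and the two inequalities trade places.\<close>

lemma scalar_multiplier_exists:
  assumes C: "0 \<le> C" and bound: "\<forall>Q\<in>cubes. Ap_bound A B p q C Q"
  shows "\<exists>t C. scalar_multiplier t C"
proof (cases "2 \<le> p")
  case True
  then show ?thesis by (rule scalar_multiplier_ge_2[OF _ C bound])
next
  case False
  interpret dual: matrix_pair B A q p by (rule swap)
  have pq1: "(p - 1) * (q - 1) = 1" using q_div_p(5) by (simp add: algebra_simps)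
  have "2 \<le> q"
  proof (rule ccontr)
    assume "\<not> 2 \<le> q"
    then have "(p - 1) * (q - 1) < 1 * 1" using False p q by (intro mult_strict_mono) auto
    then show False using pq1 by simp
  qed
  moreover have "0 \<le> dual_const C"
    using C by (simp add: dual_const_def domination_const_def)
  moreover have "\<forall>Q\<in>cubes. Ap_bound B A q p (dual_const C) Q"
    using bound by (auto intro!: dual_bound avg_set_cube C)
  ultimately obtain u D where u: "dual.scalar_multiplier u D"
    using dual.scalar_multiplier_ge_2 by blast
  then have u_pos: "0 < u x" for x by (simp add: dual.scalar_multiplier_def)
  have powr_u: "(u x powr (q - 1)) powr (p - 1) = u x" for x
    using u_pos[of x] pq1 by (simp add: powr_powr mult.commute)
  have "scalar_multiplier (\<lambda>x. u x powr (q - 1)) D"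
    unfolding scalar_multiplier_def powr_u
  proof (intro conjI allI)
    show "(\<lambda>x. u x powr (q - 1)) \<in> borel_measurable borel"
      using u by (auto simp: dual.scalar_multiplier_def)
    show "AE x in lborel. \<forall>Q\<in>cubes. x \<in> Q \<longrightarrow>
      average Q (\<lambda>y. ennreal (op_norm (A x ** B y) * u y powr (q - 1))) \<le> ennreal (D * u x powr (q - 1)) \<and>
      average Q (\<lambda>y. ennreal (op_norm (B x ** A y) * u y)) \<le> ennreal (D * u x)"
      using u unfolding dual.scalar_multiplier_def by (auto elim!: eventually_mono)
    show "0 < u x powr (q - 1)" for x
      using u_pos[of x] by simp
  qed
  then show ?thesis by blast
qed

end

section \<open>Simultaneous diagonalization and interpolation\<close>

lemma inner_symmetric_matrix:
  fixes A :: "real^'d^'d"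
  assumes "transpose A = A"
  shows "v \<bullet> (A *v w) = (A *v v) \<bullet> w"
  using dot_lmul_matrix[of v A w] assms by (metis vector_transpose_matrix)

text \<open>A maximiser \<open>v\<close> of the quadratic form on the unit sphere of
  \<open>S\<close> is an eigenvector, since otherwise the residual z = A v - \<nu> v would be a
  direction of first-order increase. Working in an invariant subspace lets the argument be repeated
  in orthogonal complements and eigenspaces.\<close>

lemma maximal_eigenvector:
  fixes A :: "real^'d^'d"
  assumes A: "transpose A = A" and S: "subspace S" "S \<noteq> {0}" and inv: "\<And>v. v \<in> S \<Longrightarrow> A *v v \<in> S"
  shows "\<exists>v\<in>S. \<exists>\<nu>. norm v = 1 \<and> A *v v = \<nu> *\<^sub>R v \<and> (\<forall>w\<in>S. w \<bullet> (A *v w) \<le> \<nu> * (w \<bullet> w))"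
proof -
  obtain u where u: "u \<in> S" "u \<noteq> 0" using S subspace_0 by blast
  define T where "T = S \<inter> sphere 0 1"
  have "(1 / norm u) *\<^sub>R u \<in> T" using u S by (simp add: T_def subspace_scale)
  moreover have "compact T" unfolding T_def using closed_subspace[OF S(1)] by (intro closed_Int_compact) auto
  moreover have "continuous_on T (\<lambda>v. v \<bullet> (A *v v))"
    by (intro continuous_intros linear_continuous_on linear_linear[THEN iffD2] matrix_vector_mul_linear)
  ultimately obtain v where v: "v \<in> T" and max: "\<And>w. w \<in> T \<Longrightarrow> w \<bullet> (A *v w) \<le> v \<bullet> (A *v v)"
    using continuous_attains_sup[of T "\<lambda>v. v \<bullet> (A *v v)"] by blast
  define \<nu> where "\<nu> = v \<bullet> (A *v v)"
  have v1: "v \<in> S" "norm v = 1" "v \<bullet> v = 1" using v by (auto simp: T_def norm_eq_1)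
  have bound: "w \<bullet> (A *v w) \<le> \<nu> * (w \<bullet> w)" if "w \<in> S" for w
  proof (cases "w = 0")
    case False
    have "(1 / norm w) *\<^sub>R w \<in> T" using False that S by (simp add: T_def subspace_scale)
    from max[OF this] have "(1 / norm w) * ((1 / norm w) * (w \<bullet> (A *v w))) \<le> \<nu>"
      by (simp add: \<nu>_def linear_scale[OF matrix_vector_mul_linear])
    then show ?thesis
      using False by (simp add: field_simps dot_square_norm power2_eq_square)
  qed simp
  define z where "z = A *v v - \<nu> *\<^sub>R v"
  have z: "z \<in> S" using v1 inv S by (simp add: z_def subspace_diff subspace_scale)
  have zv: "z \<bullet> v = 0" using v1 by (simp add: z_def inner_diff_left inner_diff_right \<nu>_def inner_commute)
  have zAv: "z \<bullet> (A *v v) = z \<bullet> z"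
  proof -
    have "A *v v = z + \<nu> *\<^sub>R v" by (simp add: z_def)
    then show ?thesis using zv by (simp add: inner_add_right)
  qed
  have "z = 0"
  proof (rule ccontr)
    assume "z \<noteq> 0"
    define n where "n = z \<bullet> z"
    define c where "c = z \<bullet> (A *v z) - \<nu> * n"
    have n: "0 < n" using \<open>z \<noteq> 0\<close> by (simp add: n_def)
    have quad: "2 * s * n + s\<^sup>2 * c \<le> 0" for s
    proof -
      have "v + s *\<^sub>R z \<in> S" using v1 z S by (simp add: subspace_add subspace_scale)
      from bound[OF this] have ineq: "(v + s *\<^sub>R z) \<bullet> (A *v v + s *\<^sub>R (A *v z)) \<le> \<nu> * ((v + s *\<^sub>R z) \<bullet> (v + s *\<^sub>R z))"
        by (simp add: linear_add[OF matrix_vector_mul_linear] linear_scale[OF matrix_vector_mul_linear])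
      have e1: "(v + s *\<^sub>R z) \<bullet> (A *v v + s *\<^sub>R (A *v z)) = \<nu> + 2 * s * n + s\<^sup>2 * (z \<bullet> (A *v z))"
        using zAv inner_symmetric_matrix[OF A, of v z]
        by (simp add: inner_add_left inner_add_right \<nu>_def n_def inner_commute power2_eq_square algebra_simps)
      have e2: "(v + s *\<^sub>R z) \<bullet> (v + s *\<^sub>R z) = 1 + s\<^sup>2 * n"
        using zv v1 by (simp add: inner_add_left inner_add_right n_def inner_commute power2_eq_square)
      show ?thesis using ineq unfolding e1 e2 by (simp add: c_def algebra_simps)
    qed
    \<comment> \<open>Small enough that |s c| is at most \<open>n\<close>, so that it cannot
      compensate the linear term 2 n.\<close>
    define s where "s = n / (\<bar>c\<bar> + 1)"
    have s: "0 < s" using n by (simp add: s_def)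
    have "s * (2 * n + s * c) \<le> 0" using quad[of s] by (simp add: algebra_simps power2_eq_square)
    then have "2 * n + s * c \<le> 0" using s by (simp add: mult_le_0_iff)
    moreover have "\<bar>s * c\<bar> \<le> n"
      using n by (simp add: s_def abs_mult field_simps)
    ultimately show False using n by linarith
  qed
  then have "A *v v = \<nu> *\<^sub>R v" by (simp add: z_def)
  then show ?thesis using v1 bound by blast
qed

section \<open>Matrices diagonal in a given orthonormal basis\<close>

definition conj_diag :: "real^'d^'d \<Rightarrow> real^'d \<Rightarrow> real^'d^'d" where
  "conj_diag P l = P ** diag_matrix l ** transpose P"

lemma orthogonal_matrixD:
  assumes "orthogonal_matrix P"
  shows "transpose P ** P = mat 1" "P ** transpose P = mat 1"
  using assms by (auto simp: orthogonal_matrix_def)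

lemma diag_matrix_mult: "diag_matrix l ** diag_matrix m = diag_matrix (\<chi> i. l $ i * m $ i)"
  by (simp add: vec_eq_iff diag_matrix_mult_left) (simp add: diag_matrix_def)

lemma conj_diag_mult:
  assumes "orthogonal_matrix P"
  shows "conj_diag P l ** conj_diag P m = conj_diag P (\<chi> i. l $ i * m $ i)"
proof -
  have "conj_diag P l ** conj_diag P m = P ** diag_matrix l ** (transpose P ** P) ** diag_matrix m ** transpose P"
    by (simp only: conj_diag_def matrix_mul_assoc)
  also have "\<dots> = P ** (diag_matrix l ** diag_matrix m) ** transpose P"
    by (simp add: orthogonal_matrixD[OF assms] matrix_mul_assoc)
  finally show ?thesis by (simp add: diag_matrix_mult conj_diag_def)
qed

lemma transpose_diag_matrix: "transpose (diag_matrix l) = diag_matrix l"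
  by (simp add: vec_eq_iff transpose_def diag_matrix_def)

lemma conj_diag_symmetric: "transpose (conj_diag P l) = conj_diag P l"
  by (simp add: conj_diag_def matrix_transpose_mul matrix_mul_assoc transpose_diag_matrix)

lemma conj_diag_1:
  assumes "orthogonal_matrix P"
  shows "conj_diag P (\<chi> i. 1) = mat 1"
proof -
  have "diag_matrix (\<chi> i. 1) = (mat 1 :: real^'a^'a)" by (simp add: diag_matrix_def mat_def vec_eq_iff)
  then show ?thesis by (simp add: conj_diag_def orthogonal_matrixD[OF assms])
qed

lemma matrix_inv_unique:
  fixes A :: "real^'d^'d"
  assumes "A ** B = mat 1"
  shows "matrix_inv A = B"
proof -
  have "invertible A" using assms unfolding invertible_right_inverse by blast
  then have "matrix_inv A ** A = mat 1" by (rule matrix_inv_left)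
  then show ?thesis by (metis assms matrix_mul_assoc matrix_mul_lid matrix_mul_rid)
qed

lemma matrix_inv_conj_diag:
  assumes "orthogonal_matrix P" "\<And>i. l $ i \<noteq> 0"
  shows "matrix_inv (conj_diag P l) = conj_diag P (\<chi> i. 1 / l $ i)"
  by (rule matrix_inv_unique) (use assms in \<open>simp add: conj_diag_mult conj_diag_1\<close>)

lemma diag_matrix_axis: "diag_matrix l *v axis j 1 = l $ j *\<^sub>R axis j 1"
  unfolding matrix_vector_mult_basis by (auto simp: vec_eq_iff column_def diag_matrix_def axis_def)

lemma conj_diag_eigenvalue_pos:
  assumes P: "orthogonal_matrix P" and pd: "pd_matrix (conj_diag P l)"
  shows "0 < l $ i"
proof -
  let ?v = "P *v axis i 1"
  have v: "transpose P *v ?v = axis i 1"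
    by (simp add: matrix_vector_mul_assoc orthogonal_matrixD[OF P])
  then have "?v \<noteq> 0" by (metis axis_eq_0_iff matrix_vector_mult_0_right zero_neq_one)
  then have "0 < ?v \<bullet> (conj_diag P l *v ?v)" using pd by (simp add: pd_matrix_def)
  also have "?v \<bullet> (conj_diag P l *v ?v) = (transpose P *v ?v) \<bullet> (diag_matrix l *v (transpose P *v ?v))"
    by (metis conj_diag_def dot_lmul_matrix matrix_vector_mul_assoc vector_transpose_matrix transpose_transpose)
  also have "\<dots> = l $ i"
    unfolding v by (simp add: diag_matrix_axis inner_axis_axis)
  finally show ?thesis .
qed

lemma psd_powr_conj_diag:
  "orthogonal_matrix P \<Longrightarrow> psd_powr (conj_diag P l) s = conj_diag P (\<chi> i. l $ i powr s)"
  unfolding conj_diag_def by (rule psd_powr_eqI) auto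

text \<open>Take a largest orthonormal family of common eigenvectors. Its orthogonal complement is
  invariant under both matrices; were it nonzero, an eigenspace of \<open>A\<close> inside it would
  be invariant under \<open>B\<close> by commutation and contain one more common
  eigenvector.\<close>

lemma simultaneous_diagonalization:
  fixes A B :: "real^'d^'d"
  assumes A: "transpose A = A" and B: "transpose B = B" and comm: "A ** B = B ** A"
  shows "\<exists>P l m. orthogonal_matrix P \<and> A = conj_diag P l \<and> B = conj_diag P m"
proof -
  define eig where "eig e \<longleftrightarrow> norm e = 1 \<and> (\<exists>\<nu>. A *v e = \<nu> *\<^sub>R e) \<and> (\<exists>\<mu>. B *v e = \<mu> *\<^sub>R e)" for e :: "real^'d"
  define fam where "fam E \<longleftrightarrow> pairwise orthogonal E \<and> (\<forall>e\<in>E. eig e)" for E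
  have fam_indep: "independent E" if "fam E" for E
    using that by (intro pairwise_orthogonal_independent) (auto simp: fam_def eig_def)
  have fam_card: "finite E \<and> card E \<le> CARD('d)" if "fam E" for E
    using independent_bound[OF fam_indep[OF that]] by simp
  have "fam {}" by (simp add: fam_def)
  then have "\<exists>E. fam E \<and> (\<forall>F. fam F \<longrightarrow> card F \<le> card E)"
    using fam_card by (intro ex_has_greatest_nat[of fam "{}" card "Suc CARD('d)"]) (auto simp: less_Suc_eq_le)
  then obtain E where E: "fam E" and max: "\<And>F. fam F \<Longrightarrow> card F \<le> card E"
    by blast
  have E_fin: "finite E" using fam_card[OF E] by simp
  define S where "S = {v. \<forall>e\<in>E. e \<bullet> v = 0}"
  have S: "subspace S"
    by (auto simp: S_def subspace_def inner_add_right)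
  have S_A: "A *v v \<in> S" and S_B: "B *v v \<in> S" if "v \<in> S" for v
    using that E by (auto simp: S_def fam_def eig_def inner_symmetric_matrix[OF A] inner_symmetric_matrix[OF B])
  have "S = {0}"
  proof (rule ccontr)
    assume "S \<noteq> {0}"
    obtain v1 \<nu> where v1: "v1 \<in> S" "norm v1 = 1" "A *v v1 = \<nu> *\<^sub>R v1"
      using maximal_eigenvector[OF A S \<open>S \<noteq> {0}\<close> S_A] by blast
    define T where "T = {v \<in> S. A *v v = \<nu> *\<^sub>R v}"
    have T: "subspace T"
      using S by (auto simp: T_def subspace_def linear_add[OF matrix_vector_mul_linear] linear_scale[OF matrix_vector_mul_linear]
          scaleR_add_right)
    have "v1 \<in> T" "v1 \<noteq> 0" using v1 by (auto simp: T_def)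
    then have "T \<noteq> {0}" by auto
    have T_B: "B *v v \<in> T" if "v \<in> T" for v
    proof -
      have "A *v (B *v v) = B *v (A *v v)" by (simp add: matrix_vector_mul_assoc comm)
      then show ?thesis using that S_B by (auto simp: T_def linear_scale[OF matrix_vector_mul_linear])
    qed
    obtain v \<mu> where v: "v \<in> T" "norm v = 1" "B *v v = \<mu> *\<^sub>R v"
      using maximal_eigenvector[OF B T \<open>T \<noteq> {0}\<close> T_B] by blast
    have "v \<notin> E"
    proof
      assume "v \<in> E"
      then have "v \<bullet> v = 0" using v(1) by (auto simp: T_def S_def)
      then show False using v(2) by simp
    qed
    have "fam (insert v E)"
      using E v by (auto simp: fam_def eig_def T_def S_def pairwise_insert orthogonal_def inner_commute)
    then have "card (insert v E) \<le> card E" by (rule max)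
    then show False using \<open>v \<notin> E\<close> E_fin by simp
  qed
  have "span E = UNIV"
  proof (rule ccontr)
    assume "span E \<noteq> UNIV"
    then obtain a where a: "a \<noteq> 0" "\<And>x. x \<in> span E \<Longrightarrow> a \<bullet> x = 0"
      using span_not_UNIV_orthogonal by blast
    then have "a \<in> S" by (auto simp: S_def span_base inner_commute)
    then show False using \<open>S = {0}\<close> a by simp
  qed
  then have "card E = card (UNIV :: 'd set)"
    using dim_span_eq_card_independent[OF fam_indep[OF E]] by simp
  then obtain f where f: "bij_betw f (UNIV :: 'd set) E"
    using finite_same_card_bij[of "UNIV :: 'd set" E] E_fin by auto
  then have fE: "f i \<in> E" "i \<noteq> j \<Longrightarrow> f i \<noteq> f j" for i j
    by (auto simp: bij_betw_def inj_def)
  define P where "P = (\<chi> i j. f j $ i)"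
  have colP: "column j P = f j" for j by (simp add: P_def column_def vec_eq_iff)
  have P: "orthogonal_matrix P"
    unfolding orthogonal_matrix_orthonormal_columns colP
    using E fE by (auto simp: fam_def eig_def pairwise_def)
  have diag: "\<exists>l. M = conj_diag P l" if "\<And>e. e \<in> E \<Longrightarrow> \<exists>\<nu>. M *v e = \<nu> *\<^sub>R e" for M :: "real^'d^'d"
  proof -
    have "\<exists>\<nu>. M *v f j = \<nu> *\<^sub>R f j" for j using that fE by blast
    then obtain c where c: "\<And>j. M *v f j = c j *\<^sub>R f j" by metis
    have "(M ** P) $ i $ j = (P ** diag_matrix (\<chi> j. c j)) $ i $ j" for i j
    proof -
      have "(M ** P) $ i $ j = (M *v f j) $ i"
        by (simp add: matrix_matrix_mult_def matrix_vector_mult_def P_def)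
      then show ?thesis by (simp add: c diag_matrix_mult_right P_def)
    qed
    then have "M ** P = P ** diag_matrix (\<chi> j. c j)" by (simp add: vec_eq_iff)
    then have "M ** (P ** transpose P) = conj_diag P (\<chi> j. c j)"
      unfolding conj_diag_def by (simp only: matrix_mul_assoc)
    then show ?thesis using orthogonal_matrixD[OF P] by auto
  qed
  have "\<exists>l. A = conj_diag P l" "\<exists>m. B = conj_diag P m"
    by (rule diag; use E in \<open>auto simp: fam_def eig_def\<close>)+
  then show ?thesis using P by blast
qed

text \<open>An eigenvalue, unlike a norm, is unchanged under similarity; the midpoint inequality
  exploits this.\<close>

lemma op_norm_squared_eigenvalue:
  fixes F :: "real^'d^'d"
  shows "\<exists>v \<nu>. v \<noteq> 0 \<and> (transpose F ** F) *v v = \<nu> *\<^sub>R v \<and> (op_norm F)\<^sup>2 \<le> \<nu>"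
proof -
  have sym: "transpose (transpose F ** F) = transpose F ** F" by (simp add: matrix_transpose_mul)
  have "(UNIV :: (real^'d) set) \<noteq> {0}"
    by (metis UNIV_I axis_eq_0_iff singletonD zero_neq_one)
  then obtain v \<nu> where v: "norm v = 1" "(transpose F ** F) *v v = \<nu> *\<^sub>R v"
    and bound: "\<And>w. w \<bullet> ((transpose F ** F) *v w) \<le> \<nu> * (w \<bullet> w)"
    using maximal_eigenvector[OF sym subspace_UNIV] by auto
  have sq: "(norm (F *v w))\<^sup>2 \<le> \<nu> * (norm w)\<^sup>2" for w
  proof -
    have "(norm (F *v w))\<^sup>2 = w \<bullet> ((transpose F ** F) *v w)"
      using dot_lmul_matrix[of w "transpose F" "F *v w"]
      by (simp add: vector_transpose_matrix dot_square_norm matrix_vector_mul_assoc)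
    then show ?thesis using bound[of w] by (simp add: dot_square_norm)
  qed
  have "0 \<le> (norm (F *v v))\<^sup>2" by simp
  also have "\<dots> \<le> \<nu>" using sq[of v] v by simp
  finally have "0 \<le> \<nu>" .
  have "op_norm F \<le> sqrt \<nu>"
  proof (rule op_norm_le)
    fix w
    have "norm (F *v w) \<le> sqrt (\<nu> * (norm w)\<^sup>2)"
      using sq[of w] by (rule real_le_rsqrt)
    then show "norm (F *v w) \<le> sqrt \<nu> * norm w" by (simp add: real_sqrt_mult)
  qed
  then have "(op_norm F)\<^sup>2 \<le> (sqrt \<nu>)\<^sup>2" by (intro power_mono) auto
  then have "(op_norm F)\<^sup>2 \<le> \<nu>" using \<open>0 \<le> \<nu>\<close> by simp
  then show ?thesis using v by (intro exI[of _ v] exI[of _ \<nu>]) auto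
qed

text \<open>Midpoint log-convexity: \<open>\<parallel>F\<parallel>\<^sup>2\<close> is an eigenvalue of \<open>F\<^sup>T F\<close>, which is similar
  to \<open>(X\<^sub>t Y\<^sub>t)\<^sup>T X\<^sub>s Y\<^sub>s\<close> when \<open>X\<^sub>s X\<^sub>t\<close> and \<open>Y\<^sub>s Y\<^sub>t\<close> are the squares of the factors of \<open>F\<close>.\<close>

lemma op_norm_midpoint:
  fixes P Q :: "real^'d^'d"
  assumes P: "orthogonal_matrix P" and Q: "orthogonal_matrix Q"
    and x: "\<And>i. x $ i * x $ i = xs $ i * xt $ i" and y: "\<And>i. y $ i * y $ i = ys $ i * yt $ i"
    and pos: "\<And>i. 0 < y $ i" "\<And>i. 0 < yt $ i"
  shows "(op_norm (conj_diag P x ** conj_diag Q y))\<^sup>2 \<le>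
    op_norm (conj_diag P xs ** conj_diag Q ys) * op_norm (conj_diag P xt ** conj_diag Q yt)"
proof -
  define F where "F = conj_diag P x ** conj_diag Q y"
  define Fs where "Fs = conj_diag P xs ** conj_diag Q ys"
  define Ft where "Ft = conj_diag P xt ** conj_diag Q yt"
  obtain v \<nu> where v: "v \<noteq> 0" "(transpose F ** F) *v v = \<nu> *\<^sub>R v" "(op_norm F)\<^sup>2 \<le> \<nu>"
    using op_norm_squared_eigenvalue by blast
  \<comment> \<open>\<open>D\<close> carries the factor with eigenvalues \<open>y\<close> to the one
    with eigenvalues \<open>yt\<close>. Conjugation by it turns F^T F into Ft^T Fs, and the
    eigenvector \<open>v\<close> into D v.\<close>
  define D where "D = conj_diag Q (\<chi> i. yt $ i / y $ i)"
  define D' where "D' = conj_diag Q (\<chi> i. y $ i / yt $ i)"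
  have nz: "y $ i \<noteq> 0" "yt $ i \<noteq> 0" for i using pos[of i] by auto
  have D'D: "D' ** D = mat 1"
    unfolding D_def D'_def conj_diag_mult[OF Q] using nz by (simp add: conj_diag_1[OF Q])
  have "conj_diag P xt ** conj_diag P xs = conj_diag P x ** conj_diag P x"
    unfolding conj_diag_mult[OF P] using x by (simp add: mult.commute)
  moreover have "conj_diag Q yt = D ** conj_diag Q y"
    unfolding D_def conj_diag_mult[OF Q] using nz by simp
  moreover have "conj_diag Q ys = conj_diag Q y ** D'"
  proof -
    have "ys $ i = y $ i * (y $ i / yt $ i)" for i using y[of i] nz[of i] by (simp add: field_simps)
    then have "ys = (\<chi> i. y $ i * (y $ i / yt $ i))" by (simp add: vec_eq_iff)
    then show ?thesis unfolding D'_def conj_diag_mult[OF Q] by simp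
  qed
  ultimately have "transpose Ft ** Fs = D ** (transpose F ** F) ** D'"
    unfolding F_def Fs_def Ft_def matrix_transpose_mul conj_diag_symmetric
    by (metis matrix_mul_assoc)
  then have "(transpose Ft ** Fs) *v (D *v v) = D *v ((transpose F ** F) *v ((D' ** D) *v v))"
    by (simp add: matrix_vector_mul_assoc matrix_mul_assoc)
  also have "\<dots> = \<nu> *\<^sub>R (D *v v)"
    by (simp add: D'D v(2) linear_scale[OF matrix_vector_mul_linear])
  finally have eig: "(transpose Ft ** Fs) *v (D *v v) = \<nu> *\<^sub>R (D *v v)" .
  have "D *v v \<noteq> 0"
  proof
    assume "D *v v = 0"
    then have "D' *v (D *v v) = 0" by simp
    then show False using v(1) by (simp add: matrix_vector_mul_assoc D'D)
  qed
  moreover have "\<bar>\<nu>\<bar> * norm (D *v v) \<le> op_norm (transpose Ft ** Fs) * norm (D *v v)"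
    using norm_mult_le_op_norm[of "transpose Ft ** Fs" "D *v v"] unfolding eig by simp
  ultimately have "\<nu> \<le> op_norm (transpose Ft ** Fs)" by simp
  also have "\<dots> \<le> op_norm Fs * op_norm Ft"
    using op_norm_mult_le[of "transpose Ft" Fs] by (simp add: mult.commute)
  finally show ?thesis using v(3) by (simp add: F_def Fs_def Ft_def)
qed

section \<open>Interpolation between two exponents\<close>

lemma op_norm_conj_diag_le: "op_norm (conj_diag P l) \<le> (op_norm P)\<^sup>2 * (\<Sum>i\<in>UNIV. \<bar>l $ i\<bar>)"
proof -
  have "op_norm (diag_matrix l) \<le> (\<Sum>j\<in>UNIV. norm (diag_matrix l *v axis j 1))"
    by (rule op_norm_le_sum_columns)
  then have diag: "op_norm (diag_matrix l) \<le> (\<Sum>i\<in>UNIV. \<bar>l $ i\<bar>)"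
    by (simp add: diag_matrix_axis norm_axis_1)
  have "op_norm (conj_diag P l) \<le> op_norm (P ** diag_matrix l) * op_norm P"
    unfolding conj_diag_def using op_norm_mult_le[of "P ** diag_matrix l" "transpose P"] by simp
  also have "\<dots> \<le> (op_norm P * (\<Sum>i\<in>UNIV. \<bar>l $ i\<bar>)) * op_norm P"
    by (intro mult_right_mono order_trans[OF op_norm_mult_le] mult_left_mono diag) auto
  finally show ?thesis by (simp add: power2_eq_square mult_ac)
qed

lemma weighted_powr_le_sum:
  fixes a b :: real
  assumes "0 < a" "0 < b" "0 \<le> \<theta>" "\<theta> \<le> 1"
  shows "a powr \<theta> * b powr (1 - \<theta>) \<le> a + b"
proof -
  have "a powr \<theta> * b powr (1 - \<theta>) \<le> (a + b) powr \<theta> * (a + b) powr (1 - \<theta>)"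
    using assms by (intro mult_mono powr_mono2) auto
  also have "\<dots> = a + b" using assms by (simp flip: powr_add)
  finally show ?thesis .
qed

text \<open>The norm \<open>g\<close> is log-convex at midpoints. Dividing it by the geometric
  interpolation of its end values gives \<open>r\<close> with r(0) = r(1) = 1. Each point of [0, 1]
  is the midpoint of an end and another point of [0, 1], so r^2 <= M for the supremum
  \<open>M\<close>; hence M <= sqrt M and M <= 1. Finiteness of \<open>M\<close> is all the
  regularity this takes.\<close>

lemma op_norm_interpolation:
  fixes P Q :: "real^'d^'d"
  assumes P: "orthogonal_matrix P" and Q: "orthogonal_matrix Q"
    and a: "\<And>i. 0 < a0 $ i" "\<And>i. 0 < a1 $ i" and c: "\<And>i. 0 < c0 $ i" "\<And>i. 0 < c1 $ i"
    and \<theta>: "0 \<le> \<theta>" "\<theta> \<le> 1"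
  shows "op_norm (conj_diag P (\<chi> i. a0 $ i powr \<theta> * a1 $ i powr (1 - \<theta>)) ** conj_diag Q (\<chi> i. c0 $ i powr \<theta> * c1 $ i powr (1 - \<theta>)))
    \<le> op_norm (conj_diag P a0 ** conj_diag Q c0) powr \<theta> * op_norm (conj_diag P a1 ** conj_diag Q c1) powr (1 - \<theta>)"
proof -
  define X where "X s = (\<chi> i. a0 $ i powr s * a1 $ i powr (1 - s))" for s
  define Y where "Y s = (\<chi> i. c0 $ i powr s * c1 $ i powr (1 - s))" for s
  define g where "g s = op_norm (conj_diag P (X s) ** conj_diag Q (Y s))" for s
  have X_pos: "0 < X s $ i" and Y_pos: "0 < Y s $ i" for s i
    using a[of i] c[of i] by (auto simp: X_def Y_def)
  have g_nonneg: "0 \<le> g s" for s by (simp add: g_def)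
  have g_pos: "0 < g s" for s
  proof -
    have "invertible (conj_diag P (X s))" "invertible (conj_diag Q (Y s))"
    proof -
      have "conj_diag P (X s) ** conj_diag P (\<chi> i. 1 / X s $ i) = mat 1"
        unfolding conj_diag_mult[OF P] using X_pos[of s] by (simp add: conj_diag_1[OF P] less_imp_neq[symmetric])
      then show "invertible (conj_diag P (X s))" unfolding invertible_right_inverse by blast
      have "conj_diag Q (Y s) ** conj_diag Q (\<chi> i. 1 / Y s $ i) = mat 1"
        unfolding conj_diag_mult[OF Q] using Y_pos[of s] by (simp add: conj_diag_1[OF Q] less_imp_neq[symmetric])
      then show "invertible (conj_diag Q (Y s))" unfolding invertible_right_inverse by blast
    qed
    then have "invertible (conj_diag P (X s) ** conj_diag Q (Y s))" by (rule invertible_mult)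
    then have "conj_diag P (X s) ** conj_diag Q (Y s) \<noteq> 0"
      using mat_1_neq_0 by (auto simp: invertible_def)
    then show ?thesis by (simp add: g_def less_le)
  qed
  have square_mult: "(b * c) * (b * c) = (b * b) * (c * c)" for b c :: real
    by simp
  have mid: "(g ((s + t) / 2))\<^sup>2 \<le> g s * g t" for s t
    unfolding g_def
  proof (rule op_norm_midpoint[OF P Q])
    fix i
    have half: "b powr ((s + t) / 2) * b powr ((s + t) / 2) = b powr s * b powr t"
      "b powr (1 - (s + t) / 2) * b powr (1 - (s + t) / 2) = b powr (1 - s) * b powr (1 - t)" for b :: real
      by (simp_all flip: powr_add)
    show "X ((s + t) / 2) $ i * X ((s + t) / 2) $ i = X s $ i * X t $ i"
      unfolding X_def vec_lambda_beta square_mult half by (simp only: mult_ac)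
    show "Y ((s + t) / 2) $ i * Y ((s + t) / 2) $ i = Y s $ i * Y t $ i"
      unfolding Y_def vec_lambda_beta square_mult half by (simp only: mult_ac)
  qed (use Y_pos in auto)
  define r where "r s = g s / (g 1 powr s * g 0 powr (1 - s))" for s
  have r_nonneg: "0 \<le> r s" for s using g_nonneg by (simp add: r_def)
  have r_01: "r 0 = 1" "r 1 = 1" using g_pos[of 0] g_pos[of 1] by (simp_all add: r_def)
  have r_mid: "(r ((s + t) / 2))\<^sup>2 \<le> r s * r t" for s t
  proof -
    define D where "D s = g 1 powr s * g 0 powr (1 - s)" for s
    have D: "0 < D s" for s using g_pos by (simp add: D_def less_imp_neq[symmetric])
    have "(D ((s + t) / 2))\<^sup>2 = D s * D t"
    proof -
      have half: "b powr ((s + t) / 2) * b powr ((s + t) / 2) = b powr s * b powr t"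
        "b powr (1 - (s + t) / 2) * b powr (1 - (s + t) / 2) = b powr (1 - s) * b powr (1 - t)" for b :: real
        by (simp_all flip: powr_add)
      show ?thesis
        unfolding D_def power2_eq_square square_mult half by (simp only: mult_ac)
    qed
    then have "(r ((s + t) / 2))\<^sup>2 = (g ((s + t) / 2))\<^sup>2 / (D s * D t)"
      by (simp add: r_def D_def power_divide)
    also have "\<dots> \<le> (g s * g t) / (D s * D t)"
      using mid[of s t] D by (intro divide_right_mono) (auto simp: less_imp_le)
    finally show ?thesis by (simp add: r_def D_def)
  qed
  define M where "M = (SUP s\<in>{0..1}. r s)"
  \<comment> \<open>Eigenvalues of the interpolated factors stay below the sum of their end values,
    and the denominator of \<open>r\<close> stays above the smaller of g(0) and g(1).\<close>
  have bdd: "bdd_above (r ` {0..1})"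
  proof -
    define m where "m = min (g 1) (g 0)"
    have m: "0 < m" using g_pos by (simp add: m_def)
    define G where "G = ((op_norm P)\<^sup>2 * (\<Sum>i\<in>UNIV. a0 $ i + a1 $ i)) * ((op_norm Q)\<^sup>2 * (\<Sum>i\<in>UNIV. c0 $ i + c1 $ i))"
    have "r s \<le> G / m" if s: "0 \<le> s" "s \<le> 1" for s
    proof -
      have "op_norm (conj_diag P (X s)) \<le> (op_norm P)\<^sup>2 * (\<Sum>i\<in>UNIV. a0 $ i + a1 $ i)"
        using X_pos[of s] a s
        by (intro order_trans[OF op_norm_conj_diag_le] mult_left_mono sum_mono)
          (auto simp: X_def abs_mult intro!: weighted_powr_le_sum)
      moreover have "op_norm (conj_diag Q (Y s)) \<le> (op_norm Q)\<^sup>2 * (\<Sum>i\<in>UNIV. c0 $ i + c1 $ i)"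
        using Y_pos[of s] c s
        by (intro order_trans[OF op_norm_conj_diag_le] mult_left_mono sum_mono)
          (auto simp: Y_def abs_mult intro!: weighted_powr_le_sum)
      ultimately have gG: "g s \<le> G"
        unfolding g_def G_def by (intro order_trans[OF op_norm_mult_le] mult_mono) (auto intro: order_trans[OF op_norm_nonneg])
      have "m powr s * m powr (1 - s) \<le> g 1 powr s * g 0 powr (1 - s)"
        using m s by (intro mult_mono powr_mono2) (auto simp: m_def)
      moreover have "m powr s * m powr (1 - s) = m" using m by (simp flip: powr_add)
      ultimately have mD: "m \<le> g 1 powr s * g 0 powr (1 - s)" by simp
      show ?thesis unfolding r_def using gG mD m g_nonneg by (intro frac_le) (auto intro: order_trans)
    qed
    then show ?thesis by (intro bdd_aboveI[of _ "G / m"]) auto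
  qed
  have r_M: "r s \<le> M" if "0 \<le> s" "s \<le> 1" for s
    unfolding M_def using that by (intro cSUP_upper bdd) auto
  have sq: "(r s)\<^sup>2 \<le> M" if s: "0 \<le> s" "s \<le> 1" for s
  proof (cases "s \<le> 1 / 2")
    case True
    then show ?thesis using r_mid[of 0 "2 * s"] r_M[of "2 * s"] s r_01 by simp
  next
    case False
    then show ?thesis using r_mid[of "2 * s - 1" 1] r_M[of "2 * s - 1"] s r_01 by simp
  qed
  have "1 \<le> M" using r_M[of 0] r_01 by simp
  have "M \<le> sqrt M"
    unfolding M_def
  proof (rule cSUP_least)
    show "r s \<le> sqrt (SUP s\<in>{0..1}. r s)" if "s \<in> {0..1}" for s
      using sq[of s] that unfolding M_def[symmetric] by (intro real_le_rsqrt) auto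
  qed simp
  then have "M\<^sup>2 \<le> (sqrt M)\<^sup>2" using \<open>1 \<le> M\<close> by (intro power_mono) auto
  then have "M \<le> 1" using \<open>1 \<le> M\<close> by (simp add: power2_eq_square)
  then have "r \<theta> \<le> 1" using r_M[OF \<theta>] by simp
  then have "g \<theta> \<le> g 1 powr \<theta> * g 0 powr (1 - \<theta>)"
    using g_pos[of 0] g_pos[of 1] by (simp add: r_def divide_le_eq)
  moreover have "X 1 = a0" "X 0 = a1" "Y 1 = c0" "Y 0 = c1"
    using a c by (auto simp: X_def Y_def vec_eq_iff less_imp_neq[symmetric] less_imp_le)
  ultimately show ?thesis by (simp add: g_def X_def Y_def)
qed

section \<open>Factorization\<close>

lemma cube_lborel: "Q \<in> cubes \<Longrightarrow> Q \<in> sets borel"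
  using avg_set_cube by (auto simp: avg_set_def)

text \<open>Passes to a Borel representative and trades the supremum of p-th roots for one real
  constant; almost everywhere equality is enough in the inner and in the outer average.\<close>

lemma Ap_characteristic_less_top_iff:
  fixes W A :: "real^'n \<Rightarrow> real^'d^'d"
  assumes W: "AE x in lborel. W x = A x" and p: "1 < p" and q: "q = conj_exponent p"
  shows "Ap_characteristic p W < \<infinity> \<longleftrightarrow> (\<exists>C\<ge>0. \<forall>Q\<in>cubes. Ap_bound A (\<lambda>x. matrix_inv (A x)) p q C Q)"
proof -
  define I where "I Q = average Q (\<lambda>x. ennreal_powr (average Q (\<lambda>y. ennreal (op_norm (A x ** matrix_inv (A y)) powr q))) (p / q))" for Q
  have "average Q (\<lambda>x. ennreal_powr (average Q (\<lambda>y. ennreal (op_norm (W x ** matrix_inv (W y)) powr q))) (p / q)) = I Q"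
    if "Q \<in> cubes" for Q
  proof -
    have Q: "avg_set Q" by (rule avg_set_cube[OF that])
    have inner: "average Q (\<lambda>y. ennreal (op_norm (M ** matrix_inv (W y)) powr q)) = average Q (\<lambda>y. ennreal (op_norm (M ** matrix_inv (A y)) powr q))" for M
      using W by (intro average_cong_AE[OF Q]) (auto elim!: eventually_mono)
    show ?thesis
      unfolding I_def inner using W by (intro average_cong_AE[OF Q]) (auto elim!: eventually_mono)
  qed
  then have char: "Ap_characteristic p W = (SUP Q\<in>cubes. ennreal_powr (I Q) (1 / p))"
    unfolding Ap_characteristic_def q[symmetric] by (intro SUP_cong) auto
  show ?thesis
  proof
    assume "Ap_characteristic p W < \<infinity>"
    then obtain K where K: "Ap_characteristic p W = ennreal K" "0 \<le> K"
      by (cases "Ap_characteristic p W") auto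
    have "I Q \<le> ennreal (K powr p)" if "Q \<in> cubes" for Q
    proof -
      have "ennreal_powr (I Q) (1 / p) \<le> ennreal K"
        unfolding K(1)[symmetric] char using that by (rule SUP_upper)
      then have "I Q \<le> ennreal_powr (ennreal K) p" using p by (simp add: ennreal_powr_le_iff)
      then show ?thesis using K by (simp add: ennreal_powr_ennreal)
    qed
    then show "\<exists>C\<ge>0. \<forall>Q\<in>cubes. Ap_bound A (\<lambda>x. matrix_inv (A x)) p q C Q"
      by (intro exI[of _ "K powr p"]) (simp add: Ap_bound_def I_def)
  next
    assume "\<exists>C\<ge>0. \<forall>Q\<in>cubes. Ap_bound A (\<lambda>x. matrix_inv (A x)) p q C Q"
    then obtain C where C: "0 \<le> C" "\<And>Q. Q \<in> cubes \<Longrightarrow> I Q \<le> ennreal C"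
      by (auto simp: Ap_bound_def I_def)
    have "Ap_characteristic p W \<le> ennreal (C powr (1 / p))"
      unfolding char
    proof (rule SUP_least)
      fix Q :: "(real^'n) set" assume "Q \<in> cubes"
      then have "ennreal_powr (I Q) (1 / p) \<le> ennreal_powr (ennreal C) (1 / p)"
        using p by (intro ennreal_powr_mono C) auto
      then show "ennreal_powr (I Q) (1 / p) \<le> ennreal (C powr (1 / p))"
        using C by (simp add: ennreal_powr_ennreal)
    qed
    also have "\<dots> < \<infinity>" by simp
    finally show "Ap_characteristic p W < \<infinity>" .
  qed
qed

lemma matrix_pair_pd:
  fixes A :: "real^'n \<Rightarrow> real^'d^'d"
  assumes A: "A \<in> borel_measurable borel" "\<And>x. pd_matrix (A x)" and p: "1 < p"
  shows "matrix_pair A (\<lambda>x. matrix_inv (A x)) p (conj_exponent p)"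
proof
  have inv: "invertible (A x)" for x by (rule pd_matrix_invertible[OF A(2)])
  show "A \<in> borel_measurable borel" by fact
  show "(\<lambda>x. matrix_inv (A x)) \<in> borel_measurable borel" by (rule measurable_matrix_inv[OF A(1) inv])
  show "transpose (A x) = A x" for x by (rule pd_matrix_symmetric[OF A(2)])
  then show "transpose (matrix_inv (A x)) = matrix_inv (A x)" for x by (intro matrix_inv_symmetric inv)
  show "A x ** matrix_inv (A x) = mat 1" for x by (rule matrix_inv_right[OF inv])
  show "1 < p" by fact
  show "1 < conj_exponent p" "1 / p + 1 / conj_exponent p = 1"
    using p by (auto simp: conj_exponent_def field_simps)
qed

lemma pd_matrix_scaleR: "0 < c \<Longrightarrow> pd_matrix A \<Longrightarrow> pd_matrix (c *\<^sub>R A)"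
  by (simp add: pd_matrix_def transpose_scalar scaleR_matrix_vector_assoc[symmetric])

lemma pd_imp_psd: "pd_matrix A \<Longrightarrow> psd_matrix A"
  unfolding pd_matrix_def psd_matrix_def by (metis inner_zero_left less_imp_le order_refl)

lemma matrix_weightI:
  assumes "W \<in> borel_measurable borel" "\<And>x. pd_matrix (W x)"
  shows "matrix_weight W"
  using assms unfolding matrix_weight_def
  by (auto intro: pd_imp_psd measurable_completion)

text \<open>On nonmeasurable functions \<open>esssup\<close> is the top element, so an upper bound
  for it has to come with measurability; \<open>AE_esssup_cube\<close> reads bounds in the other
  direction.\<close>

lemma esssup_cube_le:
  fixes f :: "real^'n \<Rightarrow> ennreal"
  assumes Q: "Q \<in> cubes" and f: "f \<in> borel_measurable borel" and le: "AE x in lborel. x \<in> Q \<longrightarrow> f x \<le> c"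
  shows "esssup (restrict_space lebesgue Q) f \<le> c"
proof (rule esssup_I)
  have f': "f \<in> borel_measurable lebesgue" by (rule measurable_completion) (use f in simp)
  then show "f \<in> borel_measurable (restrict_space lebesgue Q)" by (rule measurable_restrict_space1)
  have "Q \<inter> space lebesgue \<in> sets lebesgue" using cube_lborel[OF Q] by simp
  then show "AE x in restrict_space lebesgue Q. f x \<le> c"
    using le by (simp add: AE_restrict_space_iff AE_completion_iff)
qed

lemma AE_esssup_cube:
  fixes f :: "real^'n \<Rightarrow> ennreal"
  assumes Q: "Q \<in> cubes" and le: "esssup (restrict_space lebesgue Q) f \<le> c"
  shows "AE x in lborel. x \<in> Q \<longrightarrow> f x \<le> c"
proof -
  have "Q \<inter> space lebesgue \<in> sets lebesgue" using cube_lborel[OF Q] by simp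
  moreover have "AE x in restrict_space lebesgue Q. f x \<le> c"
    using esssup_AE[of f "restrict_space lebesgue Q"] by eventually_elim (use le in order)
  ultimately show ?thesis by (simp add: AE_restrict_space_iff AE_completion_iff)
qed

section \<open>Scalar multiples of a weight\<close>

lemma matrix_mult_scaleR: "(c *\<^sub>R A) ** (B :: real^'d^'d) = c *\<^sub>R (A ** B)" "A ** (c *\<^sub>R B) = c *\<^sub>R (A ** B)"
  by (simp_all add: vec_eq_iff matrix_matrix_mult_def sum_distrib_left mult_ac)

lemma matrix_inv_scaleR:
  fixes A :: "real^'d^'d"
  assumes "invertible A" "c \<noteq> 0"
  shows "matrix_inv (c *\<^sub>R A) = (1 / c) *\<^sub>R matrix_inv A"
  by (rule matrix_inv_unique) (simp add: matrix_mult_scaleR matrix_inv_right assms)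

lemma conj_diag_scaleR: "c *\<^sub>R conj_diag P l = conj_diag P (\<chi> i. c * l $ i)"
proof -
  have "diag_matrix (\<chi> i. c * l $ i) = c *\<^sub>R diag_matrix l" by (simp add: diag_matrix_def vec_eq_iff)
  then show ?thesis by (simp add: conj_diag_def matrix_mult_scaleR)
qed

text \<open>In an eigenbasis of \<open>A\<close> the identity is one between scalars:
  \<open>t\<close> enters with the exponents (p - 1) / p and -1 / p', which cancel.\<close>

lemma scalar_factorization:
  fixes A :: "real^'d^'d"
  assumes pd: "pd_matrix A" and t: "0 < t" and p: "1 < p"
  shows "A = psd_powr (t powr (p - 1) *\<^sub>R A) (1 / p) ** psd_powr ((1 / t) *\<^sub>R A) (1 / conj_exponent p)"
proof -
  obtain P l where P: "orthogonal_matrix P" and A: "A = conj_diag P l"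
    using simultaneous_diagonalization[of A A] pd_matrix_symmetric[OF pd] by auto
  have l: "0 < l $ i" for i using conj_diag_eigenvalue_pos[OF P] pd A by simp
  have "(t powr (p - 1) * l $ i) powr (1 / p) * ((1 / t) * l $ i) powr (1 / conj_exponent p) = l $ i" for i
  proof -
    have e: "(p - 1) * (1 / p) = 1 / conj_exponent p" using p by (simp add: conj_exponent_def)
    have "(t powr (p - 1) * l $ i) powr (1 / p) * ((1 / t) * l $ i) powr (1 / conj_exponent p)
      = (t powr (1 / conj_exponent p) * (1 / t) powr (1 / conj_exponent p)) * (l $ i powr (1 / p) * l $ i powr (1 / conj_exponent p))"
      unfolding powr_mult powr_powr e by (simp only: mult_ac)
    also have "t powr (1 / conj_exponent p) * (1 / t) powr (1 / conj_exponent p) = 1"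
      using t by (simp flip: powr_mult)
    also have "l $ i powr (1 / p) * l $ i powr (1 / conj_exponent p) = l $ i"
      using l[of i] conj_exponent[OF p] by (simp flip: powr_add)
    finally show ?thesis by simp
  qed
  then show ?thesis
    unfolding A conj_diag_scaleR psd_powr_conj_diag[OF P] conj_diag_mult[OF P] by simp
qed

lemma factorization_of_Ap:
  fixes W :: "real^'n \<Rightarrow> real^'d^'d"
  assumes p: "1 < p" and W: "W \<in> matrix_Ap p"
  shows "\<exists>W\<^sub>0 W\<^sub>1 :: real^'n \<Rightarrow> real^'d^'d.
       W\<^sub>0 \<in> matrix_A1 \<and> W\<^sub>1 \<in> matrix_Ainf \<and> commuting_weights W\<^sub>0 W\<^sub>1 \<and>
       (AE x in lebesgue. W x = psd_powr (W\<^sub>0 x) (1 / p) ** psd_powr (W\<^sub>1 x) (1 / conj_exponent p))"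
proof -
  obtain A where A: "A \<in> borel_measurable borel" "\<And>x. pd_matrix (A x)" and WA: "AE x in lborel. W x = A x"
    using matrix_weight_borel W unfolding matrix_Ap_def by blast
  note [measurable] = A(1)
  interpret matrix_pair A "\<lambda>x. matrix_inv (A x)" p "conj_exponent p" by (rule matrix_pair_pd[OF A p])
  obtain C0 where C0: "0 \<le> C0" "\<forall>Q\<in>cubes. Ap_bound A (\<lambda>x. matrix_inv (A x)) p (conj_exponent p) C0 Q"
    using W Ap_characteristic_less_top_iff[OF WA p refl] by (auto simp: matrix_Ap_def)
  obtain t C where tC: "scalar_multiplier t C" using scalar_multiplier_exists[OF C0] by blast
  then have t [measurable]: "t \<in> borel_measurable borel" and t_pos: "\<And>x. 0 < t x"
    and AE_t: "AE x in lborel. \<forall>Q\<in>cubes. x \<in> Q \<longrightarrow>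
      average Q (\<lambda>y. ennreal (op_norm (A x ** matrix_inv (A y)) * t y)) \<le> ennreal (C * t x) \<and>
      average Q (\<lambda>y. ennreal (op_norm (matrix_inv (A x) ** A y) * t y powr (p - 1))) \<le> ennreal (C * t x powr (p - 1))"
    unfolding scalar_multiplier_def by blast+
  have inv: "invertible (A x)" for x by (rule pd_matrix_invertible[OF A(2)])
  have scaled_average: "average Q (\<lambda>y. ennreal (1 / s * f y)) \<le> ennreal C"
    if Q: "Q \<in> cubes" and f: "f \<in> borel_measurable borel" "\<And>y. 0 \<le> f y" and s: "0 < s"
      and le: "average Q (\<lambda>y. ennreal (f y)) \<le> ennreal (C * s)" for Q f s
  proof -
    have "average Q (\<lambda>y. ennreal (1 / s * f y)) = ennreal (1 / s) * average Q (\<lambda>y. ennreal (f y))"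
      using f s by (subst average_cmult[OF avg_set_cube[OF Q], symmetric]) (auto simp flip: ennreal_mult)
    also have "\<dots> \<le> ennreal (1 / s) * ennreal (C * s)" by (intro mult_left_mono le) simp
    also have "\<dots> = ennreal C" using s by (simp flip: ennreal_mult')
    finally show ?thesis .
  qed
  define W0 where "W0 x = t x powr (p - 1) *\<^sub>R A x" for x
  define W1 where "W1 x = (1 / t x) *\<^sub>R A x" for x
  have W0: "W0 \<in> borel_measurable borel" "pd_matrix (W0 x)" and W1: "W1 \<in> borel_measurable borel" "pd_matrix (W1 x)" for x
    unfolding W0_def W1_def using t_pos[of x] by (auto intro!: pd_matrix_scaleR A(2))
  have k0: "op_norm (matrix_inv (W0 x) ** W0 y) = 1 / t x powr (p - 1) * (op_norm (matrix_inv (A x) ** A y) * t y powr (p - 1))" for x y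
    using t_pos[of x] t_pos[of y] by (simp add: W0_def matrix_inv_scaleR[OF inv] matrix_mult_scaleR)
  have k1: "op_norm (W1 x ** matrix_inv (W1 y)) = 1 / t x * (op_norm (A x ** matrix_inv (A y)) * t y)" for x y
  proof -
    have "matrix_inv (W1 y) = t y *\<^sub>R matrix_inv (A y)"
      using t_pos[of y] matrix_inv_scaleR[OF inv, of "1 / t y" y] by (simp add: W1_def)
    then show ?thesis
      using t_pos[of x] t_pos[of y] by (simp add: W1_def matrix_mult_scaleR)
  qed
  have "A1_characteristic W0 \<le> ennreal C"
    unfolding A1_characteristic_def k0
  proof (rule SUP_least, rule esssup_cube_le)
    fix Q :: "(real^'n) set" assume Q: "Q \<in> cubes"
    show "(\<lambda>x. average Q (\<lambda>y. ennreal (1 / t x powr (p - 1) * (op_norm (matrix_inv (A x) ** A y) * t y powr (p - 1))))) \<in> borel_measurable borel"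
    proof -
      have "(\<lambda>(x, y). ennreal (1 / t x powr (p - 1) * (op_norm (matrix_inv (A x) ** A y) * t y powr (p - 1)))) \<in> borel_measurable (borel \<Otimes>\<^sub>M borel)"
        by measurable
      from measurable_average[OF this avg_set_cube[OF Q]] show ?thesis by simp
    qed
    show "AE x in lborel. x \<in> Q \<longrightarrow> average Q (\<lambda>y. ennreal (1 / t x powr (p - 1) * (op_norm (matrix_inv (A x) ** A y) * t y powr (p - 1)))) \<le> ennreal C"
      using AE_t
    proof (eventually_elim, intro impI scaled_average[OF Q])
      fix x
      show "(\<lambda>y. op_norm (matrix_inv (A x) ** A y) * t y powr (p - 1)) \<in> borel_measurable borel" by measurable
    qed (use Q t_pos in \<open>auto simp: less_le\<close>)
  qed
  then have A1: "W0 \<in> matrix_A1"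
    using W0 by (auto simp: matrix_A1_def intro!: matrix_weightI intro: le_less_trans)
  have "Ainf_characteristic W1 \<le> ennreal C"
    unfolding Ainf_characteristic_def k1
  proof (rule SUP_least, rule esssup_cube_le)
    fix Q :: "(real^'n) set" assume Q: "Q \<in> cubes"
    show "(\<lambda>x. average Q (\<lambda>y. ennreal (1 / t x * (op_norm (A x ** matrix_inv (A y)) * t y)))) \<in> borel_measurable borel"
    proof -
      have "(\<lambda>(x, y). ennreal (1 / t x * (op_norm (A x ** matrix_inv (A y)) * t y))) \<in> borel_measurable (borel \<Otimes>\<^sub>M borel)"
        by measurable
      from measurable_average[OF this avg_set_cube[OF Q]] show ?thesis by simp
    qed
    show "AE x in lborel. x \<in> Q \<longrightarrow> average Q (\<lambda>y. ennreal (1 / t x * (op_norm (A x ** matrix_inv (A y)) * t y))) \<le> ennreal C"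
      using AE_t
    proof (eventually_elim, intro impI scaled_average[OF Q])
      fix x
      show "(\<lambda>y. op_norm (A x ** matrix_inv (A y)) * t y) \<in> borel_measurable borel" by measurable
    qed (use Q t_pos in \<open>auto simp: less_imp_le\<close>)
  qed
  then have Ainf: "W1 \<in> matrix_Ainf"
    using W1 by (auto simp: matrix_Ainf_def intro!: matrix_weightI intro: le_less_trans)
  have comm: "commuting_weights W0 W1"
    by (simp add: commuting_weights_def W0_def W1_def matrix_mult_scaleR mult.commute)
  have "AE x in lborel. W x = psd_powr (W0 x) (1 / p) ** psd_powr (W1 x) (1 / conj_exponent p)"
    using WA
  proof eventually_elim
    fix x assume "W x = A x"
    then show "W x = psd_powr (W0 x) (1 / p) ** psd_powr (W1 x) (1 / conj_exponent p)"
      unfolding W0_def W1_def using scalar_factorization[OF A(2) t_pos p] by simp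
  qed
  then show ?thesis using A1 Ainf comm by (auto simp: AE_completion_iff)
qed

text \<open>Commutation provides a common eigenbasis for each of the two pairs, in which products,
  powers and inverses act on eigenvalues. Matrices from different pairs need not commute, which is
  why the interpolation lemma allows two different bases.\<close>

lemma op_norm_factorization_le:
  fixes A0 A1 B0 B1 :: "real^'d^'d"
  assumes pd: "pd_matrix A0" "pd_matrix A1" "pd_matrix B0" "pd_matrix B1"
    and comm: "A0 ** A1 = A1 ** A0" "B0 ** B1 = B1 ** B0" and p: "1 < p"
  defines "r \<equiv> 1 / p" and "s \<equiv> 1 / conj_exponent p"
  shows "op_norm ((psd_powr A0 r ** psd_powr A1 s) ** matrix_inv (psd_powr B0 r ** psd_powr B1 s))
    \<le> op_norm (A0 ** matrix_inv B0) powr r * op_norm (A1 ** matrix_inv B1) powr s"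
proof -
  have rs: "0 \<le> r" "r \<le> 1" "s = 1 - r" using p conj_exponent[OF p] by (auto simp: r_def s_def)
  obtain P a0 a1 where P: "orthogonal_matrix P" and A: "A0 = conj_diag P a0" "A1 = conj_diag P a1"
    using simultaneous_diagonalization[of A0 A1] pd comm by (auto simp: pd_matrix_symmetric)
  obtain Q b0 b1 where Q: "orthogonal_matrix Q" and B: "B0 = conj_diag Q b0" "B1 = conj_diag Q b1"
    using simultaneous_diagonalization[of B0 B1] pd comm by (auto simp: pd_matrix_symmetric)
  have pos: "0 < a0 $ i" "0 < a1 $ i" "0 < b0 $ i" "0 < b1 $ i" for i
    using conj_diag_eigenvalue_pos[OF P] conj_diag_eigenvalue_pos[OF Q] pd unfolding A B by auto
  then have nz: "a0 $ i \<noteq> 0" "a1 $ i \<noteq> 0" "b0 $ i \<noteq> 0" "b1 $ i \<noteq> 0" for i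
    by (metis less_irrefl)+
  define c0 where "c0 = (\<chi> i. 1 / b0 $ i)"
  define c1 where "c1 = (\<chi> i. 1 / b1 $ i)"
  have "psd_powr A0 r ** psd_powr A1 s = conj_diag P (\<chi> i. a0 $ i powr r * a1 $ i powr s)"
    unfolding A psd_powr_conj_diag[OF P] conj_diag_mult[OF P] by simp
  moreover have "matrix_inv (psd_powr B0 r ** psd_powr B1 s) = conj_diag Q (\<chi> i. c0 $ i powr r * c1 $ i powr s)"
    unfolding B psd_powr_conj_diag[OF Q] conj_diag_mult[OF Q]
    by (subst matrix_inv_conj_diag[OF Q]) (auto simp: nz c0_def c1_def powr_divide)
  moreover have "matrix_inv B0 = conj_diag Q c0" "matrix_inv B1 = conj_diag Q c1"
    unfolding B c0_def c1_def by (auto intro!: matrix_inv_conj_diag[OF Q] nz)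
  moreover have "op_norm (conj_diag P (\<chi> i. a0 $ i powr r * a1 $ i powr (1 - r)) ** conj_diag Q (\<chi> i. c0 $ i powr r * c1 $ i powr (1 - r)))
    \<le> op_norm (conj_diag P a0 ** conj_diag Q c0) powr r * op_norm (conj_diag P a1 ** conj_diag Q c1) powr (1 - r)"
    using pos rs by (intro op_norm_interpolation[OF P Q]) (auto simp: c0_def c1_def)
  ultimately show ?thesis by (simp add: A rs(3))
qed

lemma Ap_of_factorization:
  fixes W W\<^sub>0 W\<^sub>1 :: "real^'n \<Rightarrow> real^'d^'d"
  assumes p: "1 < p" and W: "matrix_weight W" and W0: "W\<^sub>0 \<in> matrix_A1" and W1: "W\<^sub>1 \<in> matrix_Ainf"
    and comm: "commuting_weights W\<^sub>0 W\<^sub>1"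
    and eq: "AE x in lebesgue. W x = psd_powr (W\<^sub>0 x) (1 / p) ** psd_powr (W\<^sub>1 x) (1 / conj_exponent p)"
  shows "W \<in> matrix_Ap p"
proof -
  define q where "q = conj_exponent p"
  obtain A where A: "A \<in> borel_measurable borel" "\<And>x. pd_matrix (A x)" and WA: "AE x in lborel. W x = A x"
    using matrix_weight_borel[OF W] by blast
  obtain A0 where A0: "A0 \<in> borel_measurable borel" "\<And>x. pd_matrix (A0 x)" and WA0: "AE x in lborel. W\<^sub>0 x = A0 x"
    using matrix_weight_borel W0 unfolding matrix_A1_def by blast
  obtain A1 where A1: "A1 \<in> borel_measurable borel" "\<And>x. pd_matrix (A1 x)" and WA1: "AE x in lborel. W\<^sub>1 x = A1 x"
    using matrix_weight_borel W1 unfolding matrix_Ainf_def by blast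
  interpret A: matrix_pair A "\<lambda>x. matrix_inv (A x)" p q unfolding q_def by (rule matrix_pair_pd[OF A p])
  interpret A0: matrix_pair A0 "\<lambda>x. matrix_inv (A0 x)" p q unfolding q_def by (rule matrix_pair_pd[OF A0 p])
  interpret A1: matrix_pair A1 "\<lambda>x. matrix_inv (A1 x)" p q unfolding q_def by (rule matrix_pair_pd[OF A1 p])
  define good where "good x \<longleftrightarrow> A0 x ** A1 x = A1 x ** A0 x \<and> A x = psd_powr (A0 x) (1 / p) ** psd_powr (A1 x) (1 / q)" for x
  have AE_good: "AE x in lborel. good x"
    using WA WA0 WA1 comm[unfolded commuting_weights_def AE_completion_iff] eq[unfolded AE_completion_iff]
    by eventually_elim (auto simp: good_def q_def)
  obtain C0 where C0: "A1_characteristic W\<^sub>0 \<le> ennreal C0" "0 \<le> C0"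
    using W0 by (cases "A1_characteristic W\<^sub>0") (auto simp: matrix_A1_def)
  obtain C1 where C1: "Ainf_characteristic W\<^sub>1 \<le> ennreal C1" "0 \<le> C1"
    using W1 by (cases "Ainf_characteristic W\<^sub>1") (auto simp: matrix_Ainf_def)
  define d where "d = domination_const CARD('d) 1"
  have d: "0 \<le> d" by (simp add: d_def domination_const_def)
  have "Ap_bound A (\<lambda>x. matrix_inv (A x)) p q (C1 powr (p / q) * (d * C0 * real CARD('d))) Q" if Q: "Q \<in> cubes" for Q
  proof -
    have aQ: "avg_set Q" by (rule avg_set_cube[OF Q])
    \<comment> \<open>The A_1 condition is read at the point y, with the average over the other
      variable; transposing the symmetric factors identifies |A0(y)^-1 A0(x)| with |A0(x)
      A0(y)^-1|.\<close>
    have AE0: "AE y in lborel. y \<in> Q \<longrightarrow> average Q (\<lambda>x. ennreal (op_norm (A0 x ** matrix_inv (A0 y)))) \<le> ennreal C0"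
    proof -
      have "AE y in lborel. y \<in> Q \<longrightarrow> average Q (\<lambda>x. ennreal (op_norm (matrix_inv (W\<^sub>0 y) ** W\<^sub>0 x))) \<le> ennreal C0"
        using C0(1) unfolding A1_characteristic_def SUP_le_iff by (intro AE_esssup_cube Q) (use Q in blast)
      then show ?thesis
        using WA0
      proof eventually_elim
        fix y assume y: "y \<in> Q \<longrightarrow> average Q (\<lambda>x. ennreal (op_norm (matrix_inv (W\<^sub>0 y) ** W\<^sub>0 x))) \<le> ennreal C0" "W\<^sub>0 y = A0 y"
        have "average Q (\<lambda>x. ennreal (op_norm (matrix_inv (W\<^sub>0 y) ** W\<^sub>0 x))) = average Q (\<lambda>x. ennreal (op_norm (A0 x ** matrix_inv (A0 y))))"
          unfolding y(2) A0.kernel_swap using WA0 by (intro average_cong_AE[OF aQ]) (auto elim!: eventually_mono)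
        then show "y \<in> Q \<longrightarrow> average Q (\<lambda>x. ennreal (op_norm (A0 x ** matrix_inv (A0 y)))) \<le> ennreal C0"
          using y by simp
      qed
    qed
    have AE1: "AE x in lborel. x \<in> Q \<longrightarrow> average Q (\<lambda>y. ennreal (op_norm (A1 x ** matrix_inv (A1 y)))) \<le> ennreal C1"
    proof -
      have "AE x in lborel. x \<in> Q \<longrightarrow> average Q (\<lambda>y. ennreal (op_norm (W\<^sub>1 x ** matrix_inv (W\<^sub>1 y)))) \<le> ennreal C1"
        using C1(1) unfolding Ainf_characteristic_def SUP_le_iff by (intro AE_esssup_cube Q) (use Q in blast)
      then show ?thesis
        using WA1
      proof eventually_elim
        fix x assume x: "x \<in> Q \<longrightarrow> average Q (\<lambda>y. ennreal (op_norm (W\<^sub>1 x ** matrix_inv (W\<^sub>1 y)))) \<le> ennreal C1" "W\<^sub>1 x = A1 x"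
        have "average Q (\<lambda>y. ennreal (op_norm (W\<^sub>1 x ** matrix_inv (W\<^sub>1 y)))) = average Q (\<lambda>y. ennreal (op_norm (A1 x ** matrix_inv (A1 y))))"
          unfolding x(2) using WA1 by (intro average_cong_AE[OF aQ]) (auto elim!: eventually_mono)
        then show "x \<in> Q \<longrightarrow> average Q (\<lambda>y. ennreal (op_norm (A1 x ** matrix_inv (A1 y)))) \<le> ennreal C1"
          using x by simp
      qed
    qed
    \<comment> \<open>A single good point bounds |A0(x) v| by a multiple of the kernel at y0, and so
      makes its average finite, as \<open>reducing_basis\<close> asks.\<close>
    obtain y0 where y0: "average Q (\<lambda>x. ennreal (op_norm (A0 x ** matrix_inv (A0 y0)))) \<le> ennreal C0"
    proof (rule ccontr)
      assume "\<not> thesis"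
      then have "AE y in lborel. y \<notin> Q" using AE0 that by (auto elim!: eventually_mono)
      then have "emeasure lborel Q = 0" using cube_lborel[OF Q] by (subst (asm) AE_iff_null) auto
      then show False using avg_setD[OF aQ] by simp
    qed
    have fin: "average Q (\<lambda>x. ennreal (norm (A0 x *v v) powr 1)) < top" for v
    proof -
      have "average Q (\<lambda>x. ennreal (norm (A0 x *v v) powr 1)) \<le> average Q (\<lambda>x. ennreal (norm (A0 y0 *v v)) * ennreal (op_norm (A0 x ** matrix_inv (A0 y0))))"
      proof (rule average_mono[OF aQ])
        fix x
        have "A0 x *v v = (A0 x ** matrix_inv (A0 y0)) *v (A0 y0 *v v)"
          by (simp add: matrix_vector_mul_assoc A0.B_A flip: matrix_mul_assoc)
        then show "ennreal (norm (A0 x *v v) powr 1) \<le> ennreal (norm (A0 y0 *v v)) * ennreal (op_norm (A0 x ** matrix_inv (A0 y0)))"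
          using norm_mult_le_op_norm[of "A0 x ** matrix_inv (A0 y0)" "A0 y0 *v v"]
          by (simp add: mult.commute ennreal_leI flip: ennreal_mult)
      qed
      also have "\<dots> = ennreal (norm (A0 y0 *v v)) * average Q (\<lambda>x. ennreal (op_norm (A0 x ** matrix_inv (A0 y0))))"
        using A0(1) by (intro average_cmult aQ) measurable
      also have "\<dots> < top" using y0 by (auto simp: ennreal_mult_less_top intro: le_less_trans)
      finally show ?thesis .
    qed
    \<comment> \<open>A reducing basis with exponent 1 for \<open>A0\<close>, used with M =
      A0(y)^-1: for almost every y in \<open>Q\<close> the average is at most C0, which leaves a
      majorant depending on x alone.\<close>
    obtain v :: "'d \<Rightarrow> real^'d" where v: "\<And>i. average Q (\<lambda>x. ennreal (norm (A0 x *v v i) powr 1)) \<le> 1"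
      and dom: "\<And>M x. ennreal (op_norm (A0 x ** M) powr 1) \<le>
        ennreal (domination_const CARD('d) 1) * average Q (\<lambda>z. ennreal (op_norm (A0 z ** M) powr 1)) *
        (\<Sum>i\<in>UNIV. ennreal (norm (A0 x *v v i) powr 1))"
      by (rule reducing_basis[OF zero_less_one aQ A0(1) pd_matrix_invertible[OF A0(2)] fin]) (rule that)
    define m where "m x = (\<Sum>i\<in>UNIV. ennreal (norm (A0 x *v v i) powr 1))" for x
    have m_meas [measurable]: "m \<in> borel_measurable borel" unfolding m_def using A0(1) by measurable
    have avg_m: "average Q m \<le> ennreal (real CARD('d))"
    proof -
      have "average Q m = (\<Sum>i\<in>UNIV. average Q (\<lambda>x. ennreal (norm (A0 x *v v i) powr 1)))"
        unfolding m_def using A0(1) by (intro average_sum aQ) measurable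
      also have "\<dots> \<le> (\<Sum>i\<in>(UNIV::'d set). 1)" by (intro sum_mono v)
      finally show ?thesis by (simp add: ennreal_of_nat_eq_real_of_nat)
    qed
    have kernel0: "ennreal (op_norm (A0 x ** matrix_inv (A0 y))) \<le> ennreal (d * C0) * m x"
      if "average Q (\<lambda>x. ennreal (op_norm (A0 x ** matrix_inv (A0 y)))) \<le> ennreal C0" for x y
    proof -
      have "ennreal (op_norm (A0 x ** matrix_inv (A0 y))) \<le> ennreal d * average Q (\<lambda>z. ennreal (op_norm (A0 z ** matrix_inv (A0 y)))) * m x"
        using dom[of x "matrix_inv (A0 y)"] by (simp add: m_def d_def)
      also have "\<dots> \<le> ennreal d * ennreal C0 * m x"
        by (intro mult_right_mono mult_left_mono that) auto
      finally show ?thesis using d C0(2) by (simp add: ennreal_mult)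
    qed
    \<comment> \<open>Raising the interpolated bound to the power q gives k0^(q/p) k1. The
      A_infinity condition bounds the average of k1 in y, and the outer power p / q restores the
      first power of \<open>m\<close>, whose average is at most the dimension.\<close>
    have "average Q (\<lambda>x. ennreal_powr (average Q (\<lambda>y. ennreal (op_norm (A x ** matrix_inv (A y)) powr q))) (p / q))
      \<le> average Q (\<lambda>x. ennreal (C1 powr (p / q) * (d * C0)) * m x)"
    proof (rule average_mono_AE[OF aQ], use AE1 AE_good in eventually_elim, rule impI)
      fix x assume x: "x \<in> Q \<longrightarrow> average Q (\<lambda>y. ennreal (op_norm (A1 x ** matrix_inv (A1 y)))) \<le> ennreal C1" "good x" "x \<in> Q"
      have "average Q (\<lambda>y. ennreal (op_norm (A x ** matrix_inv (A y)) powr q)) \<le>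
        average Q (\<lambda>y. ennreal_powr (ennreal (d * C0) * m x) (q / p) * ennreal (op_norm (A1 x ** matrix_inv (A1 y))))"
      proof (rule average_mono_AE[OF aQ], use AE0 AE_good in eventually_elim, rule impI)
        fix y assume y: "y \<in> Q \<longrightarrow> average Q (\<lambda>x. ennreal (op_norm (A0 x ** matrix_inv (A0 y)))) \<le> ennreal C0" "good y" "y \<in> Q"
        let ?k0 = "op_norm (A0 x ** matrix_inv (A0 y))" and ?k1 = "op_norm (A1 x ** matrix_inv (A1 y))"
        have "op_norm (A x ** matrix_inv (A y)) \<le> ?k0 powr (1 / p) * ?k1 powr (1 / q)"
          using op_norm_factorization_le[OF A0(2) A1(2) A0(2) A1(2) _ _ p, of x x y y] x(2) y(2)
          by (simp add: good_def q_def)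
        then have "op_norm (A x ** matrix_inv (A y)) powr q \<le> (?k0 powr (1 / p) * ?k1 powr (1 / q)) powr q"
          using A.q by (intro powr_mono2) auto
        also have "\<dots> = ?k0 powr (q / p) * ?k1"
          using A.q by (simp add: powr_mult powr_powr)
        finally have "ennreal (op_norm (A x ** matrix_inv (A y)) powr q) \<le> ennreal (?k0 powr (q / p)) * ennreal ?k1"
          by (simp add: ennreal_leI flip: ennreal_mult)
        also have "ennreal (?k0 powr (q / p)) = ennreal_powr (ennreal ?k0) (q / p)"
          by (simp add: ennreal_powr_ennreal)
        also have "\<dots> \<le> ennreal_powr (ennreal (d * C0) * m x) (q / p)"
          using y A.q_div_p(3,4) by (intro ennreal_powr_mono kernel0) auto
        finally show "ennreal (op_norm (A x ** matrix_inv (A y)) powr q) \<le> ennreal_powr (ennreal (d * C0) * m x) (q / p) * ennreal ?k1"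
          by (simp add: mult_right_mono)
      qed
      also have "\<dots> = ennreal_powr (ennreal (d * C0) * m x) (q / p) * average Q (\<lambda>y. ennreal (op_norm (A1 x ** matrix_inv (A1 y))))"
        by (intro average_cmult aQ) measurable
      also have "\<dots> \<le> ennreal_powr (ennreal (d * C0) * m x) (q / p) * ennreal C1"
        using x by (intro mult_left_mono) auto
      finally have "ennreal_powr (average Q (\<lambda>y. ennreal (op_norm (A x ** matrix_inv (A y)) powr q))) (p / q) \<le>
        ennreal_powr (ennreal_powr (ennreal (d * C0) * m x) (q / p) * ennreal C1) (p / q)"
        using A.q_div_p(3,4) by (intro ennreal_powr_mono) auto
      also have "\<dots> = (ennreal (d * C0) * m x) * ennreal (C1 powr (p / q))"
        using A.q_div_p(3,4) C1(2) unfolding ennreal_powr_mult[of "ennreal_powr _ _"] ennreal_powr_powr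
        by (simp add: ennreal_powr_ennreal)
      also have "\<dots> = ennreal (C1 powr (p / q) * (d * C0)) * m x"
        using d C0(2) by (simp add: ennreal_mult mult_ac)
      finally show "ennreal_powr (average Q (\<lambda>y. ennreal (op_norm (A x ** matrix_inv (A y)) powr q))) (p / q) \<le> ennreal (C1 powr (p / q) * (d * C0)) * m x" .
    qed
    also have "\<dots> = ennreal (C1 powr (p / q) * (d * C0)) * average Q m"
      by (intro average_cmult aQ) measurable
    also have "\<dots> \<le> ennreal (C1 powr (p / q) * (d * C0)) * ennreal (real CARD('d))"
      by (intro mult_left_mono avg_m) simp
    also have "\<dots> = ennreal (C1 powr (p / q) * (d * C0 * real CARD('d)))"
      using d C0(2) by (simp add: mult.assoc flip: ennreal_mult)
    finally show ?thesis by (simp add: Ap_bound_def)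
  qed
  then have "\<exists>C\<ge>0. \<forall>Q\<in>cubes. Ap_bound A (\<lambda>x. matrix_inv (A x)) p q C Q"
    using d C0(2) by (intro exI[of _ "C1 powr (p / q) * (d * C0 * real CARD('d))"]) auto
  then show ?thesis
    using W Ap_characteristic_less_top_iff[OF WA p q_def] by (simp add: matrix_Ap_def)
qed

theorem theorem1p3:
  fixes p :: real and W :: "real^'n \<Rightarrow> real^'d^'d"
  assumes "1 < p" and "matrix_weight W"
  shows "W \<in> matrix_Ap p \<longleftrightarrow>
    (\<exists>W\<^sub>0 W\<^sub>1 :: real^'n \<Rightarrow> real^'d^'d.
       W\<^sub>0 \<in> matrix_A1 \<and> W\<^sub>1 \<in> matrix_Ainf \<and> commuting_weights W\<^sub>0 W\<^sub>1 \<and>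
       (AE x in lebesgue. W x = psd_powr (W\<^sub>0 x) (1 / p) ** psd_powr (W\<^sub>1 x) (1 / conj_exponent p)))"
  using factorization_of_Ap[OF assms(1)] Ap_of_factorization[OF assms] by blast

end
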